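(* For each of the following seven families of group presentations (each group being given by the displayed generators $S$ and defining relations; the Hermann–Mauguin name of the wallpaper group is listed in front of each presentation, and the Schläfli symbol of the common non-oriented Cayley graph names the family), the spherical growth series $\Delta(z)$, the spherical growth function $\delta(n)$ and the cumulative growth function $\gamma(n)$ of the group with respect to the displayed generating set $S$ are as stated. 1. Family $3^6$: p1 $=\langle X,Y,Z\mid XYZ=ZYX=1\rangle$; p3 $=\langle S_1,S_2,S_3\mid S_1^3=S_2^3=S_3^3=S_1S_2S_3=1\rangle$. Then $\Delta(z)=\dfrac{z^2+4z+1}{(1-z)^2}$; $\delta(0)=1$ and $\delta(n)=6n$ for $n>0$; $\gamma(n)=1+3n(n+1)$. 2. Family $4^4$: p1 $=\langle X,Y\mid XY=YX\rangle$; p2 $=\langle T_1,T_2,T_3,T_4\mid T_1^2=T_2^2=T_3^2=T_4^2=T_1T_2T_3T_4=1\rangle$; pm $=\langle Y,R,R'\mid R^2=R'^2=1,\ RY=YR,\ R'Y=YR'\rangle$; pg $=\langle P,Q\mid P^2=Q^2\rangle$; pmm $=\langle R_1,R_2,R_3,R_4\mid R_1^2=R_2^2=R_3^2=R_4^2=(R_1R_2)^2=(R_2R_3)^2=(R_3R_4)^2=(R_4R_1)^2=1\rangle$; pgg $=\langle P,O\mid (PO)^2=(P^{-1}O)^2=1\rangle$. Then $\Delta(z)=\dfrac{(1+z)^2}{(1-z)^2}$; $\delta(0)=1$ and $\delta(n)=4n$ for $n>0$; $\gamma(n)=1+2n(n+1)$. 3. Family $6^3$: p2 $=\langle T_1,T_2,T_3\mid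 T_1^2=T_2^2=T_3^2=(T_1T_2T_3)^2=1\rangle$; cm $=\langle P,R\mid R^2=1,\ RP^2=P^2R\rangle$; pmg $=\langle R,T_1,T_2\mid R^2=T_1^2=T_2^2=1,\ T_1RT_1=T_2RT_2\rangle$; p3m1 $=\langle R_1,R_2,R_3\mid R_1^2=R_2^2=R_3^2=(R_1R_2)^3=(R_2R_3)^3=(R_3R_1)^3=1\rangle$. Then $\Delta(z)=\dfrac{z^2+z+1}{(1-z)^2}$; $\delta(0)=1$ and $\delta(n)=3n$ for $n>0$; $\gamma(n)=1+\tfrac32 n(n+1)$. 4. Family $(3.6)^2$: p3 $=\langle S_1,S_2\mid S_1^3=S_2^3=(S_1S_2)^3=1\rangle$. Then $\Delta(z)=\dfrac{-2z^5+3z^4+6z^3+6z^2+4z+1}{(1-z^2)^2}$; $\delta(0)=1$, $\delta(1)=4$, and for $n>1$: $\delta(n)=5n-2$ if $n$ is even, $\delta(n)=4n+2$ if $n$ is odd; $\gamma(0)=1$, and for $n>1$: $\gamma(n)=\frac{9n^2+10n-4}{4}$ if $n$ is even, $\gamma(n)=\frac{9n^2+8n+3}{4}$ if $n$ is odd. 5. Family $4.8^2$: cmm $=\langle R_1,R_2,T\mid R_1^2=R_2^2=T^2=(R_1R_2)^2=(R_1TR_2T)^2=1\rangle$; p4 $=\langle S,T\mid S^4=T^2=(ST)^4=1\rangle$; p4m $=\langle R,R_1,R_2\mid R^2=R_1^2=R_2^2=(RR_1)^4=(R_1R_2)^2=(R_2R)^4=1\rangle$; p4g $=\langle R,S\mid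 R^2=S^4=(RS^{-1}RS)^2=1\rangle$. Then $\Delta(z)=\dfrac{(z^2+1)(z+1)^2}{(1-z)^2(1+z+z^2)}$; $\delta(0)=1$ and for $n>0$: $\delta(n)=\frac{8n}{3},\ \frac{8n+1}{3},\ \frac{8n-1}{3}$ according as $n\equiv 0,1,2 \pmod 3$; for $n>0$: $\gamma(n)=\frac{3+4n(n+1)}{3},\ \frac{4+4n(n+1)}{3},\ \frac{3+4n(n+1)}{3}$ according as $n\equiv 0,1,2\pmod 3$. 6. Family $3.12^2$: p31m $=\langle R,S\mid R^2=S^3=(RS^{-1}RS)^3=1\rangle$; p6 $=\langle S,T\mid S^3=T^2=(ST)^6=1\rangle$. Then $\Delta(z)=\dfrac{-2z^8+4z^7-3z^6+5z^5-z^4+3z^3+z^2+z+1}{(1-z)^2(1+z^2)^2}$; $\delta(0)=1$, $\delta(1)=3$, $\delta(2)=4$, and for $n>2$: $\delta(n)=\frac{5n-4}{2},\ \frac{9n+3}{4},\ 2n+2,\ \frac{9n-3}{4}$ according as $n\equiv 0,1,2,3\pmod 4$; $\gamma(0)=1$, $\gamma(1)=4$, and for $n>2$: $\gamma(n)=\frac{9n^2+10n-8}{8},\ \frac{9n^2+10n-3}{8},\ \frac{9n^2+8n+12}{8},\ \frac{9n^2+8n+7}{8}$ according as $n\equiv 0,1,2,3\pmod 4$. 7. Family $4.6.12$: p6m $=\langle R,R_1,R_2\mid R^2=R_1^2=R_2^2=(R_1R_2)^3=(R_2R)^2=(RR_1)^6=1\rangle$. Then $\Delta(z)=\dfrac{(z^2+z+1)(z^2-z+1)(z+1)^2}{(1-z^5)(1-z)}$;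 $\delta(0)=1$ and for $n>0$: $\delta(n)=\frac{12n}{5},\ \frac{12n+3}{5},\ \frac{12n+1}{5},\ \frac{12n-1}{5},\ \frac{12n-3}{5}$ according as $n\equiv 0,1,2,3,4\pmod 5$; for $n>0$: $\gamma(n)=\frac{5+6n(n+1)}{5},\ \frac{8+6n(n+1)}{5},\ \frac{9+6n(n+1)}{5},\ \frac{8+6n(n+1)}{5},\ \frac{5+6n(n+1)}{5}$ according as $n\equiv 0,1,2,3,4\pmod 5$.
   Context: For a group $G$ with finite generating set $S$, the length $|g|=|g|_S$ of $g\in G$ is the smallest $n\ge 0$ such that $g$ is a product of $n$ elements of $S\cup S^{-1}$; equivalently it is the combinatorial distance from $1$ to $g$ in the non-oriented Cayley graph of $(G,S)$. The spherical growth function is $\delta(n)=|\{g\in G: |g|=n\}|$, the cumulative growth function is $\gamma(n)=|\{g\in G:|g|\le n\}|$, and the spherical growth series is $\Delta(z)=\sum_{n\ge 0}\delta(n)z^n$. The 20 presentations listed are presentations of the 17 wallpaper groups (discrete cocompact groups of isometries of the Euclidean plane), three of them (p1, p2, p3) being listed with two different generating sets. Presentations in the same family have isomorphic non-oriented, unlabelled Cayley graphs, namely the edge graph of the planar tiling with the given Schläfli symbol. *)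

theory Defs
  imports
    "HOL-Algebra.Generated_Groups"
    "HOL-Computational_Algebra.Formal_Power_Series"
begin

section \<open>Groups given by generators and relations\<close>

datatype 'g letter = Gen 'g | Inv 'g

type_synonym 'g word = "'g letter list"

definition words :: "'g set \<Rightarrow> 'g word set" where
  "words A = lists (Gen ` A \<union> Inv ` A)"

text \<open>A presentation is a set of generators together with a set of defining relations; the pair
  \<open>(u, v)\<close> stands for the relation \<open>u = v\<close>.\<close>

type_synonym 'g presentation = "'g set \<times> ('g word \<times> 'g word) set"

inductive word_eq :: "'g presentation \<Rightarrow> 'g word \<Rightarrow> 'g word \<Rightarrow> bool" for p where
  refl: "word_eq p u u"
| sym: "word_eq p u v \<Longrightarrow> word_eq p v u"
| trans: "word_eq p u v \<Longrightarrow> word_eq p v w \<Longrightarrow> word_eq p u w"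
| cancel_right: "a \<in> fst p \<Longrightarrow> word_eq p (u @ [Gen a, Inv a] @ v) (u @ v)"
| cancel_left: "a \<in> fst p \<Longrightarrow> word_eq p (u @ [Inv a, Gen a] @ v) (u @ v)"
| relation: "(r, s) \<in> snd p \<Longrightarrow> word_eq p (u @ r @ v) (u @ s @ v)"

definition word_rel :: "'g presentation \<Rightarrow> ('g word \<times> 'g word) set" where
  "word_rel p = {(u, v). u \<in> words (fst p) \<and> v \<in> words (fst p) \<and> word_eq p u v}"

definition presented_group :: "'g presentation \<Rightarrow> 'g word set monoid" where
  "presented_group p =
     \<lparr>carrier = words (fst p) // word_rel p,
      monoid.mult = (\<lambda>U V. \<Union>u\<in>U. \<Union>v\<in>V. word_rel p `` {u @ v}),
      one = word_rel p `` {[]}\<rparr>"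

definition generating_set :: "'g presentation \<Rightarrow> 'g word set set" where
  "generating_set p = (\<lambda>a. word_rel p `` {[Gen a]}) ` fst p"

section \<open>Growth functions\<close>

text \<open>In the following definition the \<open>LEAST\<close> is meaningful whenever \<open>S\<close> generates \<open>G\<close>
  and \<open>g\<close> is an element of \<open>G\<close>.\<close>

definition word_length :: "('a, 'b) monoid_scheme \<Rightarrow> 'a set \<Rightarrow> 'a \<Rightarrow> nat" where
  "word_length G S g =
     (LEAST n. \<exists>xs. length xs = n \<and> set xs \<subseteq> S \<union> m_inv G ` S \<and>
                    foldr (monoid.mult G) xs \<one>\<^bsub>G\<^esub> = g)"

definition spherical_growth :: "('a, 'b) monoid_scheme \<Rightarrow> 'a set \<Rightarrow> nat \<Rightarrow> nat" where
  "spherical_growth G S n = card {g \<in> carrier G. word_length G S g = n}"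

definition cumulative_growth :: "('a, 'b) monoid_scheme \<Rightarrow> 'a set \<Rightarrow> nat \<Rightarrow> nat" where
  "cumulative_growth G S n = card {g \<in> carrier G. word_length G S g \<le> n}"

definition growth_series :: "('a, 'b) monoid_scheme \<Rightarrow> 'a set \<Rightarrow> real fps" where
  "growth_series G S = Abs_fps (\<lambda>n. real (spherical_growth G S n))"

abbreviation sph :: "'g presentation \<Rightarrow> nat \<Rightarrow> real" where
  "sph p n \<equiv> real (spherical_growth (presented_group p) (generating_set p) n)"

abbreviation cum :: "'g presentation \<Rightarrow> nat \<Rightarrow> real" where
  "cum p n \<equiv> real (cumulative_growth (presented_group p) (generating_set p) n)"

abbreviation series :: "'g presentation \<Rightarrow> real fps" where
  "series p \<equiv> growth_series (presented_group p) (generating_set p)"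

section \<open>The construction yields a group generated by the given generators\<close>

lemma words_simps [simp]:
  "[] \<in> words A"
  "x # u \<in> words A \<longleftrightarrow> x \<in> Gen ` A \<union> Inv ` A \<and> u \<in> words A"
  "u @ v \<in> words A \<longleftrightarrow> u \<in> words A \<and> v \<in> words A"
  by (auto simp: words_def)

lemma equiv_word_rel: "equiv (words (fst p)) (word_rel p)"
proof (rule equivI)
  show "word_rel p \<subseteq> words (fst p) \<times> words (fst p)"
    by (auto simp: word_rel_def)
  show "refl_on (words (fst p)) (word_rel p)"
    by (auto simp: word_rel_def refl_on_def word_eq.refl)
  show "sym (word_rel p)"
    by (auto simp: word_rel_def sym_def word_eq.sym)
  show "trans (word_rel p)"
    unfolding word_rel_def by (rule transI) (auto elim: word_eq.trans)
qed

lemma word_eq_context: "word_eq p u v \<Longrightarrow> word_eq p (x @ u @ y) (x @ v @ y)"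
proof (induction rule: word_eq.induct)
  case (cancel_right a u v)
  show ?case using word_eq.cancel_right[OF cancel_right, of "x @ u" "v @ y"] by simp
next
  case (cancel_left a u v)
  show ?case using word_eq.cancel_left[OF cancel_left, of "x @ u" "v @ y"] by simp
next
  case (relation r s u v)
  show ?case using word_eq.relation[OF relation, of "x @ u" "v @ y"] by simp
next
  case (trans u v w)
  show ?case using trans.IH by (rule word_eq.trans)
qed (simp_all add: word_eq.refl word_eq.sym)

lemma word_eq_append:
  assumes "word_eq p u u'" and "word_eq p v v'"
  shows "word_eq p (u @ v) (u' @ v')"
  using word_eq_context[OF assms(1), of "[]" v] word_eq_context[OF assms(2), of u' "[]"]
  by (simp add: word_eq.trans[of p "u @ v" "u' @ v"])

lemma word_class_eq_iff:
  assumes "u \<in> words (fst p)" and "v \<in> words (fst p)"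
  shows "word_rel p `` {u} = word_rel p `` {v} \<longleftrightarrow> word_eq p u v"
  using eq_equiv_class_iff[OF equiv_word_rel assms] assms by (simp add: word_rel_def)

lemma presented_group_mult:
  assumes "u \<in> words (fst p)" and "v \<in> words (fst p)"
  shows "word_rel p `` {u} \<otimes>\<^bsub>presented_group p\<^esub> word_rel p `` {v} = word_rel p `` {u @ v}"
proof -
  have "word_rel p `` {u' @ v'} = word_rel p `` {u @ v}"
    if "u' \<in> word_rel p `` {u}" "v' \<in> word_rel p `` {v}" for u' v'
  proof -
    have w: "u' \<in> words (fst p)" "v' \<in> words (fst p)" "word_eq p u u'" "word_eq p v v'"
      using that by (auto simp: word_rel_def)
    then have "word_eq p (u' @ v') (u @ v)"
      using word_eq.sym[OF word_eq_append] by blast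
    then show ?thesis
      using w assms by (simp add: word_class_eq_iff)
  qed
  then have "(\<Union>u'\<in>word_rel p `` {u}. \<Union>v'\<in>word_rel p `` {v}. word_rel p `` {u' @ v'})
      = (\<Union>u'\<in>word_rel p `` {u}. \<Union>v'\<in>word_rel p `` {v}. word_rel p `` {u @ v})"
    by (intro SUP_cong HOL.refl)
  moreover have "u \<in> word_rel p `` {u}" "v \<in> word_rel p `` {v}"
    using assms by (simp_all add: word_rel_def word_eq.refl)
  then have "word_rel p `` {u} \<noteq> {}" "word_rel p `` {v} \<noteq> {}"
    by blast+
  ultimately show ?thesis
    by (simp add: presented_group_def)
qed

fun inv_letter :: "'g letter \<Rightarrow> 'g letter" where
  "inv_letter (Gen a) = Inv a"
| "inv_letter (Inv a) = Gen a"

definition inv_word :: "'g word \<Rightarrow> 'g word" where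
  "inv_word u = rev (map inv_letter u)"

lemma inv_word_in_words [simp]: "u \<in> words A \<Longrightarrow> inv_word u \<in> words A"
  by (induction u) (auto simp: inv_word_def)

lemma word_eq_inv_left: "u \<in> words (fst p) \<Longrightarrow> word_eq p (inv_word u @ u) []"
proof (induction u)
  case Nil
  show ?case by (simp add: inv_word_def word_eq.refl)
next
  case (Cons x u)
  have "word_eq p (inv_word u @ [inv_letter x, x] @ u) (inv_word u @ u)"
    using Cons.prems word_eq.cancel_left[of _ p "inv_word u" u]
      word_eq.cancel_right[of _ p "inv_word u" u] by auto
  moreover have "word_eq p (inv_word u @ u) []"
    using Cons by simp
  ultimately have "word_eq p (inv_word u @ [inv_letter x, x] @ u) []"
    by (rule word_eq.trans)
  then show ?case
    by (simp add: inv_word_def)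
qed

lemma carrier_presented_group:
  "carrier (presented_group p) = (\<lambda>u. word_rel p `` {u}) ` words (fst p)"
  by (auto simp: presented_group_def quotient_def)

lemma one_presented_group: "\<one>\<^bsub>presented_group p\<^esub> = word_rel p `` {[]}"
  by (simp add: presented_group_def)

lemma class_in_carrier:
  "u \<in> words (fst p) \<Longrightarrow> word_rel p `` {u} \<in> carrier (presented_group p)"
  unfolding carrier_presented_group by (rule imageI)

lemma carrier_cases:
  assumes "x \<in> carrier (presented_group p)"
  obtains u where "u \<in> words (fst p)" "x = word_rel p `` {u}"
  using assms unfolding carrier_presented_group by (elim imageE) metis

lemma group_presented_group: "group (presented_group p)"
proof (rule groupI)
  fix x y z
  assume x: "x \<in> carrier (presented_group p)"
  obtain u where u: "u \<in> words (fst p)" "x = word_rel p `` {u}"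
    using carrier_cases[OF x] .
  show "\<one>\<^bsub>presented_group p\<^esub> \<otimes>\<^bsub>presented_group p\<^esub> x = x"
    using u by (simp add: one_presented_group presented_group_mult)
  have "word_rel p `` {inv_word u} \<otimes>\<^bsub>presented_group p\<^esub> x = \<one>\<^bsub>presented_group p\<^esub>"
    using u by (simp add: presented_group_mult one_presented_group word_class_eq_iff word_eq_inv_left)
  then show "\<exists>y\<in>carrier (presented_group p). y \<otimes>\<^bsub>presented_group p\<^esub> x = \<one>\<^bsub>presented_group p\<^esub>"
    using class_in_carrier[OF inv_word_in_words[OF u(1)]] by blast
  assume y: "y \<in> carrier (presented_group p)"
  obtain v where v: "v \<in> words (fst p)" "y = word_rel p `` {v}"
    using carrier_cases[OF y] .
  show "x \<otimes>\<^bsub>presented_group p\<^esub> y \<in> carrier (presented_group p)"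
    using u v by (simp add: presented_group_mult class_in_carrier)
  assume z: "z \<in> carrier (presented_group p)"
  obtain w where w: "w \<in> words (fst p)" "z = word_rel p `` {w}"
    using carrier_cases[OF z] .
  show "x \<otimes>\<^bsub>presented_group p\<^esub> y \<otimes>\<^bsub>presented_group p\<^esub> z
      = x \<otimes>\<^bsub>presented_group p\<^esub> (y \<otimes>\<^bsub>presented_group p\<^esub> z)"
    using u v w by (simp add: presented_group_mult)
next
  show "\<one>\<^bsub>presented_group p\<^esub> \<in> carrier (presented_group p)"
    by (simp add: one_presented_group class_in_carrier)
qed

lemma generate_presented_group:
  "generate (presented_group p) (generating_set p) = carrier (presented_group p)"
proof
  interpret group "presented_group p" by (rule group_presented_group)
  have sub: "generating_set p \<subseteq> carrier (presented_group p)"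
    unfolding generating_set_def by (intro image_subsetI class_in_carrier) simp
  then show "generate (presented_group p) (generating_set p) \<subseteq> carrier (presented_group p)"
    by (rule generate_incl)
  have "word_rel p `` {u} \<in> generate (presented_group p) (generating_set p)"
    if "u \<in> words (fst p)" for u
    using that
  proof (induction u)
    case Nil
    show ?case using generate.one[of "presented_group p"] by (simp add: one_presented_group)
  next
    case (Cons x u)
    have "word_rel p `` {[x]} \<in> generate (presented_group p) (generating_set p)"
    proof -
      consider a where "a \<in> fst p" "x = Gen a" | a where "a \<in> fst p" "x = Inv a"
        using Cons.prems by auto
      then show ?thesis
      proof cases
        case (1 a)
        then show ?thesis unfolding generating_set_def by (intro generate.incl) simp
      next
        case (2 a)
        let ?g = "word_rel p `` {[Gen a]}"
        have "word_eq p [Inv a, Gen a] []"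
          using word_eq.cancel_left[of a p "[]" "[]"] 2 by simp
        then have "word_rel p `` {[x]} \<otimes>\<^bsub>presented_group p\<^esub> ?g = \<one>\<^bsub>presented_group p\<^esub>"
          using 2 by (simp add: presented_group_mult one_presented_group word_class_eq_iff)
        then have "inv\<^bsub>presented_group p\<^esub> ?g = word_rel p `` {[x]}"
          using 2 by (intro inv_equality class_in_carrier) simp_all
        moreover have "?g \<in> generating_set p"
          using 2 by (simp add: generating_set_def)
        ultimately show ?thesis
          using generate.inv by metis
      qed
    qed
    then have "word_rel p `` {[x]} \<otimes>\<^bsub>presented_group p\<^esub> word_rel p `` {u}
                 \<in> generate (presented_group p) (generating_set p)"
      using Cons by (intro generate.eng) simp_all
    then show ?case
      using Cons.prems by (simp add: presented_group_mult)
  qed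
  then show "carrier (presented_group p) \<subseteq> generate (presented_group p) (generating_set p)"
    unfolding carrier_presented_group by (intro image_subsetI)
qed

section \<open>The presentations\<close>

datatype gen =
    gX | gY | gZ | gP | gQ | gO
  | gR | gR' | gR1 | gR2 | gR3 | gR4
  | gS | gS1 | gS2 | gS3
  | gT | gT1 | gT2 | gT3 | gT4

definition wpow :: "'g word \<Rightarrow> nat \<Rightarrow> 'g word" where
  "wpow w n = concat (replicate n w)"

text \<open>Names consist of the Hermann--Mauguin symbol of the group followed by the digits of the
  Schlaefli symbol of the Cayley graph.\<close>

definition p1_36 :: "gen presentation" where
  "p1_36 = ({gX, gY, gZ},
     {([Gen gX, Gen gY, Gen gZ], []),
      ([Gen gZ, Gen gY, Gen gX], [])})"

definition p3_36 :: "gen presentation" where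
  "p3_36 = ({gS1, gS2, gS3},
     {(wpow [Gen gS1] 3, []), (wpow [Gen gS2] 3, []), (wpow [Gen gS3] 3, []),
      ([Gen gS1, Gen gS2, Gen gS3], [])})"

definition p1_44 :: "gen presentation" where
  "p1_44 = ({gX, gY},
     {([Gen gX, Gen gY], [Gen gY, Gen gX])})"

definition p2_44 :: "gen presentation" where
  "p2_44 = ({gT1, gT2, gT3, gT4},
     {(wpow [Gen gT1] 2, []), (wpow [Gen gT2] 2, []),
      (wpow [Gen gT3] 2, []), (wpow [Gen gT4] 2, []),
      ([Gen gT1, Gen gT2, Gen gT3, Gen gT4], [])})"

definition pm_44 :: "gen presentation" where
  "pm_44 = ({gY, gR, gR'},
     {(wpow [Gen gR] 2, []), (wpow [Gen gR'] 2, []),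
      ([Gen gR, Gen gY], [Gen gY, Gen gR]),
      ([Gen gR', Gen gY], [Gen gY, Gen gR'])})"

definition pg_44 :: "gen presentation" where
  "pg_44 = ({gP, gQ},
     {(wpow [Gen gP] 2, wpow [Gen gQ] 2)})"

definition pmm_44 :: "gen presentation" where
  "pmm_44 = ({gR1, gR2, gR3, gR4},
     {(wpow [Gen gR1] 2, []), (wpow [Gen gR2] 2, []),
      (wpow [Gen gR3] 2, []), (wpow [Gen gR4] 2, []),
      (wpow [Gen gR1, Gen gR2] 2, []), (wpow [Gen gR2, Gen gR3] 2, []),
      (wpow [Gen gR3, Gen gR4] 2, []), (wpow [Gen gR4, Gen gR1] 2, [])})"

definition pgg_44 :: "gen presentation" where
  "pgg_44 = ({gP, gO},
     {(wpow [Gen gP, Gen gO] 2, []),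
      (wpow [Inv gP, Gen gO] 2, [])})"

definition p2_63 :: "gen presentation" where
  "p2_63 = ({gT1, gT2, gT3},
     {(wpow [Gen gT1] 2, []), (wpow [Gen gT2] 2, []), (wpow [Gen gT3] 2, []),
      (wpow [Gen gT1, Gen gT2, Gen gT3] 2, [])})"

definition cm_63 :: "gen presentation" where
  "cm_63 = ({gP, gR},
     {(wpow [Gen gR] 2, []),
      ([Gen gR] @ wpow [Gen gP] 2, wpow [Gen gP] 2 @ [Gen gR])})"

definition pmg_63 :: "gen presentation" where
  "pmg_63 = ({gR, gT1, gT2},
     {(wpow [Gen gR] 2, []), (wpow [Gen gT1] 2, []), (wpow [Gen gT2] 2, []),
      ([Gen gT1, Gen gR, Gen gT1], [Gen gT2, Gen gR, Gen gT2])})"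

definition p3m1_63 :: "gen presentation" where
  "p3m1_63 = ({gR1, gR2, gR3},
     {(wpow [Gen gR1] 2, []), (wpow [Gen gR2] 2, []), (wpow [Gen gR3] 2, []),
      (wpow [Gen gR1, Gen gR2] 3, []), (wpow [Gen gR2, Gen gR3] 3, []),
      (wpow [Gen gR3, Gen gR1] 3, [])})"

definition p3_3636 :: "gen presentation" where
  "p3_3636 = ({gS1, gS2},
     {(wpow [Gen gS1] 3, []), (wpow [Gen gS2] 3, []),
      (wpow [Gen gS1, Gen gS2] 3, [])})"

definition cmm_488 :: "gen presentation" where
  "cmm_488 = ({gR1, gR2, gT},
     {(wpow [Gen gR1] 2, []), (wpow [Gen gR2] 2, []), (wpow [Gen gT] 2, []),
      (wpow [Gen gR1, Gen gR2] 2, []),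
      (wpow [Gen gR1, Gen gT, Gen gR2, Gen gT] 2, [])})"

definition p4_488 :: "gen presentation" where
  "p4_488 = ({gS, gT},
     {(wpow [Gen gS] 4, []), (wpow [Gen gT] 2, []),
      (wpow [Gen gS, Gen gT] 4, [])})"

definition p4m_488 :: "gen presentation" where
  "p4m_488 = ({gR, gR1, gR2},
     {(wpow [Gen gR] 2, []), (wpow [Gen gR1] 2, []), (wpow [Gen gR2] 2, []),
      (wpow [Gen gR, Gen gR1] 4, []), (wpow [Gen gR1, Gen gR2] 2, []),
      (wpow [Gen gR2, Gen gR] 4, [])})"

definition p4g_488 :: "gen presentation" where
  "p4g_488 = ({gR, gS},
     {(wpow [Gen gR] 2, []), (wpow [Gen gS] 4, []),
      (wpow [Gen gR, Inv gS, Gen gR, Gen gS] 2, [])})"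

definition p31m_31212 :: "gen presentation" where
  "p31m_31212 = ({gR, gS},
     {(wpow [Gen gR] 2, []), (wpow [Gen gS] 3, []),
      (wpow [Gen gR, Inv gS, Gen gR, Gen gS] 3, [])})"

definition p6_31212 :: "gen presentation" where
  "p6_31212 = ({gS, gT},
     {(wpow [Gen gS] 3, []), (wpow [Gen gT] 2, []),
      (wpow [Gen gS, Gen gT] 6, [])})"

definition p6m_4612 :: "gen presentation" where
  "p6m_4612 = ({gR, gR1, gR2},
     {(wpow [Gen gR] 2, []), (wpow [Gen gR1] 2, []), (wpow [Gen gR2] 2, []),
      (wpow [Gen gR1, Gen gR2] 3, []), (wpow [Gen gR2, Gen gR] 2, []),
      (wpow [Gen gR, Gen gR1] 6, [])})"

end

(* Let A, B generate the translation lattice of one of the groups and let C_k represent its cosets.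
   Right multiplication by the generators on the elements A^i B^j C_k is given by a finite table, which
   is a quotient of the Cayley graph as soon as the relations hold in it, and is the Cayley graph
   itself as soon as A and B commute and each C_k x equals its normal form in the presented group;
   these finitely many equations are proved by writing them as products of conjugates of relators.
   The plane of each coset is cut into finitely many cones on which the word length is affine: explicit
   words with repeatable loops bound it from above, and affine functions that are 1-Lipschitz on the
   Cayley graph and vanish at the identity bound it from below. An affine function with slopes r_1, ..., r_d
   and minimum m on a d-dimensional such cone contributes z^m / ((1 - z^r_1) ... (1 - z^r_d)). *)

theory Submission
  imports Defs "HOL-Library.Product_Plus"
begin

section \<open>Coded words and tables\<close>

text \<open>Everything specific to a presentation is a Boolean test that \<open>code_simp\<close>
  evaluates; the theory around these tests proves them sound. Left translation by A and B commutes
  with right multiplication by generators, so a check at one vertex per coset covers all vertices,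
  and a bound at the apex of a cone together with its slopes covers the cone. That A and B satisfy
  no relation besides commutation comes for free: the relations of the presentation act on the
  vertices of the table, so different vertices are different group elements. The graphs within a
  family are isomorphic, but every presentation carries its own certificate; the point groups, and
  with them the number of cosets and the lengths of the shortest translations, differ, so no graph
  isomorphism has to be established. The main obstacle is that the maximum of the affine lower
  bounds may fall below the true distance at vertices near the walls of the cones. Such vertices are
  peeled off as separate rays or points, and the bound is improved there by looking at
  neighbours.\<close>

text \<open>The code \<open>i > 0\<close> stands for the \<open>i\<close>-th generator and \<open>-i\<close> for its inverse. A vertex \<open>((i, j), k)\<close>
  stands for the group element \<open>A\<^sup>i B\<^sup>j C\<^sub>k\<close>, where \<open>A\<close> and \<open>B\<close> span the translation lattice and the
  \<open>C\<^sub>k\<close> represent its cosets.\<close>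

type_synonym code = "int list"
type_synonym vertex = "(int \<times> int) \<times> nat"
type_synonym table = "(int \<times> ((int \<times> int) \<times> nat) list) list"

definition letter_of :: "'g list \<Rightarrow> int \<Rightarrow> 'g letter" where
  "letter_of gs x = (if 0 < x then Gen (gs ! (nat x - 1)) else Inv (gs ! (nat (- x) - 1)))"

definition codes :: "int \<Rightarrow> int list" where
  "codes n = [1..n] @ map uminus [1..n]"

lemma set_codes: "set (codes n) = {x. x \<noteq> 0 \<and> \<bar>x\<bar> \<le> n}"
proof -
  have "x \<in> set (codes n)" if "x \<noteq> 0" "\<bar>x\<bar> \<le> n" for x
    using that by (cases "x > 0") (auto simp: codes_def intro!: image_eqI[of x uminus "- x"])
  then show ?thesis by (auto simp: codes_def)
qed

definition coded :: "int \<Rightarrow> code \<Rightarrow> bool" where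
  "coded n w \<longleftrightarrow> list_all (\<lambda>x. x \<noteq> 0 \<and> \<bar>x\<bar> \<le> n) w"

lemma coded_simps [simp]:
  "coded n []"
  "coded n (x # w) \<longleftrightarrow> x \<noteq> 0 \<and> \<bar>x\<bar> \<le> n \<and> coded n w"
  "coded n (v @ w) \<longleftrightarrow> coded n v \<and> coded n w"
  by (auto simp: coded_def)

lemma coded_set: "coded n w \<longleftrightarrow> set w \<subseteq> set (codes n)"
  by (auto simp: coded_def set_codes list_all_iff)

definition inv_code :: "code \<Rightarrow> code" where
  "inv_code w = rev (map uminus w)"

lemma coded_inv_code [simp]: "coded n (inv_code w) = coded n w"
  by (induction w) (auto simp: inv_code_def)

text \<open>The entry \<open>((i, j), l)\<close> at position \<open>k\<close> of the row of
  \<open>x\<close> encodes C_k x = A^i B^j C_l: the step adds to the lattice part and replaces the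
  coset. A letter without a row fixes every vertex, which keeps the function total.\<close>

fun step :: "table \<Rightarrow> int \<Rightarrow> vertex \<Rightarrow> vertex" where
  "step T x (b, k) =
     (case map_of T x of None \<Rightarrow> (b, k) | Some row \<Rightarrow> (b + fst (row ! k), snd (row ! k)))"

primrec run :: "table \<Rightarrow> code \<Rightarrow> vertex \<Rightarrow> vertex" where
  "run T [] v = v"
| "run T (x # w) v = run T w (step T x v)"

lemma run_append [simp]: "run T (u @ w) v = run T w (run T u v)"
  by (induction u arbitrary: v) auto

definition shift :: "int \<times> int \<Rightarrow> vertex \<Rightarrow> vertex" where
  "shift t v = (t + fst v, snd v)"

lemma shift_simps [simp]: "fst (shift t v) = t + fst v" "snd (shift t v) = snd v"
  "shift t (b, k) = (t + b, k)" "shift 0 v = v"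
  by (auto simp: shift_def)

text \<open>Lattice elements multiply on the left, generators on the right. This equivariance is
  what lets the later tests look only at the vertices \<open>(0, k)\<close>.\<close>

lemma step_shift: "step T x (shift t v) = shift t (step T x v)"
  by (cases v) (auto split: option.split simp: add.assoc)

lemma run_shift: "run T w (shift t v) = shift t (run T w v)"
  by (induction w arbitrary: v) (auto simp: step_shift)

lemma run_eq_shift: "run T w (b, k) = shift b (run T w (0, k))"
  using run_shift[of T w b "(0, k)"] by simp

lemma step_eq_shift: "step T x (b, k) = shift b (step T x (0, k))"
  using step_shift[of T x b "(0, k)"] by simp

text \<open>Running over codes of both signs makes \<open>step T (- x)\<close> a two-sided inverse
  of \<open>step T x\<close>, so letters permute the vertices with coset index below
  \<open>K\<close>.\<close>

definition table_ok :: "int \<Rightarrow> nat \<Rightarrow> table \<Rightarrow> bool" where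
  "table_ok n K T \<longleftrightarrow> 0 < K \<and>
     list_all (\<lambda>x. list_all (\<lambda>k. snd (step T x (0, k)) < K \<and>
       step T (- x) (step T x (0, k)) = (0, k)) [0..<K]) (codes n)"

lemma table_ok_step:
  assumes "table_ok n K T" "x \<in> set (codes n)" "snd v < K"
  shows "snd (step T x v) < K" "step T (- x) (step T x v) = v"
proof -
  obtain b k where v: "v = (b, k)" by (cases v)
  have "snd (step T x (0, k)) < K" "step T (- x) (step T x (0, k)) = (0, k)"
    using assms v by (auto simp: table_ok_def list_all_iff simp del: step.simps)
  then show "snd (step T x v) < K" "step T (- x) (step T x v) = v"
    unfolding v step_eq_shift[of T x b k] step_shift by (auto simp del: step.simps)
qed

lemma table_ok_run:
  assumes "table_ok n K T" "coded n w" "snd v < K"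
  shows "snd (run T w v) < K"
  using assms(2,3)
proof (induction w arbitrary: v)
  case (Cons x w)
  then show ?case
    using table_ok_step(1)[OF assms(1), of x v] by (auto simp: set_codes)
qed auto

text \<open>Every coset is a start vertex, because a relator may be inserted after a prefix that
  ends in any coset.\<close>

definition relators_ok :: "nat \<Rightarrow> table \<Rightarrow> (code \<times> code) list \<Rightarrow> bool" where
  "relators_ok K T rl \<longleftrightarrow>
     list_all (\<lambda>r. list_all (\<lambda>k. run T (fst r) (0, k) = run T (snd r) (0, k)) [0..<K]) rl"

lemma relators_ok_run:
  assumes "relators_ok K T rl" "(r, s) \<in> set rl" "snd v < K"
  shows "run T r v = run T s v"
proof -
  have "run T r (0, snd v) = run T s (0, snd v)"
    using assms by (auto simp: relators_ok_def list_all_iff)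
  then show ?thesis
    using run_eq_shift[of T r "fst v" "snd v"] run_eq_shift[of T s "fst v" "snd v"] by simp
qed

section \<open>Equality certified by products of conjugates of relators\<close>

text \<open>A certificate is a list of pairs \<open>(g, m)\<close>, each standing for the conjugate by \<open>g\<close> of the \<open>m\<close>-th relator
  or, for \<open>m < 0\<close>, of its inverse. The list \<open>iv\<close> contains generators known to be involutions.\<close>

definition norm_code :: "int list \<Rightarrow> int \<Rightarrow> int" where
  "norm_code iv x = (if \<bar>x\<bar> \<in> set iv then \<bar>x\<bar> else x)"

text \<open>For an involution \<open>i\<close> the value \<open>norm_code iv (- i)\<close> is
  \<open>i\<close> itself, so the same comparison cancels inverse pairs and doubled
  involutions.\<close>

definition cons_reduce :: "int list \<Rightarrow> int \<Rightarrow> code \<Rightarrow> code" where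
  "cons_reduce iv x w = (case w of [] \<Rightarrow> [norm_code iv x]
     | y # v \<Rightarrow> if y = norm_code iv (- x) then v else norm_code iv x # w)"

fun reduce :: "int list \<Rightarrow> code \<Rightarrow> code" where
  "reduce iv [] = []"
| "reduce iv (x # w) = cons_reduce iv x (reduce iv w)"

definition relator :: "(code \<times> code) list \<Rightarrow> int \<Rightarrow> code" where
  "relator rl m = (case rl ! (nat \<bar>m\<bar> - 1) of (r, s) \<Rightarrow>
     if 0 < m then r @ inv_code s else inv_code (r @ inv_code s))"

fun conjugates :: "(code \<times> code) list \<Rightarrow> (code \<times> int) list \<Rightarrow> code" where
  "conjugates rl [] = []"
| "conjugates rl ((g, m) # c) = g @ relator rl m @ inv_code g @ conjugates rl c"

text \<open>A word is trivial in the presented group iff it is freely equal to a product of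
  conjugates of relators and their inverses. A true equation therefore always has such a witness,
  and checking it takes only free reduction.\<close>

definition certifies ::
  "int \<Rightarrow> (code \<times> code) list \<Rightarrow> int list \<Rightarrow> (code \<times> int) list \<Rightarrow> code \<Rightarrow> code \<Rightarrow> bool" where
  "certifies n rl iv c u v \<longleftrightarrow>
     list_all (\<lambda>(g, m). coded n g \<and> m \<noteq> 0 \<and> nat \<bar>m\<bar> \<le> length rl) c \<and>
     reduce iv (conjugates rl c) = reduce iv (u @ inv_code v)"

definition power_code :: "code \<Rightarrow> int \<Rightarrow> code" where
  "power_code w i =
     (if 0 \<le> i then concat (replicate (nat i) w) else concat (replicate (nat (- i)) (inv_code w)))"

definition normal_form :: "code \<Rightarrow> code \<Rightarrow> code list \<Rightarrow> vertex \<Rightarrow> code" where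
  "normal_form A B C v = power_code A (fst (fst v)) @ power_code B (snd (fst v)) @ C ! snd v"

text \<open>A pair missing from \<open>cs\<close> defaults to the empty certificate: there both
  sides agree after reduction alone. Equations are demanded for positive letters; those for inverse
  letters follow from \<open>table_ok\<close>. The condition \<open>C ! 0 = []\<close> places the
  identity at the vertex \<open>((0, 0), 0)\<close>.\<close>

definition group_ok :: "int \<Rightarrow> (code \<times> code) list \<Rightarrow> nat \<Rightarrow> table \<Rightarrow> int list \<Rightarrow> code \<Rightarrow> code \<Rightarrow> code list
    \<Rightarrow> (code \<times> int) list \<Rightarrow> ((nat \<times> int) \<times> (code \<times> int) list) list \<Rightarrow> bool" where
  "group_ok n rl K T iv A B C cAB cs \<longleftrightarrow>
     table_ok n K T \<and> relators_ok K T rl \<and>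
     list_all (\<lambda>r. coded n (fst r) \<and> coded n (snd r)) rl \<and>
     list_all (\<lambda>i. 0 < i \<and> i \<le> n \<and> ([i, i], []) \<in> set rl) iv \<and>
     coded n A \<and> coded n B \<and> list_all (coded n) C \<and> length C = K \<and> C ! 0 = [] \<and>
     certifies n rl iv cAB (A @ B) (B @ A) \<and>
     list_all (\<lambda>k. list_all (\<lambda>x.
       certifies n rl iv (case map_of cs (k, x) of None \<Rightarrow> [] | Some c \<Rightarrow> c)
         (C ! k @ [x]) (normal_form A B C (step T x (0, k)))) [1..n]) [0..<K]"

section \<open>The presented group described through codes\<close>

locale coded_presentation =
  fixes p :: "'g presentation" and gs :: "'g list" and rl :: "(code \<times> code) list" and n :: int
  assumes gens: "fst p = set gs" "distinct gs" "n = int (length gs)"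
    and rels: "snd p = (\<lambda>(r, s). (map (letter_of gs) r, map (letter_of gs) s)) ` set rl"
begin

definition cl :: "code \<Rightarrow> 'g word set" where
  "cl w = word_rel p `` {map (letter_of gs) w}"

abbreviation "G \<equiv> presented_group p"

sublocale group G by (rule group_presented_group)

text \<open>Distinctness of the generators enters here; it allows \<open>act\<close> to decode a
  letter back to its row in the table.\<close>

lemma letter_of_inj: "inj_on (letter_of gs) (set (codes n))"
proof (rule inj_onI)
  fix x y assume x: "x \<in> set (codes n)" and y: "y \<in> set (codes n)"
    and e: "letter_of gs x = letter_of gs y"
  have nth: "nat a - 1 = nat b - 1" if "gs ! (nat a - 1) = gs ! (nat b - 1)"
    "0 < a" "0 < b" "a \<le> n" "b \<le> n" for a b
    using that gens by (subst (asm) nth_eq_iff_index_eq) auto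
  consider "x > 0" "y > 0" | "x < 0" "y < 0"
    using x y e by (cases "x > 0"; cases "y > 0") (auto simp: letter_of_def set_codes)
  then show "x = y"
  proof cases
    case 1
    then show ?thesis using nth[of x y] x y e by (auto simp: letter_of_def set_codes)
  next
    case 2
    then show ?thesis using nth[of "- x" "- y"] x y e by (auto simp: letter_of_def set_codes)
  qed
qed

lemma Gen_letter_of: "a \<in> set gs \<Longrightarrow> \<exists>i. 0 < i \<and> i \<le> n \<and> gs ! (nat i - 1) = a"
proof -
  assume "a \<in> set gs"
  then obtain m where "m < length gs" "gs ! m = a" by (auto simp: in_set_conv_nth)
  moreover have "nat (int (Suc m)) - 1 = m" by (simp only: nat_int)
  ultimately have "0 < int (Suc m)" "int (Suc m) \<le> n" "gs ! (nat (int (Suc m)) - 1) = a"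
    using gens(3) by simp_all
  then show ?thesis by blast
qed

lemma letters_eq: "Gen ` fst p \<union> Inv ` fst p = letter_of gs ` set (codes n)"
proof
  show "letter_of gs ` set (codes n) \<subseteq> Gen ` fst p \<union> Inv ` fst p"
    using gens by (auto simp: letter_of_def set_codes)
  have "Gen a \<in> letter_of gs ` set (codes n)" "Inv a \<in> letter_of gs ` set (codes n)"
    if a: "a \<in> set gs" for a
  proof -
    obtain i where i: "0 < i" "i \<le> n" "gs ! (nat i - 1) = a" using Gen_letter_of[OF a] by blast
    then have "letter_of gs i = Gen a" "letter_of gs (- i) = Inv a"
      by (auto simp: letter_of_def)
    moreover have "i \<in> set (codes n)" "- i \<in> set (codes n)" using i by (auto simp: set_codes)
    ultimately show "Gen a \<in> letter_of gs ` set (codes n)" "Inv a \<in> letter_of gs ` set (codes n)"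
      by (metis image_eqI)+
  qed
  then show "Gen ` fst p \<union> Inv ` fst p \<subseteq> letter_of gs ` set (codes n)"
    using gens(1) by auto
qed

lemma words_eq: "words (fst p) = map (letter_of gs) ` {w. coded n w}"
  unfolding words_def letters_eq lists_image by (simp add: coded_set lists_eq_set)

lemma word_of_coded [simp]: "coded n w \<Longrightarrow> map (letter_of gs) w \<in> words (fst p)"
  by (auto simp: words_eq)

lemma carrier_eq: "carrier G = cl ` {w. coded n w}"
  by (auto simp: carrier_presented_group words_eq cl_def)

lemma cl_closed [simp]: "coded n w \<Longrightarrow> cl w \<in> carrier G"
  by (auto simp: carrier_eq)

lemma cl_append [simp]: "coded n v \<Longrightarrow> coded n w \<Longrightarrow> cl (v @ w) = cl v \<otimes>\<^bsub>G\<^esub> cl w"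
  by (simp add: cl_def presented_group_mult)

lemma cl_Nil [simp]: "cl [] = \<one>\<^bsub>G\<^esub>"
  by (simp add: cl_def one_presented_group)

lemma cl_Cons: "coded n (x # w) \<Longrightarrow> cl (x # w) = cl [x] \<otimes>\<^bsub>G\<^esub> cl w"
  using cl_append[of "[x]" w] by simp

lemma cl_eq_iff:
  "coded n v \<Longrightarrow> coded n w \<Longrightarrow>
    cl v = cl w \<longleftrightarrow> word_eq p (map (letter_of gs) v) (map (letter_of gs) w)"
  by (simp add: cl_def word_class_eq_iff)

lemma inv_code_word:
  "coded n w \<Longrightarrow> map (letter_of gs) (inv_code w) = inv_word (map (letter_of gs) w)"
proof (induction w)
  case (Cons x w)
  then have "letter_of gs (- x) = inv_letter (letter_of gs x)"
    by (auto simp: letter_of_def)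
  then show ?case using Cons by (simp add: inv_code_def inv_word_def)
qed (simp add: inv_code_def inv_word_def)

lemma cl_inv_code [simp]: "coded n w \<Longrightarrow> cl (inv_code w) = inv\<^bsub>G\<^esub> cl w"
proof -
  assume w: "coded n w"
  have "cl (inv_code w @ w) = cl []"
    using word_eq_inv_left[OF word_of_coded[OF w]] w
    by (subst cl_eq_iff) (auto simp: inv_code_word)
  then show ?thesis
    using w by (intro inv_equality[symmetric]) auto
qed

lemma cl_uminus: "coded n [x] \<Longrightarrow> cl [- x] = inv\<^bsub>G\<^esub> cl [x]"
  using cl_inv_code[of "[x]"] by (simp add: inv_code_def)

lemma cl_relation: "(r, s) \<in> set rl \<Longrightarrow> coded n r \<Longrightarrow> coded n s \<Longrightarrow> cl r = cl s"
proof -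
  assume a: "(r, s) \<in> set rl" "coded n r" "coded n s"
  have "(map (letter_of gs) r, map (letter_of gs) s) \<in> snd p"
    unfolding rels using a(1) by (force intro: image_eqI)
  then have "word_eq p (map (letter_of gs) r) (map (letter_of gs) s)"
    using word_eq.relation[of _ _ p "[]" "[]"] by auto
  then show ?thesis using a by (subst cl_eq_iff) auto
qed

context
  fixes iv :: "int list"
  assumes involution: "\<And>i. i \<in> set iv \<Longrightarrow> 0 < i \<and> i \<le> n \<and> ([i, i], []) \<in> set rl"
begin

lemma cl_norm_code: "coded n [x] \<Longrightarrow> cl [norm_code iv x] = cl [x] \<and> coded n [norm_code iv x]"
proof (cases "x < 0 \<and> \<bar>x\<bar> \<in> set iv")
  case True
  assume x: "coded n [x]"
  have "cl ([- x] @ [- x]) = \<one>\<^bsub>G\<^esub>"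
  proof -
    have "- x \<in> set iv" using True by auto
    then have "([- x, - x], []) \<in> set rl" using involution by blast
    then show ?thesis using x cl_relation[of "[- x, - x]" "[]"] by simp
  qed
  then have "cl [- x] \<otimes>\<^bsub>G\<^esub> cl [- x] = \<one>\<^bsub>G\<^esub>" using x by (subst (asm) cl_append) auto
  then have "inv\<^bsub>G\<^esub> cl [- x] = cl [- x]" using x by (intro inv_equality) auto
  then have "cl [x] = cl [- x]" using cl_uminus[of "- x"] x by simp
  then show ?thesis using True x by (simp add: norm_code_def)
next
  case False
  assume x: "coded n [x]"
  have "norm_code iv x = x" using False unfolding norm_code_def by (metis abs_of_nonneg linorder_not_less)
  then show ?thesis using x by simp
qed

lemma cl_reduce: "coded n w \<Longrightarrow> cl (reduce iv w) = cl w \<and> coded n (reduce iv w)"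
proof (induction w)
  case (Cons x w)
  have x: "coded n [x]" "coded n [- x]" and w: "coded n w" using Cons.prems by auto
  have IH: "cl (reduce iv w) = cl w" "coded n (reduce iv w)" using Cons by auto
  have cx: "cl (x # w) = cl [x] \<otimes>\<^bsub>G\<^esub> cl w" using Cons.prems by (rule cl_Cons)
  have keep: "cl (norm_code iv x # reduce iv w) = cl (x # w) \<and> coded n (norm_code iv x # reduce iv w)"
    using cl_norm_code[OF x(1)] IH cl_Cons[of "norm_code iv x" "reduce iv w"] cx by simp
  show ?case
  proof (cases "\<exists>v. reduce iv w = norm_code iv (- x) # v")
    case True
    then obtain v where v: "reduce iv w = norm_code iv (- x) # v" by blast
    then have cv: "coded n v" using IH by simp
    have "cl w = cl [- x] \<otimes>\<^bsub>G\<^esub> cl v"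
      using IH v cl_Cons[of "norm_code iv (- x)" v] cl_norm_code[OF x(2)] by simp
    then have "cl (x # w) = cl [x] \<otimes>\<^bsub>G\<^esub> (inv\<^bsub>G\<^esub> cl [x] \<otimes>\<^bsub>G\<^esub> cl v)"
      using cx cl_uminus[OF x(1)] by simp
    also have "\<dots> = cl v" using x cv by (simp add: m_assoc[symmetric])
    finally show ?thesis using v cv by (simp add: cons_reduce_def)
  next
    case False
    then have "reduce iv (x # w) = norm_code iv x # reduce iv w"
      by (auto simp: cons_reduce_def split: list.split)
    then show ?thesis using keep by simp
  qed
qed auto

text \<open>Reduction stays inside the class of a word, and a product of conjugates of relators is
  trivial. Equality of the reduced words therefore carries triviality over to u v^-1.\<close>

lemma certifies_eq:
  assumes c: "certifies n rl iv c u v" and u: "coded n u" and v: "coded n v"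
    and coded_rl: "\<And>r s. (r, s) \<in> set rl \<Longrightarrow> coded n r \<and> coded n s"
  shows "cl u = cl v"
proof -
  have "coded n (conjugates rl c) \<and> cl (conjugates rl c) = \<one>\<^bsub>G\<^esub>"
    if "list_all (\<lambda>(g, m). coded n g \<and> m \<noteq> 0 \<and> nat \<bar>m\<bar> \<le> length rl) c"
    using that
  proof (induction c)
    case (Cons gm c)
    obtain g m where gm: "gm = (g, m)" by (cases gm)
    obtain r s where rs: "rl ! (nat \<bar>m\<bar> - 1) = (r, s)" by (cases "rl ! (nat \<bar>m\<bar> - 1)")
    have g: "coded n g" and m: "nat \<bar>m\<bar> - 1 < length rl" using Cons.prems gm by auto
    have "(r, s) \<in> set rl" using m rs by (metis nth_mem)
    then have "coded n r" "coded n s" "cl r = cl s" using coded_rl cl_relation by blast+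
    then have "coded n (relator rl m)" "cl (relator rl m) = \<one>\<^bsub>G\<^esub>"
      using rs by (simp_all add: relator_def)
    then show ?case using g gm Cons by simp
  qed auto
  then have *: "coded n (conjugates rl c)" "cl (conjugates rl c) = \<one>\<^bsub>G\<^esub>"
    using c by (auto simp: certifies_def)
  have "cl (u @ inv_code v) = \<one>\<^bsub>G\<^esub>"
    using cl_reduce[OF *(1)] cl_reduce[of "u @ inv_code v"] c u v * by (simp add: certifies_def)
  then have "cl u \<otimes>\<^bsub>G\<^esub> inv\<^bsub>G\<^esub> cl v = \<one>\<^bsub>G\<^esub>" using u v by simp
  then show ?thesis using u v by (metis cl_closed inv_closed inv_equality inv_inv)
qed

end

end

text \<open>Outside \<open>reachable\<close> the \<open>LEAST\<close> is unspecified; this is why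
  reachability is carried along in \<open>affine\<close> and in the growth lemmas.\<close>

definition dist_run :: "int \<Rightarrow> table \<Rightarrow> vertex \<Rightarrow> nat" where
  "dist_run n T v = (LEAST m. \<exists>w. coded n w \<and> length w = m \<and> run T w (0, 0) = v)"

definition reachable :: "int \<Rightarrow> table \<Rightarrow> vertex set" where
  "reachable n T = (\<lambda>w. run T w (0, 0)) ` {w. coded n w}"

locale tabled_presentation = coded_presentation +
  fixes K T iv A B C cAB cs
  assumes group_ok: "group_ok n rl K T iv A B C cAB cs"
begin

lemma table_ok: "table_ok n K T"
  and relators_ok: "relators_ok K T rl"
  and coded_rl: "(r, s) \<in> set rl \<Longrightarrow> coded n r \<and> coded n s"
  and invol: "i \<in> set iv \<Longrightarrow> 0 < i \<and> i \<le> n \<and> ([i, i], []) \<in> set rl"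
  and coded_A: "coded n A" and coded_B: "coded n B"
  and coded_C: "k < K \<Longrightarrow> coded n (C ! k)"
  and C_0: "C ! 0 = []"
  and commute_AB: "certifies n rl iv cAB (A @ B) (B @ A)"
  and C_step: "k < K \<Longrightarrow> 0 < x \<Longrightarrow> x \<le> n \<Longrightarrow>
    certifies n rl iv (case map_of cs (k, x) of None \<Rightarrow> [] | Some c \<Rightarrow> c)
         (C ! k @ [x]) (normal_form A B C (step T x (0, k)))"
  using group_ok unfolding group_ok_def list_all_iff by (auto simp del: step.simps)

lemma K_pos: "0 < K"
  using table_ok by (simp add: table_ok_def)

lemma snd_step: "coded n [x] \<Longrightarrow> snd v < K \<Longrightarrow> snd (step T x v) < K"
  and step_uminus: "coded n [x] \<Longrightarrow> snd v < K \<Longrightarrow> step T (- x) (step T x v) = v"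
  using table_ok_step[OF table_ok] by (auto simp: set_codes)

lemma snd_run: "coded n w \<Longrightarrow> snd v < K \<Longrightarrow> snd (run T w v) < K"
  using table_ok_run[OF table_ok] .

subsection \<open>The table is a quotient of the Cayley graph\<close>

text \<open>The relation \<open>word_eq\<close> also compares words with letters outside the
  generating set, so an induction over its rules needs an action of all letters. Foreign letters act
  trivially.\<close>

definition act :: "'a letter \<Rightarrow> vertex \<Rightarrow> vertex" where
  "act l v = (if l \<in> letter_of gs ` set (codes n)
              then step T (inv_into (set (codes n)) (letter_of gs) l) v else v)"

definition run_word :: "'a word \<Rightarrow> vertex \<Rightarrow> vertex" where
  "run_word u v = foldl (\<lambda>v l. act l v) v u"

lemma act_letter_of: "coded n [x] \<Longrightarrow> act (letter_of gs x) v = step T x v"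
  using letter_of_inj by (simp add: act_def set_codes)

lemma run_word_coded: "coded n w \<Longrightarrow> run_word (map (letter_of gs) w) v = run T w v"
  by (induction w arbitrary: v) (auto simp: run_word_def act_letter_of)

lemma run_word_append: "run_word (u @ u') v = run_word u' (run_word u v)"
  by (simp add: run_word_def)

lemma snd_act: "snd v < K \<Longrightarrow> snd (act l v) < K"
proof -
  assume v: "snd v < K"
  show ?thesis
  proof (cases "l \<in> letter_of gs ` set (codes n)")
    case True
    then obtain x where "coded n [x]" "l = letter_of gs x" by (auto simp: set_codes)
    then show ?thesis using v snd_step by (simp add: act_letter_of)
  qed (use v in \<open>simp add: act_def\<close>)
qed

lemma snd_run_word: "snd v < K \<Longrightarrow> snd (run_word u v) < K"
  by (induction u arbitrary: v) (auto simp: run_word_def snd_act)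

lemma act_cancel:
  assumes "a \<in> set gs" "snd v < K"
  shows "act (Inv a) (act (Gen a) v) = v" "act (Gen a) (act (Inv a) v) = v"
proof -
  obtain i where i: "0 < i" "i \<le> n" "gs ! (nat i - 1) = a" using Gen_letter_of[OF assms(1)] by blast
  then have l: "Gen a = letter_of gs i" "Inv a = letter_of gs (- i)" and c: "coded n [i]" "coded n [- i]"
    by (auto simp: letter_of_def)
  show "act (Inv a) (act (Gen a) v) = v" "act (Gen a) (act (Inv a) v) = v"
    unfolding l using c step_uminus[OF c(1) assms(2)] step_uminus[OF c(2) assms(2)]
    by (simp_all add: act_letter_of del: coded_simps)
qed

text \<open>First half of the comparison of table and group: every rule of \<open>word_eq\<close>
  preserves the endpoint from every start vertex, so the endpoint depends only on the group
  element.\<close>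

lemma run_word_eq: "word_eq p u u' \<Longrightarrow> snd v < K \<Longrightarrow> run_word u v = run_word u' v"
proof (induction arbitrary: v rule: word_eq.induct)
  case (cancel_right a u u')
  then have "act (Inv a) (act (Gen a) (run_word u v)) = run_word u v"
    using gens act_cancel snd_run_word by blast
  then show ?case by (simp add: run_word_def)
next
  case (cancel_left a u u')
  then have "act (Gen a) (act (Inv a) (run_word u v)) = run_word u v"
    using gens act_cancel snd_run_word by blast
  then show ?case by (simp add: run_word_def)
next
  case (relation r s u u')
  then obtain r' s' where rs: "(r', s') \<in> set rl" "r = map (letter_of gs) r'" "s = map (letter_of gs) s'"
    using rels by auto
  have "run T r' (run_word u v) = run T s' (run_word u v)"
    using relators_ok_run[OF relators_ok rs(1)] snd_run_word relation by blast
  then show ?case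
    using coded_rl[OF rs(1)] rs by (simp add: run_word_append run_word_coded)
qed auto

subsection \<open>The table is the Cayley graph\<close>

lemma cert_eq:
  assumes "certifies n rl iv c u v" "coded n u" "coded n v"
  shows "cl u = cl v"
  using certifies_eq[OF _ assms] invol coded_rl by blast

lemma AB_comm: "cl A \<otimes>\<^bsub>G\<^esub> cl B = cl B \<otimes>\<^bsub>G\<^esub> cl A"
  using cert_eq[OF commute_AB] coded_A coded_B by simp

definition element :: "vertex \<Rightarrow> 'a word set" where
  "element v = (cl A [^]\<^bsub>G\<^esub> fst (fst v)) \<otimes>\<^bsub>G\<^esub> ((cl B [^]\<^bsub>G\<^esub> snd (fst v)) \<otimes>\<^bsub>G\<^esub> cl (C ! snd v))"

lemma concat_replicate:
  assumes "coded n w"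
  shows "coded n (concat (replicate m w)) \<and> cl (concat (replicate m w)) = cl w [^]\<^bsub>G\<^esub> m"
proof (induction m)
  case (Suc m)
  have "cl w [^]\<^bsub>G\<^esub> Suc m = cl w \<otimes>\<^bsub>G\<^esub> cl w [^]\<^bsub>G\<^esub> m"
    using nat_pow_Suc2[of "cl w" m] assms by simp
  then show ?case using Suc assms by simp
qed simp

lemma power_code:
  assumes "coded n w"
  shows "coded n (power_code w i) \<and> cl (power_code w i) = cl w [^]\<^bsub>G\<^esub> i"
proof (cases "0 \<le> i")
  case True
  then obtain m where "i = int m" using nonneg_int_cases by blast
  then show ?thesis
    using concat_replicate[OF assms, of m] by (simp add: power_code_def int_pow_int)
next
  case False
  then obtain m where m: "i = - int m" "0 < m" using neg_int_cases[of i] by auto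
  have "inv\<^bsub>G\<^esub> cl w [^]\<^bsub>G\<^esub> m = cl w [^]\<^bsub>G\<^esub> i"
    using nat_pow_inv[of "cl w" m] int_pow_neg_int[of "cl w" m] assms m by simp
  then show ?thesis
    using concat_replicate[of "inv_code w" m] assms m by (simp add: power_code_def)
qed

lemma normal_form: "snd v < K \<Longrightarrow> coded n (normal_form A B C v) \<and> cl (normal_form A B C v) = element v"
  using power_code[OF coded_A] power_code[OF coded_B] coded_C
  by (simp add: normal_form_def element_def)

lemma commutes_int_pow:
  assumes "x \<in> carrier G" "y \<in> carrier G" "x \<otimes>\<^bsub>G\<^esub> y = y \<otimes>\<^bsub>G\<^esub> x"
  shows "x \<otimes>\<^bsub>G\<^esub> y [^]\<^bsub>G\<^esub> (i::int) = y [^]\<^bsub>G\<^esub> i \<otimes>\<^bsub>G\<^esub> x"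
proof -
  have nat: "x \<otimes>\<^bsub>G\<^esub> y [^]\<^bsub>G\<^esub> (m::nat) = y [^]\<^bsub>G\<^esub> m \<otimes>\<^bsub>G\<^esub> x" for m
    using group_commutes_pow[of y x m] assms by simp
  have "x \<otimes>\<^bsub>G\<^esub> inv\<^bsub>G\<^esub> z = inv\<^bsub>G\<^esub> z \<otimes>\<^bsub>G\<^esub> x" if z: "z \<in> carrier G" "x \<otimes>\<^bsub>G\<^esub> z = z \<otimes>\<^bsub>G\<^esub> x" for z
  proof -
    have "x \<otimes>\<^bsub>G\<^esub> inv\<^bsub>G\<^esub> z = inv\<^bsub>G\<^esub> z \<otimes>\<^bsub>G\<^esub> (z \<otimes>\<^bsub>G\<^esub> x) \<otimes>\<^bsub>G\<^esub> inv\<^bsub>G\<^esub> z"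
      using z assms by (simp add: m_assoc[symmetric])
    also have "\<dots> = inv\<^bsub>G\<^esub> z \<otimes>\<^bsub>G\<^esub> (x \<otimes>\<^bsub>G\<^esub> z) \<otimes>\<^bsub>G\<^esub> inv\<^bsub>G\<^esub> z" using z by simp
    also have "\<dots> = inv\<^bsub>G\<^esub> z \<otimes>\<^bsub>G\<^esub> x" using z(1) assms by (simp add: m_assoc)
    finally show ?thesis .
  qed
  then show ?thesis
    using nat assms int_pow_int[of G y] int_pow_neg_int[of y] by (cases i rule: int_cases2) simp_all
qed

text \<open>The power of A inside \<open>element v\<close> must move past the new power of B; this
  is where the certified commutation of A and B is used.\<close>

lemma element_shift:
  assumes "snd v < K"
  shows "element (shift (a, b) v) = cl A [^]\<^bsub>G\<^esub> a \<otimes>\<^bsub>G\<^esub> cl B [^]\<^bsub>G\<^esub> b \<otimes>\<^bsub>G\<^esub> element v"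
proof -
  let ?A = "\<lambda>i::int. cl A [^]\<^bsub>G\<^esub> i" and ?B = "\<lambda>i::int. cl B [^]\<^bsub>G\<^esub> i"
  obtain i j k where v: "v = ((i, j), k)" by (metis surj_pair)
  have c: "?A x \<in> carrier G" "?B x \<in> carrier G" "cl (C ! k) \<in> carrier G" for x
    using coded_A coded_B coded_C assms v by auto
  have BA: "?B b \<otimes>\<^bsub>G\<^esub> ?A i = ?A i \<otimes>\<^bsub>G\<^esub> ?B b"
  proof -
    have "cl A \<otimes>\<^bsub>G\<^esub> ?B b = ?B b \<otimes>\<^bsub>G\<^esub> cl A"
      using commutes_int_pow[of "cl A" "cl B"] AB_comm coded_A coded_B by auto
    then show ?thesis
      using commutes_int_pow[of "?B b" "cl A"] coded_A c by auto
  qed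
  have "?A a \<otimes>\<^bsub>G\<^esub> ?B b \<otimes>\<^bsub>G\<^esub> element v
      = ?A a \<otimes>\<^bsub>G\<^esub> (?B b \<otimes>\<^bsub>G\<^esub> ?A i) \<otimes>\<^bsub>G\<^esub> ?B j \<otimes>\<^bsub>G\<^esub> cl (C ! k)"
    using c by (simp add: element_def v m_assoc)
  also have "\<dots> = (?A a \<otimes>\<^bsub>G\<^esub> ?A i) \<otimes>\<^bsub>G\<^esub> ((?B b \<otimes>\<^bsub>G\<^esub> ?B j) \<otimes>\<^bsub>G\<^esub> cl (C ! k))"
    unfolding BA using c by (simp add: m_assoc)
  also have "\<dots> = element (shift (a, b) v)"
    using coded_A coded_B by (simp add: element_def v int_pow_mult)
  finally show ?thesis ..
qed

text \<open>Second half of the comparison: the certified equation for C_k x, multiplied from the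
  left by A^a B^b, turns the whole table into true equations of the group.\<close>

lemma element_step:
  assumes x: "coded n [x]" and v: "snd v < K"
  shows "element v \<otimes>\<^bsub>G\<^esub> cl [x] = element (step T x v)"
proof -
  have element_closed: "element v \<in> carrier G" if "snd v < K" for v
    using normal_form[OF that] cl_closed by metis
  have pos: "element v \<otimes>\<^bsub>G\<^esub> cl [x] = element (step T x v)"
    if "0 < x" and x: "coded n [x]" and v: "snd v < K" for x v
  proof -
    obtain a b k where v': "v = ((a, b), k)" by (metis surj_pair)
    have k: "k < K" "snd (step T x (0, k)) < K"
      using v v' snd_step[OF x, of "(0, k)"] by (simp_all del: step.simps)
    have "cl (C ! k) \<otimes>\<^bsub>G\<^esub> cl [x] = element (step T x (0, k))"
      using cert_eq[OF C_step[OF k(1)]] x that(1) normal_form[OF k(2)] coded_C[OF k(1)]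
      by (simp del: step.simps)
    moreover have "cl (C ! k) = element (0, k)"
      using coded_C[OF k(1)] by (simp add: element_def)
    ultimately have 0: "element (0, k) \<otimes>\<^bsub>G\<^esub> cl [x] = element (step T x (0, k))" by simp
    have "element v = element (shift (a, b) (0, k))" by (simp add: v')
    then have "element v \<otimes>\<^bsub>G\<^esub> cl [x]
        = cl A [^]\<^bsub>G\<^esub> a \<otimes>\<^bsub>G\<^esub> cl B [^]\<^bsub>G\<^esub> b \<otimes>\<^bsub>G\<^esub> element (0, k) \<otimes>\<^bsub>G\<^esub> cl [x]"
      using element_shift[of "(0, k)" a b] k by simp
    also have "\<dots> = cl A [^]\<^bsub>G\<^esub> a \<otimes>\<^bsub>G\<^esub> cl B [^]\<^bsub>G\<^esub> b \<otimes>\<^bsub>G\<^esub> element (step T x (0, k))"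
      unfolding 0[symmetric] using coded_A coded_B x element_closed[of "(0, k)"] k by (simp add: m_assoc)
    also have "\<dots> = element (step T x v)"
      using element_shift[OF k(2), of a b] step_eq_shift[of T x "(a, b)" k] v' by simp
    finally show ?thesis .
  qed
  show ?thesis
  proof (cases "0 < x")
    case False
    let ?u = "step T x v"
    \<comment> \<open>For an inverse letter, the positive case at the target vertex leads back to
      \<open>v\<close> and is then solved for the target.\<close>
    have x': "coded n [- x]" "0 < - x" using x False by auto
    have "element ?u \<otimes>\<^bsub>G\<^esub> cl [- x] = element v"
      using pos[OF x'(2,1), of ?u] snd_step[OF x v] step_uminus[OF x v] by simp
    moreover have "cl [x] = inv\<^bsub>G\<^esub> cl [- x]" using cl_uminus[OF x'(1)] by simp
    moreover have "element ?u \<in> carrier G" using element_closed[OF snd_step[OF x v]] .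
    ultimately show ?thesis
      using cl_closed[OF x'(1)] m_assoc[of "element ?u" "cl [- x]" "inv\<^bsub>G\<^esub> cl [- x]"] by simp
  qed (use pos x v in simp)
qed

lemma cl_eq_element: "coded n w \<Longrightarrow> cl w = element (run T w (0, 0))"
proof (induction w rule: rev_induct)
  case Nil
  show ?case by (simp add: element_def C_0)
next
  case (snoc x w)
  then have "cl (w @ [x]) = element (run T w (0, 0)) \<otimes>\<^bsub>G\<^esub> cl [x]" by simp
  then show ?case using element_step[of x "run T w (0, 0)"] snd_run[of w "(0, 0)"] snoc.prems K_pos by simp
qed

text \<open>The action on vertices gives one direction, the normal forms the other; together they
  identify the group with the reachable vertices.\<close>

lemma cl_eq_iff_run:
  assumes "coded n u" "coded n w"
  shows "cl u = cl w \<longleftrightarrow> run T u (0, 0) = run T w (0, 0)"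
  using cl_eq_element assms cl_eq_iff[OF assms] run_word_eq[of _ _ "(0, 0)"] run_word_coded K_pos
  by (metis snd_conv)

subsection \<open>Word length\<close>

lemma letters_group: "generating_set p \<union> m_inv G ` generating_set p = (\<lambda>x. cl [x]) ` set (codes n)"
proof -
  have gen: "generating_set p = (\<lambda>x. cl [x]) ` {1..n}"
  proof -
    have "fst p \<subseteq> (\<lambda>x. gs ! (nat x - 1)) ` {1..n}"
    proof
      fix a assume "a \<in> fst p"
      then obtain i where "0 < i" "i \<le> n" "gs ! (nat i - 1) = a" using Gen_letter_of gens by blast
      then show "a \<in> (\<lambda>x. gs ! (nat x - 1)) ` {1..n}" by (intro image_eqI[of _ _ i]) auto
    qed
    moreover have "(\<lambda>x. gs ! (nat x - 1)) ` {1..n} \<subseteq> fst p"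
    proof (rule image_subsetI)
      fix i assume "i \<in> {1..n}"
      then have "1 \<le> i" "i \<le> int (length gs)" using gens(3) by auto
      then have "nat i - 1 < length gs" by linarith
      then show "gs ! (nat i - 1) \<in> fst p" unfolding gens(1) by (rule nth_mem)
    qed
    ultimately have "fst p = (\<lambda>x. gs ! (nat x - 1)) ` {1..n}" ..
    then show ?thesis
      by (simp add: generating_set_def cl_def image_image letter_of_def)
  qed
  have codes: "set (codes n) = {1..n} \<union> uminus ` {1..n}"
    by (simp add: codes_def)
  have "(\<lambda>x. inv\<^bsub>G\<^esub> cl [x]) ` {1..n} = (\<lambda>x. cl [- x]) ` {1..n}"
    by (rule image_cong) (simp_all add: cl_uminus)
  then show ?thesis
    unfolding gen codes image_Un image_image by (simp only:)
qed

text \<open>Elements of S and S^-1 are the classes of single codes, so both \<open>LEAST\<close>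
  expressions range over the same set of lengths.\<close>

lemma word_length_cl:
  assumes "coded n u"
  shows "word_length G (generating_set p) (cl u) = dist_run n T (run T u (0, 0))"
proof -
  have prod: "foldr (monoid.mult G) (map (\<lambda>x. cl [x]) w) \<one>\<^bsub>G\<^esub> = cl w" if "coded n w" for w
    using that
  proof (induction w)
    case (Cons x w)
    then show ?case using cl_Cons[of x w] by simp
  qed simp
  have "(\<exists>xs. length xs = m \<and> set xs \<subseteq> generating_set p \<union> m_inv G ` generating_set p \<and>
                 foldr (monoid.mult G) xs \<one>\<^bsub>G\<^esub> = cl u)
      \<longleftrightarrow> (\<exists>w. coded n w \<and> length w = m \<and> run T w (0, 0) = run T u (0, 0))" (is "?L = ?R") for m
  proof
    assume ?L
    then obtain xs where xs: "length xs = m" "set xs \<subseteq> (\<lambda>x. cl [x]) ` set (codes n)"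
      "foldr (monoid.mult G) xs \<one>\<^bsub>G\<^esub> = cl u" unfolding letters_group by blast
    from xs(2) have "xs \<in> lists ((\<lambda>x. cl [x]) ` set (codes n))" by (simp only: lists_eq_set mem_Collect_eq)
    then have "xs \<in> map (\<lambda>x. cl [x]) ` lists (set (codes n))" by (simp only: lists_image)
    then obtain w where "w \<in> lists (set (codes n))" and xs_eq: "xs = map (\<lambda>x. cl [x]) w" by (rule imageE)
    then have w: "coded n w" unfolding coded_set by (simp only: lists_eq_set mem_Collect_eq)
    have "cl w = cl u" using xs(3) prod[OF w] unfolding xs_eq by simp
    then have "run T w (0, 0) = run T u (0, 0)" using cl_eq_iff_run[OF w assms] by simp
    then show ?R using w xs(1) xs_eq by auto
  next
    assume ?R
    then obtain w where w: "coded n w" "length w = m" "run T w (0, 0) = run T u (0, 0)" by blast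
    then have "cl w = cl u" using cl_eq_iff_run[OF w(1) assms] by simp
    moreover have "set (map (\<lambda>x. cl [x]) w) \<subseteq> (\<lambda>x. cl [x]) ` set (codes n)"
      using w(1) unfolding coded_set set_map by (rule image_mono)
    ultimately show ?L unfolding letters_group
      using prod[OF w(1)] w(2) by (intro exI[of _ "map (\<lambda>x. cl [x]) w"]) simp
  qed
  then show ?thesis by (simp add: word_length_def dist_run_def)
qed

text \<open>The predicate \<open>P\<close> lets one bijection serve spheres as well as
  balls.\<close>

lemma growth_set:
  "card {g \<in> carrier G. P (word_length G (generating_set p) g)} = card {v \<in> reachable n T. P (dist_run n T v)}"
proof -
  have "bij_betw element {v \<in> reachable n T. P (dist_run n T v)}
     {g \<in> carrier G. P (word_length G (generating_set p) g)}"
  proof (rule bij_betw_imageI)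
    show "inj_on element {v \<in> reachable n T. P (dist_run n T v)}"
    proof (rule inj_onI)
      fix v v' assume "v \<in> {v \<in> reachable n T. P (dist_run n T v)}"
        "v' \<in> {v \<in> reachable n T. P (dist_run n T v)}" and e: "element v = element v'"
      then obtain w w' where w: "coded n w" "v = run T w (0, 0)" "coded n w'" "v' = run T w' (0, 0)"
        unfolding reachable_def by blast
      then have "cl w = cl w'" using e cl_eq_element by simp
      then show "v = v'" using w cl_eq_iff_run by simp
    qed
    show "element ` {v \<in> reachable n T. P (dist_run n T v)}
        = {g \<in> carrier G. P (word_length G (generating_set p) g)}" (is "?L = ?R")
    proof
      show "?L \<subseteq> ?R"
      proof (rule image_subsetI)
        fix v assume v: "v \<in> {v \<in> reachable n T. P (dist_run n T v)}"
        then obtain w where w: "coded n w" "v = run T w (0, 0)" unfolding reachable_def by blast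
        then have "element v = cl w" using cl_eq_element by simp
        then show "element v \<in> ?R" using v w word_length_cl by simp
      qed
      show "?R \<subseteq> ?L"
      proof
        fix g assume g: "g \<in> ?R"
        then obtain w where w: "coded n w" "g = cl w" unfolding carrier_eq by blast
        then have "g = element (run T w (0, 0))" using cl_eq_element by simp
        moreover have "run T w (0, 0) \<in> {v \<in> reachable n T. P (dist_run n T v)}"
          using g w word_length_cl unfolding reachable_def by auto
        ultimately show "g \<in> ?L" by (rule image_eqI)
      qed
    qed
  qed
  then show ?thesis by (simp add: bij_betw_same_card)
qed

end

section \<open>Counting vertices in cones\<close>

definition growth_of :: "int \<Rightarrow> table \<Rightarrow> vertex set \<Rightarrow> real fps" where
  "growth_of n T X = Abs_fps (\<lambda>m. real (card {v \<in> X. dist_run n T v = m}))"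

lemma finite_coded_length: "finite {w. coded n w \<and> length w = m}"
  unfolding coded_set by (rule finite_lists_length_eq) simp

lemma reachable_dist:
  assumes "v \<in> reachable n T"
  obtains w where "coded n w" "length w = dist_run n T v" "run T w (0, 0) = v"
proof -
  have "\<exists>m w. coded n w \<and> length w = m \<and> run T w (0, 0) = v"
    using assms by (auto simp: reachable_def)
  then have "\<exists>w. coded n w \<and> length w = dist_run n T v \<and> run T w (0, 0) = v"
    unfolding dist_run_def by (rule LeastI_ex)
  then show thesis using that by blast
qed

lemma finite_sphere: "X \<subseteq> reachable n T \<Longrightarrow> finite {v \<in> X. dist_run n T v = m}"
proof (rule finite_subset[OF _ finite_imageI[OF finite_coded_length, of "\<lambda>w. run T w (0, 0)" n m]])
  assume X: "X \<subseteq> reachable n T"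
  show "{v \<in> X. dist_run n T v = m} \<subseteq> (\<lambda>w. run T w (0, 0)) ` {w. coded n w \<and> length w = m}"
  proof
    fix v assume v: "v \<in> {v \<in> X. dist_run n T v = m}"
    then obtain w where "coded n w" "length w = m" "run T w (0, 0) = v"
      using X reachable_dist by (smt (verit) mem_Collect_eq subsetD)
    then show "v \<in> (\<lambda>w. run T w (0, 0)) ` {w. coded n w \<and> length w = m}" by blast
  qed
qed

lemma growth_of_Un:
  assumes "X \<subseteq> reachable n T" "Y \<subseteq> reachable n T" "X \<inter> Y = {}"
  shows "growth_of n T (X \<union> Y) = growth_of n T X + growth_of n T Y"
proof (rule fps_ext)
  fix m
  have "{v \<in> X \<union> Y. dist_run n T v = m} = {v \<in> X. dist_run n T v = m} \<union> {v \<in> Y. dist_run n T v = m}"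
    by auto
  moreover have "card ({v \<in> X. dist_run n T v = m} \<union> {v \<in> Y. dist_run n T v = m})
      = card {v \<in> X. dist_run n T v = m} + card {v \<in> Y. dist_run n T v = m}"
    using assms finite_sphere[of X n T m] finite_sphere[of Y n T m] by (intro card_Un_disjoint) auto
  ultimately show "fps_nth (growth_of n T (X \<union> Y)) m = fps_nth (growth_of n T X + growth_of n T Y) m"
    by (simp add: growth_of_def)
qed

section \<open>Lattice cones and their decompositions\<close>

definition scale :: "nat \<Rightarrow> int \<times> int \<Rightarrow> int \<times> int" where
  "scale s u = (int s * fst u, int s * snd u)"

lemma scale_simps [simp]: "scale 0 u = 0" "scale (Suc s) u = u + scale s u" "scale s 0 = 0"
  by (auto simp: scale_def prod_eq_iff algebra_simps)

text \<open>Coefficients are natural numbers. The recursion over the directions is repeated in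
  \<open>affine\<close>, \<open>joined\<close> and \<open>separated\<close>, so inductions run in
  parallel.\<close>

fun cone :: "int \<times> int \<Rightarrow> (int \<times> int) list \<Rightarrow> (int \<times> int) set" where
  "cone b [] = {b}"
| "cone b (u # us) = (\<Union>s. cone (b + scale s u) us)"

text \<open>Linear independence in the plane, for at most two vectors. It makes the coefficients of
  a point of the cone unique, so that no vertex is counted twice.\<close>

fun independent :: "(int \<times> int) list \<Rightarrow> bool" where
  "independent [] = True"
| "independent [u] = (u \<noteq> 0)"
| "independent [u, v] = (fst u * snd v \<noteq> snd u * fst v)"
| "independent _ = False"

lemma independent_cases:
  assumes "independent us"
  obtains "us = []" | u where "us = [u]" "u \<noteq> 0"
    | u v where "us = [u, v]" "fst u * snd v \<noteq> snd u * fst v"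
  using assms by (cases us rule: independent.cases) auto

lemma independent_tl: "independent (u # us) \<Longrightarrow> independent us"
  by (cases "u # us" rule: independent.cases) (auto simp: prod_eq_iff)

lemma cone_Cons: "cone b (u # us) = cone b us \<union> cone (b + u) (u # us)"
proof -
  have "(\<Union>s. f s) = f 0 \<union> (\<Union>s. f (Suc s))" for f :: "nat \<Rightarrow> (int \<times> int) set"
    by (auto, metis not0_implies_Suc)
  from this[of "\<lambda>s. cone (b + scale s u) us"] show ?thesis by (simp add: add.assoc)
qed

lemma cone_translate: "cone (t + b) us = (+) t ` cone b us"
proof (induction us arbitrary: b)
  case (Cons u us)
  show ?case using Cons.IH by (simp add: image_UN add.assoc)
qed simp

lemma cone_ray: "cone b [u] = {x. \<exists>s. x = b + scale s u}"
  by auto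

lemma cone_plane: "cone b [u, v] = {x. \<exists>s t. x = b + scale s u + scale t v}"
  by auto

lemma independent_inject:
  assumes "fst u * snd v \<noteq> snd u * fst v"
    and "scale s u + scale t v = scale s' u + scale t' v"
  shows "s = s' \<and> t = t'"
proof -
  define d e where "d = int s - int s'" and "e = int t - int t'"
  have 1: "d * fst u + e * fst v = 0" and 2: "d * snd u + e * snd v = 0"
    using assms(2) by (auto simp: d_def e_def scale_def prod_eq_iff algebra_simps)
  have "d * (fst u * snd v - snd u * fst v) = 0" "e * (fst u * snd v - snd u * fst v) = 0"
    using 1 2 by algebra+
  then show ?thesis using assms(1) by (simp add: d_def e_def)
qed

lemma cone_Cons_disjoint:
  assumes "independent (u # us)"
  shows "cone b us \<inter> cone (b + u) (u # us) = {}"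
  using assms
proof (cases rule: independent_cases)
  case (2 v)
  have "b \<noteq> b + u + scale s u" for s
  proof
    assume "b = b + u + scale s u"
    then have "(int s + 1) * fst u = 0 \<and> (int s + 1) * snd u = 0"
      by (auto simp: scale_def prod_eq_iff algebra_simps)
    then show False using 2 by (auto simp: prod_eq_iff)
  qed
  then show ?thesis using 2 by auto
next
  case (3 v w)
  then have uv: "u = v" "us = [w]" by auto
  have False if "b + scale t w = b + v + scale s v + scale t' w" for s t t'
  proof -
    have "scale 0 v + scale t w = scale (Suc s) v + scale t' w"
      using that by (simp add: add.assoc)
    then show False using independent_inject[of v w 0 t "Suc s" t'] 3 by simp
  qed
  then show ?thesis unfolding uv cone_ray cone_plane by blast
qed auto

text \<open>A point with coefficients \<open>s\<close>, \<open>t\<close> lies in the first piece if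
  \<open>t \<le> s\<close> and in the second otherwise. The second apex is moved by \<open>v\<close>
  so that the diagonal is counted only once. The determinant of the two directions does not change,
  so no lattice point is lost.\<close>

lemma cone_star:
  shows "cone b [u, v] = cone b [u, u + v] \<union> cone (b + v) [u + v, v]"
    and "independent [u, v] \<Longrightarrow> cone b [u, u + v] \<inter> cone (b + v) [u + v, v] = {}"
    and "independent [u, v] \<Longrightarrow> independent [u, u + v] \<and> independent [u + v, v]"
proof -
  have 1: "b + scale s u + scale t (u + v) = b + scale (s + t) u + scale t v" for s t
    by (simp add: scale_def prod_eq_iff algebra_simps)
  have 2: "b + v + scale s (u + v) + scale t v = b + scale s u + scale (Suc (s + t)) v" for s t
    by (simp add: scale_def prod_eq_iff algebra_simps)
  show "cone b [u, v] = cone b [u, u + v] \<union> cone (b + v) [u + v, v]"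
  proof
    show "cone b [u, u + v] \<union> cone (b + v) [u + v, v] \<subseteq> cone b [u, v]"
      unfolding cone_plane 1 2 by blast
    show "cone b [u, v] \<subseteq> cone b [u, u + v] \<union> cone (b + v) [u + v, v]"
    proof
      fix x assume "x \<in> cone b [u, v]"
      then obtain s t where x: "x = b + scale s u + scale t v" unfolding cone_plane by blast
      show "x \<in> cone b [u, u + v] \<union> cone (b + v) [u + v, v]"
      proof (cases "t \<le> s")
        case True
        then have "x = b + scale (s - t) u + scale t (u + v)" unfolding 1 x by simp
        then show ?thesis unfolding cone_plane by blast
      next
        case False
        then have "x = b + v + scale s (u + v) + scale (t - Suc s) v" unfolding 2 x by simp
        then show ?thesis unfolding cone_plane by blast
      qed
    qed
  qed
  assume ind: "independent [u, v]"
  have False if "b + scale s u + scale t (u + v) = b + v + scale s' (u + v) + scale t' v" for s t s' t'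
  proof -
    have "scale (s + t) u + scale t v = scale s' u + scale (Suc (s' + t')) v"
      using that unfolding 1 2 by (simp only: add.assoc add_left_cancel)
    then show False using independent_inject[of u v "s + t" t s' "Suc (s' + t')"] ind by simp
  qed
  then show "cone b [u, u + v] \<inter> cone (b + v) [u + v, v] = {}" unfolding cone_plane by blast
  show "independent [u, u + v] \<and> independent [u + v, v]"
    using ind by (auto simp: algebra_simps)
qed

lemma cone_swap: "cone b [u, v] = cone b [v, u]"
  unfolding cone_plane by (metis add.assoc add.commute)

subsection \<open>Cones on which the distance is affine\<close>

text \<open>Unfolded, the recursion says that b + sum s_i u_i is reachable in layer k and has
  distance m + sum s_i r_i for all natural s_i.\<close>

fun affine :: "int \<Rightarrow> table \<Rightarrow> nat \<Rightarrow> int \<times> int \<Rightarrow> (int \<times> int) list \<Rightarrow> nat \<Rightarrow> nat list \<Rightarrow> bool" where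
  "affine n T k b [] m [] \<longleftrightarrow> (b, k) \<in> reachable n T \<and> dist_run n T (b, k) = m"
| "affine n T k b (u # us) m (r # rs) \<longleftrightarrow> (\<forall>s. affine n T k (b + scale s u) us (m + s * r) rs)"
| "affine n T k b _ m _ \<longleftrightarrow> False"

definition layer :: "nat \<Rightarrow> (int \<times> int) set \<Rightarrow> vertex set" where
  "layer k X = (\<lambda>x. (x, k)) ` X"

lemma layer_simps: "layer k (X \<union> Y) = layer k X \<union> layer k Y" "layer k X \<inter> layer k Y = layer k (X \<inter> Y)"
  "layer k {} = {}"
  by (auto simp: layer_def)

lemma affine_reachable: "affine n T k b us m rs \<Longrightarrow> layer k (cone b us) \<subseteq> reachable n T"
  by (induction n T k b us m rs rule: affine.induct) (auto simp: layer_def)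

text \<open>With equal slopes, moving the apex changes only the constant term; this is how a cone is
  compared with its translate along a direction.\<close>

lemma affine_translate:
  assumes "affine n T k b us m rs" "affine n T k (t + b) us (m + r) rs" "x \<in> cone b us"
  shows "dist_run n T (t + x, k) = dist_run n T (x, k) + r"
  using assms
proof (induction n T k b us m rs rule: affine.induct)
  case (2 n T k b u us m r' rs)
  then obtain s where s: "x \<in> cone (b + scale s u) us" by auto
  have "affine n T k (t + (b + scale s u)) us (m + s * r' + r) rs"
    using 2(3) by (simp add: add.assoc add.left_commute add.commute)
  then show ?case using 2 s by simp
qed auto

definition leaf_series :: "nat list \<times> nat \<Rightarrow> real fps" where
  "leaf_series l = fps_X ^ snd l * inverse (prod_list (map (\<lambda>r. 1 - fps_X ^ r) (fst l)))"

text \<open>Self-similarity replaces a multiple sum: removing the face spanned by the remaining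
  directions leaves a translate of the cone with all distances larger by \<open>r\<close>. Hence the
  series F satisfies F = face + z^r F, and \<open>r > 0\<close> makes 1 - z^r invertible.\<close>

lemma growth_of_affine:
  assumes "affine n T k b us m rs" "independent us" "\<forall>r\<in>set rs. 0 < r"
  shows "growth_of n T (layer k (cone b us)) = leaf_series (rs, m)"
  using assms
proof (induction n T k b us m rs rule: affine.induct)
  case (1 n T k b m)
  have "{v \<in> layer k (cone b []). dist_run n T v = i} = (if i = m then {(b, k)} else {})" for i
    using 1 by (auto simp: layer_def)
  then have "growth_of n T (layer k (cone b [])) = Abs_fps (\<lambda>i. if i = m then 1 else 0)"
    unfolding growth_of_def by (auto intro!: arg_cong[of _ _ Abs_fps])
  also have "\<dots> = fps_X ^ m" by (simp add: fps_X_power_iff)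
  finally show ?case by (simp add: leaf_series_def)
next
  case (2 n T k b u us m r rs)
  let ?X = "layer k (cone b (u # us))" and ?Y = "layer k (cone (b + u) (u # us))"
  have r: "0 < r" using 2 by simp
  have aff: "affine n T k (b + u) (u # us) (m + r) (r # rs)"
  proof -
    have "affine n T k (b + u + scale s u) us (m + r + s * r) rs" for s
      using 2(2)[unfolded affine.simps, rule_format, of "Suc s"] by (simp add: add.assoc)
    then show ?thesis by simp
  qed
  have XY: "?X = layer k (cone b us) \<union> ?Y" "layer k (cone b us) \<inter> ?Y = {}"
    using cone_Cons[of b u us] cone_Cons_disjoint[OF 2(3)] by (simp_all only: layer_simps)
  have aff0: "affine n T k b us m rs" using 2(2) by (auto dest: spec[of _ 0])
  have reach: "layer k (cone b us) \<subseteq> reachable n T" "?Y \<subseteq> reachable n T"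
    using affine_reachable[OF aff] affine_reachable[OF aff0] by auto
  have shift: "growth_of n T ?Y = fps_X ^ r * growth_of n T ?X"
  proof (rule fps_ext)
    fix i
    have Y: "?Y = (\<lambda>v. (u + fst v, snd v)) ` ?X"
      using cone_translate[of u b "u # us"] by (simp add: layer_def image_image add.commute del: cone.simps)
    have "dist_run n T (u + x, k) = dist_run n T (x, k) + r" if "x \<in> cone b (u # us)" for x
      using affine_translate[OF 2(2) _ that, of u r] aff by (simp only: add.commute[of u b])
    then have d: "dist_run n T (u + fst v, snd v) = dist_run n T v + r" if "v \<in> ?X" for v
      using that by (auto simp: layer_def simp del: cone.simps)
    show "fps_nth (growth_of n T ?Y) i = fps_nth (fps_X ^ r * growth_of n T ?X) i"
    proof (cases "i < r")
      case True
      then have "{v \<in> ?Y. dist_run n T v = i} = {}" using d unfolding Y by fastforce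
      then have "card {v \<in> ?Y. dist_run n T v = i} = 0" by (simp only: card.empty)
      then show ?thesis using True by (simp add: growth_of_def fps_X_power_mult_nth del: cone.simps)
    next
      case False
      then have "{v \<in> ?Y. dist_run n T v = i} = (\<lambda>v. (u + fst v, snd v)) ` {v \<in> ?X. dist_run n T v = i - r}"
        unfolding Y using d by (auto simp del: cone.simps)
      moreover have "inj_on (\<lambda>v::vertex. (u + fst v, snd v)) A" for A by (auto simp: inj_on_def)
      ultimately show ?thesis
        using False by (simp add: growth_of_def fps_X_power_mult_nth card_image del: cone.simps)
    qed
  qed
  have "independent us" using independent_tl[OF 2(3)] .
  then have "growth_of n T (layer k (cone b us)) = leaf_series (rs, m)"
    using 2(1)[of 0] aff0 2(4) by simp
  then have eq: "growth_of n T ?X = leaf_series (rs, m) + fps_X ^ r * growth_of n T ?X"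
    using growth_of_Un[OF reach XY(2)] XY(1) shift by simp
  then have *: "growth_of n T ?X * (1 - fps_X ^ r) = leaf_series (rs, m)"
    by (simp add: algebra_simps del: cone.simps)
  have "fps_nth (1 - fps_X ^ r :: real fps) 0 \<noteq> 0" using r by simp
  then have "growth_of n T ?X = growth_of n T ?X * ((1 - fps_X ^ r) * inverse (1 - fps_X ^ r))"
    by (simp add: inverse_mult_eq_1' del: cone.simps)
  also have "\<dots> = leaf_series (rs, m) * inverse (1 - fps_X ^ r)"
    unfolding mult.assoc[symmetric] * ..
  also have "\<dots> = leaf_series (r # rs, m)"
    by (simp add: leaf_series_def fps_inverse_mult mult.assoc mult.commute)
  finally show ?case .
qed auto

section \<open>Certified distances\<close>

text \<open>A leaf describes the geodesics to the points of a cone: run through the given words, inserting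
  before the end of each listed word any number of copies of the loop with the given index. A loop realises
  the translation by one of the vectors spanning the cone.\<close>

datatype tree = Leaf "(code \<times> nat) list" code | Peel tree tree | Star tree tree | Swap tree

type_synonym form = "int \<times> int \<times> int list"

text \<open>This is the path in which every loop is used zero times, so its endpoint is the apex of
  the cone.\<close>

fun travel :: "table \<Rightarrow> vertex \<Rightarrow> (code \<times> nat) list \<Rightarrow> code \<Rightarrow> vertex" where
  "travel T v [] w = run T w v"
| "travel T v ((u, l) # ps) w = travel T (run T u v) ps w"

text \<open>One loop word gives different translations in different cosets, since conjugation by C_k
  applies the linear part of C_k. The translation is therefore read off in the coset where the loop
  is inserted, and a prefix may serve to enter a suitable coset. Nonempty loops make the slopes
  positive.\<close>

fun loops_ok :: "int \<Rightarrow> table \<Rightarrow> code list \<Rightarrow> vertex \<Rightarrow> (code \<times> nat) list \<Rightarrow> (int \<times> int) list \<Rightarrow> bool" where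
  "loops_ok n T loops v [] us \<longleftrightarrow> us = []"
| "loops_ok n T loops v (p # ps) us \<longleftrightarrow> (case us of [] \<Rightarrow> False | t # ts \<Rightarrow>
     coded n (fst p) \<and> coded n (loops ! snd p) \<and> loops ! snd p \<noteq> [] \<and>
     run T (loops ! snd p) (0, snd (run T (fst p) v)) = (t, snd (run T (fst p) v)) \<and>
     loops_ok n T loops (run T (fst p) v) ps ts)"

text \<open>A form \<open>(p, q, a)\<close> stands for the function \<open>p i + q j + a\<^sub>k\<close> on the vertices. If it is 1-Lipschitz on the
  Cayley graph and at most zero at the base vertex, then it is a lower bound for the distance.\<close>

fun form_value :: "form \<Rightarrow> vertex \<Rightarrow> int" where
  "form_value (p, q, a) (b, k) = p * fst b + q * snd b + a ! k"

definition forms_ok :: "int \<Rightarrow> nat \<Rightarrow> table \<Rightarrow> form list \<Rightarrow> bool" where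
  "forms_ok n K T forms \<longleftrightarrow> list_all (\<lambda>f. form_value f (0, 0) \<le> 0 \<and>
     list_all (\<lambda>x. list_all (\<lambda>k. form_value f (step T x (0, k)) \<le> form_value f (0, k) + 1) [0..<K])
       (codes n)) forms"

fun form_slope :: "form \<Rightarrow> int \<times> int \<Rightarrow> int" where
  "form_slope (p, q, a) u = p * fst u + q * snd u"

text \<open>A single form has to serve the whole cone: its value at the apex and its slopes along
  the directions bound it at all points.\<close>

definition bounded_by_form :: "form list \<Rightarrow> vertex \<Rightarrow> (int \<times> int) list \<Rightarrow> int \<Rightarrow> nat list \<Rightarrow> bool" where
  "bounded_by_form forms v us m rs \<longleftrightarrow>
     list_ex (\<lambda>f. m \<le> form_value f v \<and> list_all2 (\<lambda>u r. int r \<le> form_slope f u) us rs) forms"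

text \<open>The lower bounds given by forms are not always sharp: when all neighbours of a vertex other than
  the base vertex have distance at least \<open>m - 1\<close>, its distance is at least \<open>m\<close>.\<close>

fun bounded_below :: "int \<Rightarrow> table \<Rightarrow> form list \<Rightarrow> nat \<Rightarrow> vertex \<Rightarrow> (int \<times> int) list \<Rightarrow> int \<Rightarrow> nat list \<Rightarrow> bool" where
  "bounded_below n T forms 0 v us m rs \<longleftrightarrow> bounded_by_form forms v us m rs"
| "bounded_below n T forms (Suc d) v us m rs \<longleftrightarrow> bounded_by_form forms v us m rs \<or>
     bounded_by_form forms v us 1 (map (\<lambda>_. 0) rs) \<and>
     list_all (\<lambda>x. bounded_below n T forms d (step T x v) us (m - 1) rs) (codes n)"

text \<open>\<open>Peel\<close> separates a face on which the formula of the interior fails.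
  \<open>Swap\<close> is there because loops must be met along the path in the order of the
  directions, and because only the first direction can be peeled. The depth \<open>2\<close> permits
  two rounds of the neighbour argument.\<close>

fun tree_ok :: "int \<Rightarrow> table \<Rightarrow> form list \<Rightarrow> code list \<Rightarrow> nat \<Rightarrow> int \<times> int \<Rightarrow> (int \<times> int) list \<Rightarrow> tree \<Rightarrow> bool" where
  "tree_ok n T forms loops k b us (Leaf ps w) \<longleftrightarrow>
     coded n w \<and> loops_ok n T loops (0, 0) ps us \<and> travel T (0, 0) ps w = (b, k) \<and>
     bounded_below n T forms 2 (b, k) us (int (length (concat (map fst ps) @ w)))
       (map (\<lambda>p. length (loops ! snd p)) ps)"
| "tree_ok n T forms loops k b us (Peel t t') \<longleftrightarrow> (case us of [] \<Rightarrow> False | u # us' \<Rightarrow>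
     tree_ok n T forms loops k b us' t \<and> tree_ok n T forms loops k (b + u) us t')"
| "tree_ok n T forms loops k b us (Star t t') \<longleftrightarrow> (case us of [u, v] \<Rightarrow>
     tree_ok n T forms loops k b [u, u + v] t \<and> tree_ok n T forms loops k (b + v) [u + v, v] t' | _ \<Rightarrow> False)"
| "tree_ok n T forms loops k b us (Swap t) \<longleftrightarrow> (case us of [u, v] \<Rightarrow>
     tree_ok n T forms loops k b [v, u] t | _ \<Rightarrow> False)"

fun leaves :: "code list \<Rightarrow> tree \<Rightarrow> (nat list \<times> nat) list" where
  "leaves loops (Leaf ps w) = [(map (\<lambda>p. length (loops ! snd p)) ps, length (concat (map fst ps) @ w))]"
| "leaves loops (Peel t t') = leaves loops t @ leaves loops t'"
| "leaves loops (Star t t') = leaves loops t @ leaves loops t'"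
| "leaves loops (Swap t) = leaves loops t"

subsection \<open>Upper bounds\<close>

text \<open>The upper-bound counterpart of \<open>affine\<close>. The start vertex is arbitrary so
  that an induction can move along the path from one loop to the next.\<close>

fun joined :: "int \<Rightarrow> table \<Rightarrow> vertex \<Rightarrow> nat \<Rightarrow> int \<times> int \<Rightarrow> (int \<times> int) list \<Rightarrow> nat \<Rightarrow> nat list \<Rightarrow> bool" where
  "joined n T v k b [] m [] \<longleftrightarrow> (\<exists>w. coded n w \<and> length w = m \<and> run T w v = (b, k))"
| "joined n T v k b (u # us) m (r # rs) \<longleftrightarrow> (\<forall>s. joined n T v k (b + scale s u) us (m + s * r) rs)"
| "joined n T v k b _ m _ \<longleftrightarrow> False"

lemma joined_word: "joined n T v k b us m rs \<Longrightarrow> \<exists>w c. coded n w \<and> run T w v = (c, k)"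
proof (induction us arbitrary: b m rs)
  case Nil
  then show ?case by (cases rs) auto
next
  case (Cons u us)
  then obtain r rs' where rs: "rs = r # rs'" by (cases rs) auto
  then have "\<forall>s. joined n T v k (b + scale s u) us (m + s * r) rs'" using Cons.prems by simp
  then have "joined n T v k (b + scale 0 u) us (m + 0 * r) rs'" by (rule spec)
  then show ?case by (rule Cons.IH)
qed

lemma joined_append:
  "joined n T (run T u v) k b us m rs \<Longrightarrow> coded n u \<Longrightarrow> joined n T v k b us (length u + m) rs"
proof (induction n T "run T u v" k b us m rs rule: joined.induct)
  case (1 n T k b m)
  then obtain w where "coded n w" "length w = m" "run T w (run T u v) = (b, k)" by auto
  then show ?case using 1 by (auto intro!: exI[of _ "u @ w"])
qed (auto simp: add.assoc)

lemma joined_shift: "joined n T v k b us m rs \<Longrightarrow> joined n T (shift t v) k (t + b) us m rs"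
proof (induction n T v k b us m rs rule: joined.induct)
  case (1 n T v k b m)
  then obtain w where w: "coded n w" "length w = m" "run T w v = (b, k)" by auto
  then have "run T w (shift t v) = (t + b, k)" by (simp add: run_shift)
  then show ?case using w by auto
qed (auto simp: add.assoc)

lemma loop_power:
  assumes "coded n l" "run T l (0, k) = (u, k)"
  shows "\<exists>w. coded n w \<and> length w = s * length l \<and> run T w (b, k) = shift (scale s u) (b, k)"
proof (induction s)
  case (Suc s)
  then obtain w where w: "coded n w" "length w = s * length l" "run T w (b, k) = shift (scale s u) (b, k)"
    by blast
  then have "run T (w @ l) (b, k) = shift (scale (Suc s) u) (b, k)"
    using run_eq_shift[of T l "scale s u + b" k] assms(2) by (simp add: ac_simps)
  then show ?case using w assms(1) by (intro exI[of _ "w @ l"]) simp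
qed auto

text \<open>Copies of a loop translate the current vertex without changing its coset. By
  equivariance the rest of the path, read unchanged, then ends at the translated endpoint.\<close>

lemma loops_joined:
  assumes "loops_ok n T loops v ps us" "travel T v ps w = (b, k)" "coded n w"
  shows "joined n T v k b us (length (concat (map fst ps) @ w)) (map (\<lambda>p. length (loops ! snd p)) ps)"
  using assms(1,2)
proof (induction ps arbitrary: v us)
  case Nil
  then show ?case using assms(3) by (auto intro!: exI[of _ w])
next
  case (Cons p ps)
  obtain t ts where us: "us = t # ts" using Cons.prems(1) by (cases us) auto
  obtain c k' where v': "run T (fst p) v = (c, k')" by fastforce
  let ?l = "loops ! snd p"
  let ?rs = "map (\<lambda>p. length (loops ! snd p)) ps" and ?m = "length (concat (map fst ps) @ w)"
  have p: "coded n (fst p)" "coded n ?l" "run T ?l (0, k') = (t, k')" "loops_ok n T loops (c, k') ps ts"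
    using Cons.prems(1) us v' by auto
  have "travel T (c, k') ps w = (b, k)" using Cons.prems(2) v' by (cases p) simp
  then have IH: "joined n T (c, k') k b ts ?m ?rs" using Cons.IH p(4) by blast
  have "joined n T v k (b + scale s t) ts (length (concat (map fst (p # ps)) @ w) + s * length ?l) ?rs" for s
  proof -
    obtain u where u: "coded n u" "length u = s * length ?l" "run T u (c, k') = shift (scale s t) (c, k')"
      using loop_power[OF p(2,3)] by blast
    have "joined n T (run T (fst p @ u) v) k (scale s t + b) ts ?m ?rs"
      using joined_shift[OF IH] u(3) v' by simp
    then have "joined n T v k (scale s t + b) ts (length (fst p @ u) + ?m) ?rs"
      using joined_append[of n T "fst p @ u" v k "scale s t + b" ts ?m ?rs] p(1) u(1) by simp
    then show ?thesis using u(2) by (simp add: ac_simps)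
  qed
  then show ?case using us by simp
qed

subsection \<open>Lower bounds\<close>

fun separated :: "int \<Rightarrow> table \<Rightarrow> vertex \<Rightarrow> (int \<times> int) list \<Rightarrow> int \<Rightarrow> nat list \<Rightarrow> bool" where
  "separated n T v [] m [] \<longleftrightarrow> (\<forall>w. coded n w \<and> run T w (0, 0) = v \<longrightarrow> m \<le> int (length w))"
| "separated n T v (u # us) m (r # rs) \<longleftrightarrow>
     (\<forall>s. separated n T (shift (scale s u) v) us (m + int (s * r)) rs)"
| "separated n T v _ m _ \<longleftrightarrow> False"

lemma joined_separated_affine:
  "joined n T (0, 0) k b us m rs \<Longrightarrow> separated n T (b, k) us (int m) rs \<Longrightarrow> affine n T k b us m rs"
proof (induction n T "(0, 0) :: vertex" k b us m rs rule: joined.induct)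
  case (1 n T k b m)
  then obtain w where w: "coded n w" "length w = m" "run T w (0, 0) = (b, k)" by auto
  have "dist_run n T (b, k) = m"
    unfolding dist_run_def using 1(2) w by (intro Least_equality) auto
  then show ?case using w by (force simp: reachable_def)
next
  case (2 n T k b u us m r rs)
  then show ?case by (simp add: add.commute)
qed auto

lemma form_value_shift: "form_value f (shift t v) = form_value f v + form_slope f t"
  by (cases f; cases v) (simp add: algebra_simps)

lemma form_slope_scale: "form_slope f (scale s u) = int s * form_slope f u"
  by (cases f) (simp add: scale_def algebra_simps)

context
  fixes n T K forms
  assumes table: "table_ok n K T" and forms: "forms_ok n K T forms"
begin

text \<open>A 1-Lipschitz function increases by at most one per letter. The test at
  \<open>(0, k)\<close> suffices because a shift adds the same slope term to both sides.\<close>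

lemma form_value_run:
  assumes "f \<in> set forms" "coded n w"
  shows "form_value f (run T w (0, 0)) \<le> int (length w)"
  using assms(2)
proof (induction w rule: rev_induct)
  case Nil
  then show ?case using forms assms(1) by (simp add: forms_ok_def list_all_iff)
next
  case (snoc x w)
  obtain b k where v: "run T w (0, 0) = (b, k)" by fastforce
  have "k < K" using table_ok_run[OF table, of w "(0, 0)"] table snoc.prems v by (simp add: table_ok_def)
  moreover have "x \<in> set (codes n)" using snoc.prems by (simp add: set_codes)
  ultimately have "form_value f (step T x (0, k)) \<le> form_value f (0, k) + 1"
    using forms assms(1) by (simp add: forms_ok_def list_all_iff del: step.simps form_value.simps)
  then have "form_value f (shift b (step T x (0, k))) \<le> form_value f (shift b (0, k)) + 1"
    unfolding form_value_shift by linarith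
  then have "form_value f (step T x (b, k)) \<le> form_value f (b, k) + 1"
    by (simp add: step_eq_shift[of T x b k] del: step.simps form_value.simps)
  then show ?case using snoc v by (simp del: step.simps form_value.simps)
qed

lemma form_separated:
  assumes "f \<in> set forms" "m \<le> form_value f v" "list_all2 (\<lambda>u r. int r \<le> form_slope f u) us rs"
  shows "separated n T v us m rs"
  using assms(3,2)
proof (induction us rs arbitrary: v m rule: list_all2_induct)
  case Nil
  then show ?case using form_value_run[OF assms(1)] by fastforce
next
  case (Cons u us r rs)
  have "m + int (s * r) \<le> form_value f (shift (scale s u) v)" for s
    using Cons.prems mult_left_mono[OF Cons.hyps(1), of "int s"]
    by (simp add: form_value_shift form_slope_scale)
  then show ?case using Cons.IH by simp
qed

lemma bounded_by_form_separated: "bounded_by_form forms v us m rs \<Longrightarrow> separated n T v us m rs"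
  unfolding bounded_by_form_def list_ex_iff using form_separated by blast

text \<open>A nonempty word ending at \<open>v\<close> visits a neighbour of \<open>v\<close> one
  letter earlier. The argument treats a whole cone at once, since steps commute with the shifts
  along it.\<close>

lemma neighbours_separated:
  assumes "separated n T v us 1 (map (\<lambda>_. 0) rs)" "snd v < K"
    and "\<forall>x\<in>set (codes n). separated n T (step T x v) us (m - 1) rs"
  shows "separated n T v us m rs"
  using assms
proof (induction us arbitrary: v m rs)
  case Nil
  note prems = Nil.prems
  have [simp]: "rs = []" using prems(1) by (cases rs) auto
  have "m \<le> int (length w)" if w: "coded n w" "run T w (0, 0) = v" for w
  proof (cases w rule: rev_cases)
    case Nil
    \<comment> \<open>The bound \<open>1\<close> excludes the base vertex, the only vertex reached
      by the empty word.\<close>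
    have "1 \<le> int (length w)" using prems(1) w by simp
    then show ?thesis using Nil by simp
  next
    case (snoc w' x)
    have x: "coded n w'" "x \<in> set (codes n)" "- x \<in> set (codes n)"
      using w(1) snoc by (auto simp: set_codes)
    have "snd (run T w' (0, 0)) < K"
      using table_ok_run[OF table x(1), of "(0, 0)"] table by (simp add: table_ok_def)
    \<comment> \<open>The letter \<open>- x\<close> undoes the last one, and codes are closed under
      negation, so the predecessor is one of the tested neighbours.\<close>
    then have "run T w' (0, 0) = step T (- x) v"
      using table_ok_step(2)[OF table x(2), of "run T w' (0, 0)"] w(2) snoc by (simp del: step.simps)
    then have "m - 1 \<le> int (length w')" using prems(3) x(1,3) by fastforce
    then show ?thesis using snoc by simp
  qed
  then show ?case by simp
next
  case (Cons u us)
  then obtain r rs' where rs: "rs = r # rs'" by (cases rs) auto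
  have "separated n T (shift (scale s u) v) us (m + int (s * r)) rs'" for s
  proof (rule Cons.IH)
    have "\<forall>s. separated n T (shift (scale s u) v) us (1 + int (s * 0)) (map (\<lambda>_. 0) rs')"
      using Cons.prems(1) rs by simp
    then show "separated n T (shift (scale s u) v) us 1 (map (\<lambda>_. 0) rs')" by simp
    show "snd (shift (scale s u) v) < K" using Cons.prems(2) by simp
    have "m - 1 + int (s * r) = m + int (s * r) - 1" by simp
    then show "\<forall>x\<in>set (codes n). separated n T (step T x (shift (scale s u) v)) us (m + int (s * r) - 1) rs'"
      using Cons.prems(3) unfolding rs separated.simps step_shift by metis
  qed
  then show ?case using rs by simp
qed

lemma bounded_below_separated:
  "bounded_below n T forms d v us m rs \<Longrightarrow> snd v < K \<Longrightarrow> separated n T v us m rs"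
proof (induction d arbitrary: v m)
  case (Suc d)
  consider "bounded_by_form forms v us m rs" | "bounded_by_form forms v us 1 (map (\<lambda>_. 0) rs)"
    "\<forall>x\<in>set (codes n). bounded_below n T forms d (step T x v) us (m - 1) rs"
    using Suc.prems by (auto simp: list_all_iff)
  then show ?case
  proof cases
    case 2
    then have "\<forall>x\<in>set (codes n). separated n T (step T x v) us (m - 1) rs"
      using Suc.IH Suc.prems(2) table_ok_step(1)[OF table] by blast
    then show ?thesis
      using neighbours_separated 2(1) bounded_by_form_separated Suc.prems(2) by blast
  qed (rule bounded_by_form_separated)
qed (simp add: bounded_by_form_separated)

text \<open>All distance estimates happen at the leaves, where path and lower bound agree; the inner
  nodes only record disjoint decompositions, over which the series add up.\<close>

lemma tree_ok_growth:
  assumes "tree_ok n T forms loops k b us t" "independent us"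
  shows "layer k (cone b us) \<subseteq> reachable n T \<and>
    growth_of n T (layer k (cone b us)) = sum_list (map leaf_series (leaves loops t))"
  using assms
proof (induction t arbitrary: b us)
  case (Leaf ps w)
  let ?m = "length (concat (map fst ps) @ w)" and ?rs = "map (\<lambda>p. length (loops ! snd p)) ps"
  have ok: "coded n w" "loops_ok n T loops (0, 0) ps us" "travel T (0, 0) ps w = (b, k)"
    and below: "bounded_below n T forms 2 (b, k) us (int ?m) ?rs"
    using Leaf.prems(1) by auto
  have loops: "\<forall>p\<in>set ps. loops ! snd p \<noteq> []" if "loops_ok n T loops v ps us" for v us
    using that by (induction n T loops v ps us rule: loops_ok.induct) (auto split: list.splits)
  have J: "joined n T (0, 0) k b us ?m ?rs" by (rule loops_joined[OF ok(2,3,1)])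
  \<comment> \<open>The path to the apex ends in layer \<open>k\<close>, and runs never leave the
    cosets below \<open>K\<close>.\<close>
  have "k < K"
  proof -
    obtain w c where "coded n w" "run T w (0, 0) = (c, k)" using joined_word[OF J] by blast
    then show ?thesis using table_ok_run[OF table, of w "(0, 0)"] table by (simp add: table_ok_def)
  qed
  then have "affine n T k b us ?m ?rs"
    using joined_separated_affine[OF J] bounded_below_separated[OF below] by simp
  then show ?case
    using affine_reachable growth_of_affine[of n T k b us ?m ?rs] Leaf.prems(2) loops[OF ok(2)] by simp
next
  case (Peel t t')
  then obtain u us' where us: "us = u # us'" by (cases us) auto
  have "independent us'" using Peel.prems(2) independent_tl us by simp
  then have "layer k (cone b us') \<subseteq> reachable n T \<and>
      growth_of n T (layer k (cone b us')) = sum_list (map leaf_series (leaves loops t))"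
    "layer k (cone (b + u) us) \<subseteq> reachable n T \<and>
      growth_of n T (layer k (cone (b + u) us)) = sum_list (map leaf_series (leaves loops t'))"
    using Peel us by (auto simp del: cone.simps)
  moreover have "layer k (cone b us) = layer k (cone b us') \<union> layer k (cone (b + u) us)"
    "layer k (cone b us') \<inter> layer k (cone (b + u) us) = {}"
    using cone_Cons[of b u us'] cone_Cons_disjoint[of u us' b] Peel.prems(2) us
    by (simp_all only: layer_simps)
  ultimately show ?case using growth_of_Un by simp
next
  case (Star t t')
  then obtain u v where us: "us = [u, v]" by (auto split: list.splits)
  note star = cone_star[of u v, folded us]
  have "layer k (cone b [u, u + v]) \<subseteq> reachable n T \<and>
      growth_of n T (layer k (cone b [u, u + v])) = sum_list (map leaf_series (leaves loops t))"
    "layer k (cone (b + v) [u + v, v]) \<subseteq> reachable n T \<and>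
      growth_of n T (layer k (cone (b + v) [u + v, v])) = sum_list (map leaf_series (leaves loops t'))"
    using Star star(3) us by (auto simp del: cone.simps independent.simps)
  moreover have "layer k (cone b us) = layer k (cone b [u, u + v]) \<union> layer k (cone (b + v) [u + v, v])"
    "layer k (cone b [u, u + v]) \<inter> layer k (cone (b + v) [u + v, v]) = {}"
    using cone_star(1)[of b u v] cone_star(2)[of u v b] Star.prems(2) us by (simp_all only: layer_simps)
  ultimately show ?case using growth_of_Un by simp
next
  case (Swap t)
  then obtain u v where us: "us = [u, v]" by (auto split: list.splits)
  have "independent [v, u]" using Swap.prems(2) us by (simp add: mult.commute)
  then show ?case using Swap us cone_swap[of b u v] by (simp del: cone.simps independent.simps)
qed

end

section \<open>From cones to quadrants, cosets and the whole graph\<close>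

definition quadrants :: "((int \<times> int) \<times> (int \<times> int) list) list" where
  "quadrants = [((0, 0), [(1, 0), (0, 1)]), ((-1, 0), [(0, 1), (-1, 0)]),
     ((-1, -1), [(-1, 0), (0, -1)]), ((0, -1), [(0, -1), (1, 0)])]"

text \<open>The apexes \<open>(-1, 0)\<close>, \<open>(-1, -1)\<close> and \<open>(0, -1)\<close>
  make the quadrants half-open, so that each point of an axis belongs to exactly one of
  them.\<close>

lemma quadrant_cones:
  "cone (0, 0) [(1, 0), (0, 1)] = {x. 0 \<le> fst x \<and> 0 \<le> snd x}"
  "cone (-1, 0) [(0, 1), (-1, 0)] = {x. fst x < 0 \<and> 0 \<le> snd x}"
  "cone (-1, -1) [(-1, 0), (0, -1)] = {x. fst x < 0 \<and> snd x < 0}"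
  "cone (0, -1) [(0, -1), (1, 0)] = {x. 0 \<le> fst x \<and> snd x < 0}"
proof -
  have "\<exists>s t. x = (0, 0) + scale s (1, 0) + scale t (0, 1)" if "0 \<le> fst x" "0 \<le> snd x" for x
    using that by (intro exI[of _ "nat (fst x)"] exI[of _ "nat (snd x)"]) (auto simp: scale_def prod_eq_iff)
  moreover have "\<exists>s t. x = (-1, 0) + scale s (0, 1) + scale t (-1, 0)" if "fst x < 0" "0 \<le> snd x" for x
    using that by (intro exI[of _ "nat (snd x)"] exI[of _ "nat (- fst x - 1)"]) (auto simp: scale_def prod_eq_iff)
  moreover have "\<exists>s t. x = (-1, -1) + scale s (-1, 0) + scale t (0, -1)" if "fst x < 0" "snd x < 0" for x
    using that by (intro exI[of _ "nat (- fst x - 1)"] exI[of _ "nat (- snd x - 1)"]) (auto simp: scale_def prod_eq_iff)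
  moreover have "\<exists>s t. x = (0, -1) + scale s (0, -1) + scale t (1, 0)" if "0 \<le> fst x" "snd x < 0" for x
    using that by (intro exI[of _ "nat (- snd x - 1)"] exI[of _ "nat (fst x)"]) (auto simp: scale_def prod_eq_iff)
  ultimately show
    "cone (0, 0) [(1, 0), (0, 1)] = {x. 0 \<le> fst x \<and> 0 \<le> snd x}"
    "cone (-1, 0) [(0, 1), (-1, 0)] = {x. fst x < 0 \<and> 0 \<le> snd x}"
    "cone (-1, -1) [(-1, 0), (0, -1)] = {x. fst x < 0 \<and> snd x < 0}"
    "cone (0, -1) [(0, -1), (1, 0)] = {x. 0 \<le> fst x \<and> snd x < 0}"
    unfolding cone_plane by (auto simp: scale_def)
qed

definition trees_ok :: "int \<Rightarrow> table \<Rightarrow> nat \<Rightarrow> form list \<Rightarrow> code list \<Rightarrow> tree list list \<Rightarrow> bool" where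
  "trees_ok n T K forms loops trees \<longleftrightarrow> forms_ok n K T forms \<and> length trees = K \<and>
     list_all (\<lambda>k. list_all2 (\<lambda>c t. tree_ok n T forms loops k (fst c) (snd c) t) quadrants (trees ! k)) [0..<K]"

lemma layer_growth:
  assumes "table_ok n K T" "forms_ok n K T forms"
    and "list_all2 (\<lambda>c t. tree_ok n T forms loops k (fst c) (snd c) t) quadrants ts"
  shows "layer k UNIV \<subseteq> reachable n T \<and>
    growth_of n T (layer k UNIV) = sum_list (map leaf_series (concat (map (leaves loops) ts)))"
proof -
  obtain t1 t2 t3 t4 where ts: "ts = [t1, t2, t3, t4]"
    and ok: "tree_ok n T forms loops k (0, 0) [(1, 0), (0, 1)] t1"
      "tree_ok n T forms loops k (-1, 0) [(0, 1), (-1, 0)] t2"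
      "tree_ok n T forms loops k (-1, -1) [(-1, 0), (0, -1)] t3"
      "tree_ok n T forms loops k (0, -1) [(0, -1), (1, 0)] t4"
    using assms(3) by (auto simp: quadrants_def list_all2_Cons1)
  note growth = tree_ok_growth[OF assms(1,2)]
  let ?Q = "\<lambda>P. layer k {x::int \<times> int. P x}"
  note q = growth[OF ok(1), unfolded quadrant_cones] growth[OF ok(2), unfolded quadrant_cones]
    growth[OF ok(3), unfolded quadrant_cones] growth[OF ok(4), unfolded quadrant_cones]
  have eq: "layer k UNIV = ?Q (\<lambda>x. 0 \<le> fst x \<and> 0 \<le> snd x) \<union> (?Q (\<lambda>x. fst x < 0 \<and> 0 \<le> snd x)
      \<union> (?Q (\<lambda>x. fst x < 0 \<and> snd x < 0) \<union> ?Q (\<lambda>x. 0 \<le> fst x \<and> snd x < 0)))"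
    unfolding layer_simps(1)[symmetric] by (rule arg_cong[of _ _ "layer k"]) auto
  have disj: "?Q (\<lambda>x. 0 \<le> fst x \<and> 0 \<le> snd x) \<inter> (?Q (\<lambda>x. fst x < 0 \<and> 0 \<le> snd x)
      \<union> (?Q (\<lambda>x. fst x < 0 \<and> snd x < 0) \<union> ?Q (\<lambda>x. 0 \<le> fst x \<and> snd x < 0))) = {}"
    "?Q (\<lambda>x. fst x < 0 \<and> 0 \<le> snd x) \<inter>
       (?Q (\<lambda>x. fst x < 0 \<and> snd x < 0) \<union> ?Q (\<lambda>x. 0 \<le> fst x \<and> snd x < 0)) = {}"
    "?Q (\<lambda>x. fst x < 0 \<and> snd x < 0) \<inter> ?Q (\<lambda>x. 0 \<le> fst x \<and> snd x < 0) = {}"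
    by (auto simp: layer_def)
  show ?thesis
    unfolding eq using q disj by (simp add: growth_of_Un ts)
qed

lemma trees_ok_growth:
  assumes "table_ok n K T" "trees_ok n T K forms loops trees"
  shows "growth_of n T (reachable n T)
    = sum_list (map leaf_series (concat (map (leaves loops) (concat trees))))"
proof -
  have forms: "forms_ok n K T forms" and len: "length trees = K"
    and ok: "\<And>k. k < K \<Longrightarrow>
      list_all2 (\<lambda>c t. tree_ok n T forms loops k (fst c) (snd c) t) quadrants (trees ! k)"
    using assms(2) by (auto simp: trees_ok_def list_all_iff)
  have "(\<Union>k<m. layer k UNIV) \<subseteq> reachable n T \<and> growth_of n T (\<Union>k<m. layer k UNIV)
      = sum_list (map leaf_series (concat (map (leaves loops) (concat (take m trees)))))" if "m \<le> K" for m
    using that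
  proof (induction m)
    case 0
    show ?case by (simp add: growth_of_def fps_eq_iff)
  next
    case (Suc m)
    have m: "m < K" using Suc.prems by simp
    have "(\<Union>k<m. layer k UNIV) \<inter> layer m UNIV = {}" by (auto simp: layer_def)
    moreover have "(\<Union>k<Suc m. layer k UNIV) = (\<Union>k<m. layer k UNIV) \<union> layer m UNIV"
      by (simp add: lessThan_Suc Un_commute)
    ultimately show ?case
      using Suc.IH m layer_growth[OF assms(1) forms ok[OF m]] len
      by (simp add: growth_of_Un take_Suc_conv_app_nth)
  qed
  from this[of K] have "(\<Union>k<K. layer k UNIV) \<subseteq> reachable n T" "growth_of n T (\<Union>k<K. layer k UNIV)
      = sum_list (map leaf_series (concat (map (leaves loops) (concat trees))))"
    using len by auto
  \<comment> \<open>The trees already showed that all vertices of the \<open>K\<close> layers are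
    reachable; conversely no run leaves these layers.\<close>
  moreover have "reachable n T \<subseteq> (\<Union>k<K. layer k UNIV)"
  proof
    fix v assume "v \<in> reachable n T"
    then have "snd v < K"
      using table_ok_run[OF assms(1), of _ "(0, 0)"] assms(1) by (auto simp: reachable_def table_ok_def)
    then show "v \<in> (\<Union>k<K. layer k UNIV)" by (cases v) (auto simp: layer_def)
  qed
  ultimately show ?thesis by (metis subset_antisym)
qed

section \<open>Summing the series\<close>

text \<open>Coefficient lists, constant term first, are the computable stand-ins for polynomials
  regarded as power series.\<close>

fun poly_fps :: "int list \<Rightarrow> real fps" where
  "poly_fps [] = 0"
| "poly_fps (a # p) = fps_const (of_int a) + fps_X * poly_fps p"

fun add_poly :: "int list \<Rightarrow> int list \<Rightarrow> int list" where
  "add_poly [] q = q"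
| "add_poly p [] = p"
| "add_poly (a # p) (b # q) = (a + b) # add_poly p q"

fun mult_poly :: "int list \<Rightarrow> int list \<Rightarrow> int list" where
  "mult_poly [] q = []"
| "mult_poly (a # p) q = add_poly (map ((*) a) q) (0 # mult_poly p q)"

definition shift_poly :: "nat \<Rightarrow> int list \<Rightarrow> int list" where
  "shift_poly r p = replicate r 0 @ p"

text \<open>Testing the difference makes trailing zeros irrelevant.\<close>

definition same_poly :: "int list \<Rightarrow> int list \<Rightarrow> bool" where
  "same_poly p q \<longleftrightarrow> list_all (\<lambda>a. a = 0) (add_poly p (map uminus q))"

lemma poly_fps_map_mult: "poly_fps (map ((*) a) p) = fps_const (of_int a) * poly_fps p"
  by (induction p) (auto simp: algebra_simps fps_const_mult[symmetric] simp del: fps_const_mult)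

lemma poly_fps_uminus: "poly_fps (map uminus p) = - poly_fps p"
  by (induction p) (auto simp: algebra_simps fps_const_neg[symmetric] simp del: fps_const_neg)

lemma poly_fps_add: "poly_fps (add_poly p q) = poly_fps p + poly_fps q"
  by (induction p q rule: add_poly.induct)
    (auto simp: algebra_simps fps_const_add[symmetric] simp del: fps_const_add)

lemma poly_fps_mult: "poly_fps (mult_poly p q) = poly_fps p * poly_fps q"
  by (induction p) (auto simp: poly_fps_add poly_fps_map_mult algebra_simps)

lemma poly_fps_shift: "poly_fps (shift_poly r p) = fps_X ^ r * poly_fps p"
  by (induction r) (auto simp: shift_poly_def algebra_simps)

lemma same_poly_fps: "same_poly p q \<Longrightarrow> poly_fps p = poly_fps q"
proof -
  have "poly_fps r = 0" if "list_all (\<lambda>a. a = 0) r" for r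
    using that by (induction r) auto
  then show "same_poly p q \<Longrightarrow> poly_fps p = poly_fps q"
    using poly_fps_add[of p "map uminus q"] by (simp add: same_poly_def poly_fps_uminus)
qed

text \<open>Every pair \<open>(rs, q)\<close> in \<open>types\<close> satisfies \<open>1 / \<Prod>(1 - X\<^sup>r) = q / Q\<close>.\<close>

definition types_ok :: "int list \<Rightarrow> (nat list \<times> int list) list \<Rightarrow> bool" where
  "types_ok Q types \<longleftrightarrow> Q \<noteq> [] \<and> hd Q = 1 \<and>
     list_all (\<lambda>t. list_all (\<lambda>r. 0 < r) (fst t) \<and>
       same_poly (foldr (\<lambda>r q. add_poly q (shift_poly r (map uminus q))) (fst t) (snd t)) Q) types"

fun sum_leaves :: "(nat list \<times> int list) list \<Rightarrow> (nat list \<times> nat) list \<Rightarrow> int list" where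
  "sum_leaves types [] = []"
| "sum_leaves types (l # ls) =
     add_poly (shift_poly (snd l) (the (map_of types (fst l)))) (sum_leaves types ls)"

text \<open>The last test is the equation N / D = (sum of numerators) / Q, cross-multiplied. The
  middle one protects the use of \<open>the\<close> in \<open>sum_leaves\<close>.\<close>

definition series_ok ::
  "int list \<Rightarrow> (nat list \<times> int list) list \<Rightarrow> (nat list \<times> nat) list \<Rightarrow> int list \<Rightarrow> int list \<Rightarrow> bool" where
  "series_ok Q types ls N D \<longleftrightarrow> types_ok Q types \<and>
     list_all (\<lambda>l. map_of types (fst l) \<noteq> None) ls \<and>
     same_poly (mult_poly N Q) (mult_poly D (sum_leaves types ls))"

lemma foldr_one_minus:
  "poly_fps (foldr (\<lambda>r q. add_poly q (shift_poly r (map uminus q))) rs q)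
    = prod_list (map (\<lambda>r. 1 - fps_X ^ r) rs) * poly_fps q"
  by (induction rs) (auto simp: poly_fps_add poly_fps_shift poly_fps_uminus algebra_simps)

lemma sum_leaves_series:
  assumes "types_ok Q types" "list_all (\<lambda>l. map_of types (fst l) \<noteq> None) ls"
  shows "sum_list (map leaf_series ls) * poly_fps Q = poly_fps (sum_leaves types ls)"
  using assms(2)
proof (induction ls)
  case (Cons l ls)
  obtain q where q: "map_of types (fst l) = Some q" using Cons.prems by auto
  let ?P = "prod_list (map (\<lambda>r. 1 - fps_X ^ r) (fst l)) :: real fps"
  have "(fst l, q) \<in> set types" using q by (rule map_of_SomeD)
  then have pos: "\<forall>r\<in>set (fst l). 0 < r"
    and same: "same_poly (foldr (\<lambda>r q. add_poly q (shift_poly r (map uminus q))) (fst l) q) Q"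
    using assms(1) by (auto simp: types_ok_def list_all_iff)
  have Q: "poly_fps Q = ?P * poly_fps q"
    using same_poly_fps[OF same] unfolding foldr_one_minus by (rule HOL.sym)
  have "fps_nth (prod_list (map (\<lambda>r. 1 - fps_X ^ r) rs) :: real fps) 0 = 1"
    if "\<forall>r\<in>set rs. 0 < r" for rs :: "nat list"
    using that by (induction rs) (auto simp: fps_mult_nth_0)
  then have P: "inverse ?P * ?P = 1" using pos by (intro inverse_mult_eq_1) simp
  have "leaf_series l * poly_fps Q = fps_X ^ snd l * ((inverse ?P * ?P) * poly_fps q)"
    unfolding leaf_series_def Q by (simp only: mult.assoc)
  also have "\<dots> = poly_fps (shift_poly (snd l) q)" unfolding P by (simp add: poly_fps_shift)
  finally show ?case using Cons q by (simp add: distrib_right poly_fps_add)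
qed simp

text \<open>The constant term of Q is 1, so Q is nonzero and can be cancelled among power
  series.\<close>

lemma series_ok_eq:
  assumes "series_ok Q types ls N D"
  shows "sum_list (map leaf_series ls) * poly_fps D = poly_fps N"
proof -
  let ?S = "sum_list (map leaf_series ls)"
  have t: "types_ok Q types" "list_all (\<lambda>l. map_of types (fst l) \<noteq> None) ls"
    and s: "same_poly (mult_poly N Q) (mult_poly D (sum_leaves types ls))"
    using assms by (auto simp: series_ok_def)
  have "fps_nth (poly_fps Q) 0 = 1" using t(1) by (cases Q) (auto simp: types_ok_def)
  then have Q: "poly_fps Q \<noteq> 0" by auto
  have "poly_fps N * poly_fps Q = poly_fps D * (?S * poly_fps Q)"
    using same_poly_fps[OF s] sum_leaves_series[OF t] by (simp add: poly_fps_mult)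
  then have "(?S * poly_fps D) * poly_fps Q = poly_fps N * poly_fps Q" by (simp only: mult_ac)
  then show ?thesis using Q by simp
qed

theorem (in tabled_presentation) growth_series_certified:
  assumes "trees_ok n T K forms loops trees"
    and "series_ok Q types (concat (map (leaves loops) (concat trees))) N D"
  shows "series p * poly_fps D = poly_fps N"
proof -
  have "series p = growth_of n T (reachable n T)"
    using growth_set[of "\<lambda>d. d = _"] by (simp add: growth_series_def spherical_growth_def growth_of_def)
  then show ?thesis using trees_ok_growth[OF table_ok assms(1)] series_ok_eq[OF assms(2)] by simp
qed

section \<open>Closed forms\<close>

text \<open>A coefficient of a product with a polynomial. For a concrete denominator, unfolding it
  yields the linear recurrence of the sequence.\<close>

fun convolve :: "int list \<Rightarrow> (nat \<Rightarrow> real) \<Rightarrow> nat \<Rightarrow> real" where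
  "convolve [] s n = 0"
| "convolve (a # d) s 0 = of_int a * s 0"
| "convolve (a # d) s (Suc n) = of_int a * s (Suc n) + convolve d s n"

fun coefficient :: "int list \<Rightarrow> nat \<Rightarrow> real" where
  "coefficient [] n = 0"
| "coefficient (a # p) 0 = of_int a"
| "coefficient (a # p) (Suc n) = coefficient p n"

lemma coefficient_poly_fps: "fps_nth (poly_fps p) n = coefficient p n"
  by (induction p n rule: coefficient.induct) auto

lemma convolve_poly_fps: "fps_nth (S * poly_fps d) n = convolve d (fps_nth S) n"
proof (induction d "fps_nth S" n rule: convolve.induct)
  case (3 a d n)
  have "S * (fps_X * poly_fps d) = fps_X * (S * poly_fps d)" by (simp only: mult.left_commute)
  then have "fps_nth (S * (fps_X * poly_fps d)) (Suc n) = fps_nth (S * poly_fps d) n"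
    by (simp only: fps_X_mult_nth) simp
  then show ?case using 3 by (simp add: distrib_left mult.commute)
qed (auto simp: fps_mult_nth_0)

lemma sph_convolve:
  assumes "series p * poly_fps d = poly_fps q"
  shows "convolve d (sph p) n = coefficient q n"
proof -
  have "fps_nth (series p) = sph p" by (simp add: growth_series_def fun_eq_iff)
  then show ?thesis using convolve_poly_fps[of "series p" d n] coefficient_poly_fps[of q n] assms by simp
qed

text \<open>Expanding the fraction by \<open>e\<close> serves to reach a denominator (1 - z^m)^2,
  whose recurrence links only indices in one residue class modulo m.\<close>

lemma sph_convolve_mult:
  assumes "series p * poly_fps d = poly_fps q"
  shows "convolve (mult_poly d e) (sph p) n = coefficient (mult_poly q e) n"
  by (rule sph_convolve) (simp add: poly_fps_mult assms[symmetric] mult.assoc)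

lemma series_quotient:
  assumes "series p * poly_fps (1 # d) = poly_fps q"
  shows "series p = poly_fps q / poly_fps (1 # d)"
proof -
  have u: "fps_nth (poly_fps (1 # d)) 0 \<noteq> 0" by simp
  have "poly_fps q / poly_fps (1 # d) = series p * (poly_fps (1 # d) * inverse (poly_fps (1 # d)))"
    unfolding fps_divide_unit[OF u] assms[symmetric] by (simp only: mult.assoc)
  also have "\<dots> = series p" unfolding inverse_mult_eq_1'[OF u] by simp
  finally show ?thesis ..
qed

text \<open>Balls are finite unions of finite spheres, so the cardinalities of a ball and of the
  next sphere really add.\<close>

lemma cum_sum:
  assumes "coded_presentation p gs rl n" "group_ok n rl K T iv A B C cAB cs"
  shows "cum p 0 = sph p 0" "cum p (Suc m) = cum p m + sph p (Suc m)"
proof -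
  interpret coded_presentation p gs rl n by fact
  interpret tabled_presentation p gs rl n K T iv A B C cAB cs
    by unfold_locales fact
  let ?R = "reachable n T" and ?d = "dist_run n T"
  have s: "sph p m = real (card {v \<in> ?R. ?d v = m})" for m
    using growth_set[of "\<lambda>d. d = m"] by (simp add: spherical_growth_def)
  have c: "cum p m = real (card {v \<in> ?R. ?d v \<le> m})" for m
    using growth_set[of "\<lambda>d. d \<le> m"] by (simp add: cumulative_growth_def)
  have fin: "finite {v \<in> ?R. ?d v \<le> m}" for m
  proof -
    have "{v \<in> ?R. ?d v \<le> m} = (\<Union>i\<le>m. {v \<in> ?R. ?d v = i})" by auto
    then show ?thesis using finite_sphere[of ?R n T] by auto
  qed
  have "{v \<in> ?R. ?d v \<le> Suc m} = {v \<in> ?R. ?d v \<le> m} \<union> {v \<in> ?R. ?d v = Suc m}" for m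
    by auto
  then show "cum p (Suc m) = cum p m + sph p (Suc m)"
    unfolding s c using fin[of m] finite_sphere[of ?R n T "Suc m"] by (subst card_Un_disjoint[symmetric, THEN arg_cong[of _ _ real], simplified]) auto
  show "cum p 0 = sph p 0" unfolding s c by simp
qed

text \<open>Collects all that the closed forms use about a presentation. The fraction stays
  multiplied out; a denominator with constant term 1 is later divided by in
  \<open>series_quotient\<close>.\<close>

definition growth_fraction :: "'g presentation \<Rightarrow> int list \<Rightarrow> int list \<Rightarrow> bool" where
  "growth_fraction p q d \<longleftrightarrow> series p * poly_fps d = poly_fps q \<and>
     cum p 0 = sph p 0 \<and> (\<forall>n. cum p (Suc n) = cum p n + sph p (Suc n))"

theorem certified_growth:
  assumes "coded_presentation p gs rl n"
    and "group_ok n rl K T iv A B C cAB cs"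
    and "trees_ok n T K forms loops trees"
    and "series_ok Q types (concat (map (leaves loops) (concat trees))) N D"
  shows "growth_fraction p N D"
proof -
  interpret coded_presentation p gs rl n by fact
  interpret tabled_presentation p gs rl n K T iv A B C cAB cs
    by unfold_locales fact
  show ?thesis
    using growth_series_certified[OF assms(3,4)] cum_sum[OF assms(1,2)] by (simp add: growth_fraction_def)
qed

lemma growth_fractionD:
  assumes "growth_fraction p q d"
  shows "series p * poly_fps d = poly_fps q" "cum p 0 = sph p 0" "cum p (Suc n) = cum p n + sph p (Suc n)"
  using assms by (auto simp: growth_fraction_def)

text \<open>Tailored to the recurrence a(n+2m) = 2 a(n+m) - a(n) of a denominator (1 - z^m)^2: on
  each residue class a is an arithmetic progression, fixed by two values. Thus 2m initial values,
  beginning at k, suffice.\<close>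

lemma two_step_induct:
  fixes n m k :: nat
  assumes "0 < m" and base: "\<And>i. k \<le> i \<Longrightarrow> i < k + 2 * m \<Longrightarrow> P i"
    and step: "\<And>i. P (k + i) \<Longrightarrow> P (k + i + m) \<Longrightarrow> P (k + i + 2 * m)"
    and "k \<le> n"
  shows "P n"
  using assms(4)
proof (induction n rule: less_induct)
  case (less n)
  show ?case
  proof (cases "n < k + 2 * m")
    case False
    define i where "i = n - k - 2 * m"
    have n: "n = k + i + 2 * m" using False by (simp add: i_def)
    show ?thesis unfolding n using less.IH[of "k + i"] less.IH[of "k + i + m"] n \<open>0 < m\<close>
      by (intro step) auto
  qed (use base less.prems in blast)
qed

text \<open>The slope \<open>a + 2\<close> is the value of the numerator at z = 1. The choices a =
  4, 2, 1 give the slopes 6, 4, 3 of the first three families.\<close>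

lemma growth_linear:
  assumes G: "growth_fraction p [1, a, 1] [1, -2, 1]"
  shows "sph p 0 = 1" "n > 0 \<Longrightarrow> sph p n = (of_int a + 2) * real n"
    "cum p n = 1 + (of_int a + 2) / 2 * real n * (real n + 1)"
proof -
  note S = growth_fractionD(1)[OF G] and C = growth_fractionD(2,3)[OF G]
  note rec = sph_convolve[OF S]
  show 0: "sph p 0 = 1" using rec[of 0] by simp
  have 1: "sph p 1 = of_int a + 2" using rec[of 1] 0 by simp
  have 2: "sph p 2 = 2 * (of_int a + 2)" using rec[of 2] 0 1 by (simp add: eval_nat_numeral)
  have s: "sph p n = (of_int a + 2) * real n" if "n > 0" for n
  proof (rule two_step_induct[of 1 1 _ n])
    fix i assume "1 \<le> i" "i < 1 + 2 * (1::nat)"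
    then have "i = 1 \<or> i = 2" by auto
    then show "sph p i = (of_int a + 2) * real i" using 1 2 by auto
  next
    fix i assume "sph p (1 + i) = (of_int a + 2) * real (1 + i)"
      "sph p (1 + i + 1) = (of_int a + 2) * real (1 + i + 1)"
    then show "sph p (1 + i + 2 * 1) = (of_int a + 2) * real (1 + i + 2 * 1)"
      using rec[of "i + 3"] by (simp add: eval_nat_numeral algebra_simps)
  qed (use that in auto)
  then show "n > 0 \<Longrightarrow> sph p n = (of_int a + 2) * real n" .
  show "cum p n = 1 + (of_int a + 2) / 2 * real n * (real n + 1)"
  proof (induction n)
    case (Suc n)
    then show ?case using C s[of "Suc n"] by (simp add: field_simps)
  qed (use 0 C in simp)
qed

text \<open>The denominator is (1 - z^2)^2 and the numerator has degree 5, so the recurrence holds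
  from index 6 on; the values at 2, ..., 5 start the induction, and 0 and 1 are exceptional.\<close>

lemma growth_3636:
  assumes G: "growth_fraction p [1, 4, 6, 6, 3, -2] [1, 0, -2, 0, 1]"
  shows "sph p 0 = 1" "sph p 1 = 4"
    "n > 1 \<Longrightarrow> (even n \<longrightarrow> sph p n = 5 * real n - 2) \<and> (odd n \<longrightarrow> sph p n = 4 * real n + 2)"
    "cum p 0 = 1"
    "n > 1 \<Longrightarrow> (even n \<longrightarrow> cum p n = (9 * real n^2 + 10 * real n - 4) / 4) \<and>
               (odd n \<longrightarrow> cum p n = (9 * real n^2 + 8 * real n + 3) / 4)"
proof -
  note S = growth_fractionD(1)[OF G] and C = growth_fractionD(2,3)[OF G]
  note rec = sph_convolve[OF S]
  have v: "sph p 0 = 1" "sph p 1 = 4" "sph p 2 = 8" "sph p 3 = 14" "sph p 4 = 18" "sph p 5 = 22"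
    using rec[of 0] rec[of 1] rec[of 2] rec[of 3] rec[of 4] rec[of 5] by (simp_all add: eval_nat_numeral)
  show "sph p 0 = 1" "sph p 1 = 4" by fact+
  show c0: "cum p 0 = 1" using v C by simp
  let ?P = "\<lambda>n. (even n \<longrightarrow> sph p n = 5 * real n - 2) \<and> (odd n \<longrightarrow> sph p n = 4 * real n + 2)"
  have s: "?P n" if "n > 1" for n
  proof (rule two_step_induct[of 2 2 _ n])
    fix i assume "2 \<le> i" "i < 2 + 2 * (2::nat)"
    then have "i \<in> {2, 3, 4, 5}" by auto
    then show "?P i" using v by auto
  next
    fix i assume P: "?P (2 + i)" "?P (2 + i + 2)"
    have "sph p (2 + i + 2 * 2) = 2 * sph p (2 + i + 2) - sph p (2 + i)"
      using rec[of "i + 6"] by (simp add: eval_nat_numeral)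
    then show "?P (2 + i + 2 * 2)" using P by (cases "even i") simp_all
  qed (use that in auto)
  show "?P n" if "n > 1" by (rule s) (fact that)
  let ?Q = "\<lambda>n. (even n \<longrightarrow> cum p n = (9 * real n^2 + 10 * real n - 4) / 4) \<and>
               (odd n \<longrightarrow> cum p n = (9 * real n^2 + 8 * real n + 3) / 4)"
  have "?Q (i + 2)" for i
  proof (induction i)
    case 0
    show ?case using C v c0 by (simp add: eval_nat_numeral)
  next
    case (Suc i)
    then show ?case using C s[of "Suc i + 2"]
      by (cases "even i") (simp_all add: field_simps power2_eq_square)
  qed
  note q = this
  show "?Q n" if n: "n > 1"
  proof -
    have e: "n - 2 + 2 = n" using n by simp
    show ?thesis using q[of "n - 2"] unfolding e by (rule asm_rl)
  qed
qed

lemma growth_488: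
  assumes G: "growth_fraction p [1, 2, 2, 2, 1] [1, -1, 0, -1, 1]"
  shows "sph p 0 = 1"
    "n > 0 \<Longrightarrow> (n mod 3 = 0 \<longrightarrow> sph p n = 8 * real n / 3) \<and>
               (n mod 3 = 1 \<longrightarrow> sph p n = (8 * real n + 1) / 3) \<and>
               (n mod 3 = 2 \<longrightarrow> sph p n = (8 * real n - 1) / 3)"
    "n > 0 \<Longrightarrow> (n mod 3 = 0 \<longrightarrow> cum p n = (3 + 4 * real n * (real n + 1)) / 3) \<and>
               (n mod 3 = 1 \<longrightarrow> cum p n = (4 + 4 * real n * (real n + 1)) / 3) \<and>
               (n mod 3 = 2 \<longrightarrow> cum p n = (3 + 4 * real n * (real n + 1)) / 3)"
proof -
  note S = growth_fractionD(1)[OF G] and C = growth_fractionD(2,3)[OF G]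
  \<comment> \<open>The denominator (1 - z)^2 (1 + z + z^2), multiplied by 1 + z + z^2, becomes (1 -
    z^3)^2.\<close>
  have "mult_poly [1, -1, 0, -1, 1] [1, 1, 1] = [1, 0, 0, -2, 0, 0, 1]"
    "mult_poly [1, 2, 2, 2, 1] [1, 1, 1] = [1, 3, 5, 6, 5, 3, 1]" by code_simp+
  note rec = sph_convolve_mult[OF S, of "[1, 1, 1]", unfolded this]
  have v: "sph p 0 = 1" "sph p 1 = 3" "sph p 2 = 5" "sph p 3 = 8" "sph p 4 = 11" "sph p 5 = 13" "sph p 6 = 16"
    using rec[of 0] rec[of 1] rec[of 2] rec[of 3] rec[of 4] rec[of 5] rec[of 6]
    by (simp_all add: eval_nat_numeral)
  show "sph p 0 = 1" by fact
  let ?P = "\<lambda>n. (n mod 3 = 0 \<longrightarrow> sph p n = 8 * real n / 3) \<and>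
               (n mod 3 = 1 \<longrightarrow> sph p n = (8 * real n + 1) / 3) \<and>
               (n mod 3 = 2 \<longrightarrow> sph p n = (8 * real n - 1) / 3)"
  have s: "?P n" if "n > 0" for n
  proof (rule two_step_induct[of 3 1 _ n])
    fix i assume "1 \<le> i" "i < 1 + 2 * (3::nat)"
    then have "i \<in> {1, 2, 3, 4, 5, 6}" by auto
    then show "?P i" using v by auto
  next
    fix i assume P: "?P (1 + i)" "?P (1 + i + 3)"
    have e: "sph p (1 + i + 2 * 3) = 2 * sph p (1 + i + 3) - sph p (1 + i)"
      using rec[of "i + 7"] by (simp add: eval_nat_numeral)
    have mods: "(1 + i + 2 * 3) mod 3 = (1 + i) mod 3" "(1 + i + 3) mod 3 = (1 + i) mod 3"
      by presburger+
    have "(1 + i) mod 3 = 0 \<or> (1 + i) mod 3 = 1 \<or> (1 + i) mod 3 = 2" by presburger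
    then show "?P (1 + i + 2 * 3)" using P unfolding e mods by (elim disjE) simp_all
  qed (use that in auto)
  show "?P n" if "n > 0" by (rule s) (fact that)
  let ?Q = "\<lambda>n. (n mod 3 = 0 \<longrightarrow> cum p n = (3 + 4 * real n * (real n + 1)) / 3) \<and>
               (n mod 3 = 1 \<longrightarrow> cum p n = (4 + 4 * real n * (real n + 1)) / 3) \<and>
               (n mod 3 = 2 \<longrightarrow> cum p n = (3 + 4 * real n * (real n + 1)) / 3)"
  have step: "?Q (Suc k)" if "?Q k" "?P (Suc k)" for k
  proof -
    have c: "cum p (Suc k) = cum p k + sph p (Suc k)" using C(2) .
    have "k mod 3 = 0 \<or> k mod 3 = 1 \<or> k mod 3 = 2" by presburger
    then show ?thesis using that c by (elim disjE) (simp_all add: mod_Suc field_simps power2_eq_square)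
  qed
  have "?Q (i + 1)" for i
  proof (induction i)
    case 0
    show ?case using C v by simp
  next
    case (Suc i)
    have "?Q (Suc (i + 1))" by (rule step[OF Suc.IH s]) simp
    then show ?case by (simp only: add_Suc)
  qed
  note q = this
  show "?Q n" if n: "n > 0"
  proof -
    have e: "n - 1 + 1 = n" using n by simp
    show ?thesis using q[of "n - 1"] unfolding e by (rule asm_rl)
  qed
qed

lemma growth_31212:
  assumes G: "growth_fraction p [1, 1, 1, 3, -1, 5, -3, 4, -2] [1, -2, 3, -4, 3, -2, 1]"
  shows "sph p 0 = 1" "sph p 1 = 3" "sph p 2 = 4" "cum p 0 = 1" "cum p 1 = 4"
    "n > 2 \<Longrightarrow> (n mod 4 = 0 \<longrightarrow> sph p n = (5 * real n - 4) / 2) \<and>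
               (n mod 4 = 1 \<longrightarrow> sph p n = (9 * real n + 3) / 4) \<and>
               (n mod 4 = 2 \<longrightarrow> sph p n = 2 * real n + 2) \<and>
               (n mod 4 = 3 \<longrightarrow> sph p n = (9 * real n - 3) / 4)"
    "n > 2 \<Longrightarrow> (n mod 4 = 0 \<longrightarrow> cum p n = (9 * real n^2 + 10 * real n - 8) / 8) \<and>
               (n mod 4 = 1 \<longrightarrow> cum p n = (9 * real n^2 + 10 * real n - 3) / 8) \<and>
               (n mod 4 = 2 \<longrightarrow> cum p n = (9 * real n^2 + 8 * real n + 12) / 8) \<and>
               (n mod 4 = 3 \<longrightarrow> cum p n = (9 * real n^2 + 8 * real n + 7) / 8)"
proof -
  note S = growth_fractionD(1)[OF G] and C = growth_fractionD(2,3)[OF G]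
  \<comment> \<open>The factor (1 + z)^2 turns (1 - z)^2 (1 + z^2)^2 into (1 - z^4)^2. The numerator
    then has degree 10, so the induction starts with the eight values at 3, ..., 10.\<close>
  have "mult_poly [1, -2, 3, -4, 3, -2, 1] [1, 2, 1] = [1, 0, 0, 0, -2, 0, 0, 0, 1]"
    "mult_poly [1, 1, 1, 3, -1, 5, -3, 4, -2] [1, 2, 1] = [1, 3, 4, 6, 6, 6, 6, 3, 3, 0, -2]" by code_simp+
  note rec = sph_convolve_mult[OF S, of "[1, 2, 1]", unfolded this]
  have v: "sph p 0 = 1" "sph p 1 = 3" "sph p 2 = 4" "sph p 3 = 6" "sph p 4 = 8" "sph p 5 = 12" "sph p 6 = 14" "sph p 7 = 15" "sph p 8 = 18" "sph p 9 = 21" "sph p 10 = 22"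
    using rec[of 0] rec[of 1] rec[of 2] rec[of 3] rec[of 4] rec[of 5] rec[of 6] rec[of 7] rec[of 8] rec[of 9] rec[of 10]
    by (simp_all add: eval_nat_numeral)
  show "sph p 0 = 1" "sph p 1 = 3" "sph p 2 = 4" by fact+
  show c0: "cum p 0 = 1" using v C(1) by simp
  show c1: "cum p 1 = 4" using v C(2)[of 0] c0 by simp
  let ?P = "\<lambda>n. (n mod 4 = 0 \<longrightarrow> sph p n = (5 * real n - 4) / 2) \<and>
               (n mod 4 = 1 \<longrightarrow> sph p n = (9 * real n + 3) / 4) \<and>
               (n mod 4 = 2 \<longrightarrow> sph p n = 2 * real n + 2) \<and>
               (n mod 4 = 3 \<longrightarrow> sph p n = (9 * real n - 3) / 4)"
  have s: "?P n" if "n > 2" for n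
  proof (rule two_step_induct[of 4 3 _ n])
    fix i assume "3 \<le> i" "i < 3 + 2 * (4::nat)"
    then have "i \<in> {3, 4, 5, 6, 7, 8, 9, 10}" by (auto simp: eval_nat_numeral less_Suc_eq)
    then show "?P i" using v by auto
  next
    fix i assume P: "?P (3 + i)" "?P (3 + i + 4)"
    have e: "sph p (3 + i + 2 * 4) = 2 * sph p (3 + i + 4) - sph p (3 + i)"
      using rec[of "i + 11"] by (simp add: eval_nat_numeral)
    have mods: "(3 + i + 2 * 4) mod 4 = (3 + i) mod 4" "(3 + i + 4) mod 4 = (3 + i) mod 4"
      by presburger+
    have "(3 + i) mod 4 = 0 \<or> (3 + i) mod 4 = 1 \<or> (3 + i) mod 4 = 2 \<or> (3 + i) mod 4 = 3" by presburger
    then show "?P (3 + i + 2 * 4)" using P unfolding e mods by (elim disjE) simp_all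
  qed (use that in auto)
  show "?P n" if "n > 2" by (rule s) (fact that)
  let ?Q = "\<lambda>n. (n mod 4 = 0 \<longrightarrow> cum p n = (9 * real n^2 + 10 * real n - 8) / 8) \<and>
               (n mod 4 = 1 \<longrightarrow> cum p n = (9 * real n^2 + 10 * real n - 3) / 8) \<and>
               (n mod 4 = 2 \<longrightarrow> cum p n = (9 * real n^2 + 8 * real n + 12) / 8) \<and>
               (n mod 4 = 3 \<longrightarrow> cum p n = (9 * real n^2 + 8 * real n + 7) / 8)"
  have step: "?Q (Suc k)" if "?Q k" "?P (Suc k)" for k
  proof -
    have c: "cum p (Suc k) = cum p k + sph p (Suc k)" using C(2) .
    have "k mod 4 = 0 \<or> k mod 4 = 1 \<or> k mod 4 = 2 \<or> k mod 4 = 3" by presburger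
    then show ?thesis using that c by (elim disjE) (simp_all add: mod_Suc field_simps power2_eq_square)
  qed
  have "?Q (i + 3)" for i
  proof (induction i)
    case 0
    have "cum p 2 = 8" using C(2)[of 1] c1 v(3) by (simp add: numeral_2_eq_2)
    then have "cum p 3 = 14" using C(2)[of 2] v(4) by (simp add: eval_nat_numeral)
    then show ?case by simp
  next
    case (Suc i)
    have "?Q (Suc (i + 3))" by (rule step[OF Suc.IH s]) simp
    then show ?case by (simp only: add_Suc)
  qed
  note q = this
  show "?Q n" if n: "n > 2"
  proof -
    have e: "n - 3 + 3 = n" using n by simp
    show ?thesis using q[of "n - 3"] unfolding e by (rule asm_rl)
  qed
qed

lemma growth_4612:
  assumes G: "growth_fraction p [1, 2, 2, 2, 2, 2, 1] [1, -1, 0, 0, 0, -1, 1]"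
  shows "sph p 0 = 1"
    "n > 0 \<Longrightarrow> (n mod 5 = 0 \<longrightarrow> sph p n = 12 * real n / 5) \<and>
               (n mod 5 = 1 \<longrightarrow> sph p n = (12 * real n + 3) / 5) \<and>
               (n mod 5 = 2 \<longrightarrow> sph p n = (12 * real n + 1) / 5) \<and>
               (n mod 5 = 3 \<longrightarrow> sph p n = (12 * real n - 1) / 5) \<and>
               (n mod 5 = 4 \<longrightarrow> sph p n = (12 * real n - 3) / 5)"
    "n > 0 \<Longrightarrow> (n mod 5 = 0 \<longrightarrow> cum p n = (5 + 6 * real n * (real n + 1)) / 5) \<and>
               (n mod 5 = 1 \<longrightarrow> cum p n = (8 + 6 * real n * (real n + 1)) / 5) \<and>
               (n mod 5 = 2 \<longrightarrow> cum p n = (9 + 6 * real n * (real n + 1)) / 5) \<and>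
               (n mod 5 = 3 \<longrightarrow> cum p n = (8 + 6 * real n * (real n + 1)) / 5) \<and>
               (n mod 5 = 4 \<longrightarrow> cum p n = (5 + 6 * real n * (real n + 1)) / 5)"
proof -
  note S = growth_fractionD(1)[OF G] and C = growth_fractionD(2,3)[OF G]
  \<comment> \<open>The factor 1 + z + z^2 + z^3 + z^4 turns (1 - z^5) (1 - z) into (1 -
    z^5)^2.\<close>
  have "mult_poly [1, -1, 0, 0, 0, -1, 1] [1, 1, 1, 1, 1] = [1, 0, 0, 0, 0, -2, 0, 0, 0, 0, 1]"
    "mult_poly [1, 2, 2, 2, 2, 2, 1] [1, 1, 1, 1, 1] = [1, 3, 5, 7, 9, 10, 9, 7, 5, 3, 1]" by code_simp+
  note rec = sph_convolve_mult[OF S, of "[1, 1, 1, 1, 1]", unfolded this]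
  have v: "sph p 0 = 1" "sph p 1 = 3" "sph p 2 = 5" "sph p 3 = 7" "sph p 4 = 9" "sph p 5 = 12" "sph p 6 = 15" "sph p 7 = 17" "sph p 8 = 19" "sph p 9 = 21" "sph p 10 = 24"
    using rec[of 0] rec[of 1] rec[of 2] rec[of 3] rec[of 4] rec[of 5] rec[of 6] rec[of 7] rec[of 8] rec[of 9] rec[of 10]
    by (simp_all add: eval_nat_numeral)
  show "sph p 0 = 1" by fact
  let ?P = "\<lambda>n. (n mod 5 = 0 \<longrightarrow> sph p n = 12 * real n / 5) \<and>
               (n mod 5 = 1 \<longrightarrow> sph p n = (12 * real n + 3) / 5) \<and>
               (n mod 5 = 2 \<longrightarrow> sph p n = (12 * real n + 1) / 5) \<and>
               (n mod 5 = 3 \<longrightarrow> sph p n = (12 * real n - 1) / 5) \<and>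
               (n mod 5 = 4 \<longrightarrow> sph p n = (12 * real n - 3) / 5)"
  have s: "?P n" if "n > 0" for n
  proof (rule two_step_induct[of 5 1 _ n])
    fix i assume "1 \<le> i" "i < 1 + 2 * (5::nat)"
    then have "i \<in> {1, 2, 3, 4, 5, 6, 7, 8, 9, 10}" by (auto simp: eval_nat_numeral less_Suc_eq)
    then show "?P i" using v by auto
  next
    fix i assume P: "?P (1 + i)" "?P (1 + i + 5)"
    have e: "sph p (1 + i + 2 * 5) = 2 * sph p (1 + i + 5) - sph p (1 + i)"
      using rec[of "i + 11"] by (simp add: eval_nat_numeral)
    have mods: "(1 + i + 2 * 5) mod 5 = (1 + i) mod 5" "(1 + i + 5) mod 5 = (1 + i) mod 5"
      by presburger+
    have "(1 + i) mod 5 = 0 \<or> (1 + i) mod 5 = 1 \<or> (1 + i) mod 5 = 2 \<or> (1 + i) mod 5 = 3 \<or> (1 + i) mod 5 = 4" by presburger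
    then show "?P (1 + i + 2 * 5)" using P unfolding e mods by (elim disjE) simp_all
  qed (use that in auto)
  show "?P n" if "n > 0" by (rule s) (fact that)
  let ?Q = "\<lambda>n. (n mod 5 = 0 \<longrightarrow> cum p n = (5 + 6 * real n * (real n + 1)) / 5) \<and>
               (n mod 5 = 1 \<longrightarrow> cum p n = (8 + 6 * real n * (real n + 1)) / 5) \<and>
               (n mod 5 = 2 \<longrightarrow> cum p n = (9 + 6 * real n * (real n + 1)) / 5) \<and>
               (n mod 5 = 3 \<longrightarrow> cum p n = (8 + 6 * real n * (real n + 1)) / 5) \<and>
               (n mod 5 = 4 \<longrightarrow> cum p n = (5 + 6 * real n * (real n + 1)) / 5)"
  have step: "?Q (Suc k)" if "?Q k" "?P (Suc k)" for k
  proof -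
    have c: "cum p (Suc k) = cum p k + sph p (Suc k)" using C(2) .
    have "k mod 5 = 0 \<or> k mod 5 = 1 \<or> k mod 5 = 2 \<or> k mod 5 = 3 \<or> k mod 5 = 4" by presburger
    then show ?thesis using that c by (elim disjE) (simp_all add: mod_Suc field_simps power2_eq_square)
  qed
  have "?Q (i + 1)" for i
  proof (induction i)
    case 0
    show ?case using C(1) C(2)[of 0] v(1,2) by simp
  next
    case (Suc i)
    have "?Q (Suc (i + 1))" by (rule step[OF Suc.IH s]) simp
    then show ?case by (simp only: add_Suc)
  qed
  note q = this
  show "?Q n" if n: "n > 0"
  proof -
    have e: "n - 1 + 1 = n" using n by simp
    show ?thesis using q[of "n - 1"] unfolding e by (rule asm_rl)
  qed
qed

section \<open>The twenty presentations\<close>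

definition p1_36_table :: table where
  "p1_36_table =
     [(1, [((0, 1), 0)]), (-1, [((0, -1), 0)]), (2, [((-1, -1), 0)]), (-2, [((1, 1), 0)]), (3,
     [((1, 0), 0)]), (-3, [((-1, 0), 0)])]"

definition p1_36_loops :: "code list" where
  "p1_36_loops =
     [[3], [-2], [1], [-3], [2], [-1]]"

definition p1_36_trees :: "tree list list" where
  "p1_36_trees =
     [[Star (Leaf [([], 0), ([], 1)] []) (Leaf [([], 1), ([], 2)] [1]), Leaf [([], 2), ([], 3)]
     [-3], Star (Leaf [([], 3), ([], 4)] [2]) (Leaf [([], 4), ([], 5)] [-1,2]), Leaf [([], 5),
     ([], 0)] [-1]]]"

lemma growth_p1_36: "growth_fraction p1_36 [1,4,1] [1,-2,1]"
proof (rule certified_growth)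
  show "coded_presentation p1_36 [gX, gY, gZ]
     [([1,2,3], []), ([3,2,1], [])] 3"
    unfolding p1_36_def by (rule coded_presentation.intro) (simp_all add: letter_of_def wpow_def eval_nat_numeral)
  \<comment> \<open>A = Z and B = X; then Y = A^-1 B^-1.\<close>
  show "group_ok 3
     [([1,2,3], []), ([3,2,1], [])]
     1 p1_36_table [] [3] [1]
     [[]]
     [([3], 1), ([-2,-3], -2)]
     [((0, 2), [([2,1], 2)])]"
    by code_simp
  \<comment> \<open>The six forms express the hexagonal norm max(|i|, |j|, |i - j|).\<close>
  show "trees_ok 3 p1_36_table 1
     [(1, 0, [0]), (0, 1, [0]), (0, -1, [0]), (-1, 0, [0]), (1, -1, [0]), (-1, 1, [0])]
     p1_36_loops p1_36_trees"
    by code_simp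
  show "series_ok
     [1,-2,1]
     [([1,1], [1])]
     (concat (map (leaves p1_36_loops) (concat p1_36_trees)))
     [1,4,1] [1,-2,1]"
    by code_simp
qed

definition p3_36_table :: table where
  "p3_36_table =
     [(1, [((0, 0), 1), ((0, 0), 2), ((0, 0), 0)]), (-1, [((0, 0), 2), ((0, 0), 0), ((0, 0),
     1)]), (2, [((-1, 0), 1), ((0, -1), 2), ((1, 1), 0)]), (-2, [((-1, -1), 2), ((1, 0), 0), ((0,
     1), 1)]), (3, [((-1, -1), 1), ((1, 0), 2), ((0, 1), 0)]), (-3, [((0, -1), 2), ((1, 1), 0),
     ((-1, 0), 1)])]"

definition p3_36_loops :: "code list" where
  "p3_36_loops =
     [[1,-2], [1,3,2], [1,-3], [-1,3], [-1,-2,-3], [2,-1], [2,1,3], [-2,1], [-2,-3,-1], [3,2,1],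
     [3,-2], [-3,-1,-2]]"

definition p3_36_trees :: "tree list list" where
  "p3_36_trees =
     [[Star (Star (Leaf [([], 0), ([], 1)] []) (Leaf [([], 1), ([], 2)] [1,-3])) (Peel (Leaf
     [([], 3)] [-1,3]) (Star (Leaf [([], 2), ([], 4)] [-1,-2,-3]) (Leaf [([], 4), ([], 3)]
     [-1,-2,1,-2,-3]))), Peel (Leaf [([], 5)] [2,-1]) (Star (Leaf [([], 3), ([], 6)] [2,1,3])
     (Leaf [([], 6), ([], 5)] [2,1,3,2,-1])), Star (Peel (Leaf [([], 7)] [-2,1]) (Star (Leaf
     [([], 5), ([], 8)] [-2,-3,-1]) (Leaf [([], 8), ([], 7)] [-2,1,-2,-3,-1]))) (Star (Leaf [([],
     7), ([], 9)] [3,2,1]) (Leaf [([], 9), ([], 10)] [3,2,1,3,-2])), Star (Leaf [([], 10), ([],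
     11)] [3,-2]) (Leaf [([], 11), ([], 0)] [-3,-1,-2])], [Star (Star (Leaf [([], 0), ([], 1)]
     [1]) (Leaf [([], 1), ([], 2)] [1,3,-2])) (Star (Leaf [([], 2), ([], 4)] [-1,-2]) (Leaf [([],
     4), ([], 3)] [-1,-2,1,-2])), Star (Leaf [([], 3), ([], 6)] [2]) (Leaf [([], 6), ([], 5)]
     [2,1,-3]), Peel (Leaf [([], 10)] [3]) (Star (Star (Leaf [([], 5), ([], 8)] [-2,-3]) (Leaf
     [([], 8), ([], 7)] [-2,1,-2,-3])) (Star (Leaf [([], 7), ([], 9)] [-2,1,3]) (Leaf [([], 9),
     ([], 10)] [3,2,1,3]))), Star (Leaf [([], 10), ([], 11)] [-3,-1]) (Leaf [([], 11), ([], 0)]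
     [1,-2,-3,-1])], [Peel (Leaf [([], 3)] [-1]) (Star (Star (Leaf [([], 0), ([], 1)] [1,3])
     (Leaf [([], 1), ([], 2)] [1,3,2,-1])) (Star (Leaf [([], 2), ([], 4)] [1,-3,-1]) (Leaf [([],
     4), ([], 3)] [-1,-2,-3,-1]))), Star (Leaf [([], 3), ([], 6)] [2,1]) (Leaf [([], 6), ([], 5)]
     [2,1,3,-2]), Star (Star (Leaf [([], 5), ([], 8)] [-2]) (Leaf [([], 8), ([], 7)] [-2,1,-2]))
     (Star (Leaf [([], 7), ([], 9)] [3,2]) (Leaf [([], 9), ([], 10)] [3,2,1,-3])), Star (Leaf
     [([], 10), ([], 11)] [-3]) (Leaf [([], 11), ([], 0)] [1,-2,-3])]]"

lemma growth_p3_36: "growth_fraction p3_36 [1,4,1] [1,-2,1]"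
proof (rule certified_growth)
  show "coded_presentation p3_36 [gS1, gS2, gS3]
     [([1,1,1], []), ([2,2,2], []), ([3,3,3], []), ([1,2,3], [])] 3"
    unfolding p3_36_def by (rule coded_presentation.intro) (simp_all add: letter_of_def wpow_def eval_nat_numeral)
  \<comment> \<open>The generators rotate by the same angle, so A = S1 S2^-1 and B = S1^-1 S3 are
    translations; powers of S1 represent the cosets.\<close>
  show "group_ok 3
     [([1,1,1], []), ([2,2,2], []), ([3,3,3], []), ([1,2,3], [])]
     3 p3_36_table [] [1,-2] [-1,3]
     [[], [1], [-1]]
     [([1,-2,-1,3,2,-1], -4), ([1,-2,-1,3], 2), ([1,3], -4), ([1], 3), ([1], -4), ([], 1)]
     [((0, 3), [([3], -1), ([3], 4), ([-2,3], 4), ([], -2)]), ((1, 1), [([], 1)]), ((1, 2), [([],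
     4)]), ((1, 3), [([1,3], 4)]), ((2, 2), [([-1,2,-3], 4), ([-1,2], -3), ([-1,-1], 4), ([],
     -1)])]"
    by code_simp
  show "trees_ok 3 p3_36_table 3
     [(1, 1, [0,1,1]), (-1, -1, [0,-1,-1]), (2, -1, [0,1,0]), (1, -2, [0,0,-1]), (-1, 2,
     [0,0,1]), (-2, 1, [0,-1,0])]
     p3_36_loops p3_36_trees"
    by code_simp
  \<comment> \<open>Translations of lengths 2 and 3 span the cones, whence Q = (1 - z^2) (1 - z^3);
    the factor (1 + z) (1 + z + z^2) cancels from the sum.\<close>
  show "series_ok
     [1,0,-1,-1,0,1]
     [([2], [1,0,0,-1]), ([2,3], [1]), ([3,2], [1])]
     (concat (map (leaves p3_36_loops) (concat p3_36_trees)))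
     [1,4,1] [1,-2,1]"
    by code_simp
qed

section \<open>The square tiling 4^4\<close>

definition p1_44_table :: table where
  "p1_44_table =
     [(1, [((-1, 0), 0)]), (-1, [((1, 0), 0)]), (2, [((0, -1), 0)]), (-2, [((0, 1), 0)])]"

definition p1_44_loops :: "code list" where
  "p1_44_loops =
     [[-1], [-2], [1], [2]]"

definition p1_44_trees :: "tree list list" where
  "p1_44_trees =
     [[Leaf [([], 0), ([], 1)] [], Leaf [([], 1), ([], 2)] [1], Leaf [([], 2), ([], 3)] [1,2],
     Leaf [([], 3), ([], 0)] [2]]]"

lemma growth_p1_44: "growth_fraction p1_44 [1,2,1] [1,-2,1]"
proof (rule certified_growth)
  show "coded_presentation p1_44 [gX, gY]
     [([1,2], [2,1])] 2"
    unfolding p1_44_def by (rule coded_presentation.intro) (simp_all add: letter_of_def wpow_def eval_nat_numeral)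
  \<comment> \<open>A = X^-1 and B = Y^-1.\<close>
  show "group_ok 2
     [([1,2], [2,1])]
     1 p1_44_table [] [-1] [-2]
     [[]]
     [([-1,-2], 1)]
     []"
    by code_simp
  \<comment> \<open>The four choices of signs in the norm |i| + |j|.\<close>
  show "trees_ok 2 p1_44_table 1
     [(1, 1, [0]), (1, -1, [0]), (-1, 1, [0]), (-1, -1, [0])]
     p1_44_loops p1_44_trees"
    by code_simp
  show "series_ok
     [1,-2,1]
     [([1,1], [1])]
     (concat (map (leaves p1_44_loops) (concat p1_44_trees)))
     [1,2,1] [1,-2,1]"
    by code_simp
qed

definition p2_44_table :: table where
  "p2_44_table =
     [(1, [((0, 0), 1), ((0, 0), 0)]), (-1, [((0, 0), 1), ((0, 0), 0)]), (2, [((-1, 0), 1), ((1,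
     0), 0)]), (-2, [((-1, 0), 1), ((1, 0), 0)]), (3, [((-1, -1), 1), ((1, 1), 0)]), (-3, [((-1,
     -1), 1), ((1, 1), 0)]), (4, [((0, -1), 1), ((0, 1), 0)]), (-4, [((0, -1), 1), ((0, 1), 0)])]"

definition p2_44_loops :: "code list" where
  "p2_44_loops =
     [[1,2], [1,3], [1,4], [2,1], [2,4], [3,1], [3,2], [4,2]]"

definition p2_44_trees :: "tree list list" where
  "p2_44_trees =
     [[Star (Leaf [([], 0), ([], 1)] []) (Leaf [([], 1), ([], 2)] [1,4]), Peel (Leaf [([], 3)]
     [2,1]) (Star (Leaf [([], 2), ([], 4)] [2,4]) (Leaf [([], 4), ([], 3)] [2,1,2,4])), Star
     (Leaf [([], 3), ([], 5)] [3,1]) (Leaf [([], 5), ([], 6)] [3,1,3,2]), Star (Leaf [([], 6),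
     ([], 7)] [3,2]) (Leaf [([], 7), ([], 0)] [4,2])], [Star (Leaf [([], 0), ([], 1)] [1]) (Leaf
     [([], 1), ([], 2)] [1,3,2]), Star (Leaf [([], 2), ([], 4)] [2]) (Leaf [([], 4), ([], 3)]
     [2,1,2]), Star (Leaf [([], 3), ([], 5)] [3]) (Leaf [([], 5), ([], 6)] [3,1,4]), Star (Leaf
     [([], 6), ([], 7)] [4]) (Leaf [([], 7), ([], 0)] [1,2,4])]]"

lemma growth_p2_44: "growth_fraction p2_44 [1,2,1] [1,-2,1]"
proof (rule certified_growth)
  show "coded_presentation p2_44 [gT1, gT2, gT3, gT4]
     [([1,1], []), ([2,2], []), ([3,3], []), ([4,4], []), ([1,2,3,4], [])] 4"
    unfolding p2_44_def by (rule coded_presentation.intro) (simp_all add: letter_of_def wpow_def eval_nat_numeral)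
  \<comment> \<open>A product of two half-turns is a translation: A = T1 T2 and B = T1 T4.\<close>
  show "group_ok 4
     [([1,1], []), ([2,2], []), ([3,3], []), ([4,4], []), ([1,2,3,4], [])]
     2 p2_44_table [1,2,3,4] [1,2] [1,4]
     [[], [1]]
     [([1,2,1], -5), ([1,3,2,1], -5)]
     [((0, 3), [([3,4], 5)]), ((1, 3), [([1,3,4], 5)])]"
    by code_simp
  \<comment> \<open>The gradients belong to the norm 2 max(|i|, |j|), which bends along the
    diagonals; this is why each quadrant is cut there.\<close>
  show "trees_ok 4 p2_44_table 2
     [(2, 0, [0,1]), (0, 2, [0,1]), (0, -2, [0,-1]), (-2, 0, [0,-1])]
     p2_44_loops p2_44_trees"
    by code_simp
  show "series_ok
     [1,0,-2,0,1]
     [([2], [1,0,-1]), ([2,2], [1])]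
     (concat (map (leaves p2_44_loops) (concat p2_44_trees)))
     [1,2,1] [1,-2,1]"
    by code_simp
qed

definition pm_44_table :: table where
  "pm_44_table =
     [(1, [((1, 0), 0), ((1, 0), 1)]), (-1, [((-1, 0), 0), ((-1, 0), 1)]), (2, [((0, 0), 1), ((0,
     0), 0)]), (-2, [((0, 0), 1), ((0, 0), 0)]), (3, [((0, -1), 1), ((0, 1), 0)]), (-3, [((0,
     -1), 1), ((0, 1), 0)])]"

definition pm_44_loops :: "code list" where
  "pm_44_loops =
     [[1], [2,3], [-1], [3,2]]"

definition pm_44_trees :: "tree list list" where
  "pm_44_trees =
     [[Leaf [([], 0), ([], 1)] [], Leaf [([], 1), ([], 2)] [-1], Leaf [([], 2), ([], 3)]
     [-1,3,2], Leaf [([], 3), ([], 0)] [3,2]], [Leaf [([], 0), ([], 1)] [2], Leaf [([], 1), ([],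
     2)] [-1,2], Leaf [([], 2), ([], 3)] [-1,3], Leaf [([], 3), ([], 0)] [3]]]"

lemma growth_pm_44: "growth_fraction pm_44 [1,2,1] [1,-2,1]"
proof (rule certified_growth)
  show "coded_presentation pm_44 [gY, gR, gR']
     [([2,2], []), ([3,3], []), ([2,1], [1,2]), ([3,1], [1,3])] 3"
    unfolding pm_44_def by (rule coded_presentation.intro) (simp_all add: letter_of_def wpow_def eval_nat_numeral)
  \<comment> \<open>A = Y translates along the two parallel mirrors, B = R R' across them.\<close>
  show "group_ok 3
     [([2,2], []), ([3,3], []), ([2,1], [1,2]), ([3,1], [1,3])]
     2 pm_44_table [2,3] [1] [2,3]
     [[], [2]]
     [([1,2,3,-1], 4), ([1,2,-1], 3)]
     [((1, 1), [([], 3)])]"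
    by code_simp
  show "trees_ok 3 pm_44_table 2
     [(1, 2, [0,1]), (1, -2, [0,-1]), (-1, 2, [0,1]), (-1, -2, [0,-1])]
     pm_44_loops pm_44_trees"
    by code_simp
  show "series_ok
     [1,-1,-1,1]
     [([1,2], [1]), ([2,1], [1])]
     (concat (map (leaves pm_44_loops) (concat pm_44_trees)))
     [1,2,1] [1,-2,1]"
    by code_simp
qed

definition pg_44_table :: table where
  "pg_44_table =
     [(1, [((0, 0), 1), ((1, 0), 0)]), (-1, [((-1, 0), 1), ((0, 0), 0)]), (2, [((0, -1), 1), ((1,
     1), 0)]), (-2, [((-1, -1), 1), ((0, 1), 0)])]"

definition pg_44_loops :: "code list" where
  "pg_44_loops =
     [[1,1], [1,2], [1,-2], [-1,-1], [-1,-2], [-2,-1], [2,-1], [2,1]]"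

definition pg_44_trees :: "tree list list" where
  "pg_44_trees =
     [[Star (Leaf [([], 0), ([], 1)] []) (Leaf [([], 1), ([], 2)] [1,-2]), Peel (Leaf [([], 3)]
     [-1,-1]) (Star (Leaf [([], 2), ([], 4)] [-1,-2]) (Leaf [([], 4), ([], 3)] [-1,-1,-1,-2])),
     Star (Leaf [([], 3), ([], 5)] [-2,-1]) (Leaf [([], 5), ([], 6)] [2,-1,-2,-1]), Star (Leaf
     [([], 6), ([], 7)] [2,-1]) (Leaf [([], 7), ([], 0)] [2,1])], [Star (Leaf [([], 0), ([], 1)]
     [1]) (Leaf [([], 1), ([], 2)] [1,2,-1]), Star (Leaf [([], 2), ([], 4)] [-1]) (Leaf [([], 4),
     ([], 3)] [-1,-1,-1]), Star (Leaf [([], 3), ([], 5)] [-2]) (Leaf [([], 5), ([], 6)]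
     [2,-1,-2]), Star (Leaf [([], 6), ([], 7)] [2]) (Leaf [([], 7), ([], 0)] [1,1,2])]]"

lemma growth_pg_44: "growth_fraction pg_44 [1,2,1] [1,-2,1]"
proof (rule certified_growth)
  show "coded_presentation pg_44 [gP, gQ]
     [([1,1], [2,2])] 2"
    unfolding pg_44_def by (rule coded_presentation.intro) (simp_all add: letter_of_def wpow_def eval_nat_numeral)
  \<comment> \<open>P and Q are glide reflections with parallel axes: A = P^2 translates along them,
    B = P Q^-1 across them.\<close>
  show "group_ok 2
     [([1,1], [2,2])]
     2 pg_44_table [] [1,1] [1,-2]
     [[], [1]]
     [([1], 1), ([1,2,-1,-1], -1)]
     [((1, 2), [([1], -1)])]"
    by code_simp
  show "trees_ok 2 pg_44_table 2
     [(2, 0, [0,1]), (0, 2, [0,1]), (0, -2, [0,-1]), (-2, 0, [0,-1])]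
     pg_44_loops pg_44_trees"
    by code_simp
  show "series_ok
     [1,0,-2,0,1]
     [([2], [1,0,-1]), ([2,2], [1])]
     (concat (map (leaves pg_44_loops) (concat pg_44_trees)))
     [1,2,1] [1,-2,1]"
    by code_simp
qed

definition pmm_44_table :: table where
  "pmm_44_table =
     [(1, [((0, 0), 1), ((0, 0), 0), ((0, 0), 3), ((0, 0), 2)]), (-1, [((0, 0), 1), ((0, 0), 0),
     ((0, 0), 3), ((0, 0), 2)]), (2, [((0, 0), 2), ((0, 0), 3), ((0, 0), 0), ((0, 0), 1)]), (-2,
     [((0, 0), 2), ((0, 0), 3), ((0, 0), 0), ((0, 0), 1)]), (3, [((-1, 0), 1), ((1, 0), 0), ((-1,
     0), 3), ((1, 0), 2)]), (-3, [((-1, 0), 1), ((1, 0), 0), ((-1, 0), 3), ((1, 0), 2)]), (4,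
     [((0, -1), 2), ((0, -1), 3), ((0, 1), 0), ((0, 1), 1)]), (-4, [((0, -1), 2), ((0, -1), 3),
     ((0, 1), 0), ((0, 1), 1)])]"

definition pmm_44_loops :: "code list" where
  "pmm_44_loops =
     [[1,3], [2,4], [3,1], [4,2]]"

definition pmm_44_trees :: "tree list list" where
  "pmm_44_trees =
     [[Leaf [([], 0), ([], 1)] [], Leaf [([], 1), ([], 2)] [3,1], Leaf [([], 2), ([], 3)]
     [3,1,4,2], Leaf [([], 3), ([], 0)] [4,2]], [Leaf [([], 0), ([], 1)] [1], Leaf [([], 1), ([],
     2)] [3], Leaf [([], 2), ([], 3)] [3,4,2], Leaf [([], 3), ([], 0)] [1,4,2]], [Leaf [([], 0),
     ([], 1)] [2], Leaf [([], 1), ([], 2)] [2,3,1], Leaf [([], 2), ([], 3)] [3,1,4], Leaf [([],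
     3), ([], 0)] [4]], [Leaf [([], 0), ([], 1)] [1,2], Leaf [([], 1), ([], 2)] [2,3], Leaf [([],
     2), ([], 3)] [3,4], Leaf [([], 3), ([], 0)] [1,4]]]"

lemma growth_pmm_44: "growth_fraction pmm_44 [1,2,1] [1,-2,1]"
proof (rule certified_growth)
  show "coded_presentation pmm_44 [gR1, gR2, gR3, gR4]
     [([1,1], []), ([2,2], []), ([3,3], []), ([4,4], []), ([1,2,1,2], []), ([2,3,2,3], []),
     ([3,4,3,4], []), ([4,1,4,1], [])] 4"
    unfolding pmm_44_def by (rule coded_presentation.intro) (simp_all add: letter_of_def wpow_def eval_nat_numeral)
  \<comment> \<open>The four mirrors bound a rectangle; A = R1 R3 and B = R2 R4 are the products of
    reflections in opposite sides.\<close>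
  show "group_ok 4
     [([1,1], []), ([2,2], []), ([3,3], []), ([4,4], []), ([1,2,1,2], []), ([2,3,2,3], []),
     ([3,4,3,4], []), ([4,1,4,1], [])]
     4 pmm_44_table [1,2,3,4] [1,3] [2,4]
     [[], [1], [2], [1,2]]
     [([1,3], 6), ([1,2], 7), ([1,2], 8), ([], 5)]
     [((1, 4), [([1,4,2], 5), ([1], 8)]), ((2, 1), [([2], 5)]), ((2, 3), [([], 6)]), ((3, 1),
     [([], 5)]), ((3, 3), [([1], 6)]), ((3, 4), [([1,2], 8), ([], 5)])]"
    by code_simp
  show "trees_ok 4 pmm_44_table 4
     [(2, 2, [0,1,1,2]), (2, -2, [0,1,-1,0]), (-2, 2, [0,-1,1,0]), (-2, -2, [0,-1,-1,-2])]
     pmm_44_loops pmm_44_trees"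
    by code_simp
  show "series_ok
     [1,0,-2,0,1]
     [([2,2], [1])]
     (concat (map (leaves pmm_44_loops) (concat pmm_44_trees)))
     [1,2,1] [1,-2,1]"
    by code_simp
qed

definition pgg_44_table :: table where
  "pgg_44_table =
     [(1, [((0, 0), 1), ((1, 0), 0), ((-1, -1), 3), ((0, 1), 2)]), (-1, [((-1, 0), 1), ((0, 0),
     0), ((0, -1), 3), ((1, 1), 2)]), (2, [((0, 0), 2), ((0, 0), 3), ((0, -1), 0), ((0, 1), 1)]),
     (-2, [((0, 1), 2), ((0, -1), 3), ((0, 0), 0), ((0, 0), 1)])]"

definition pgg_44_loops :: "code list" where
  "pgg_44_loops =
     [[1,1], [-2,-2], [-1,-1], [2,2]]"

definition pgg_44_trees :: "tree list list" where
  "pgg_44_trees =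
     [[Leaf [([], 0), ([], 1)] [], Leaf [([], 1), ([], 2)] [-1,-1], Leaf [([], 2), ([], 3)]
     [-1,-1,2,2], Leaf [([], 3), ([], 0)] [2,2]], [Leaf [([], 0), ([], 1)] [1], Leaf [([], 1),
     ([], 2)] [-1], Leaf [([], 2), ([], 3)] [-1,-2,-2], Leaf [([], 3), ([], 0)] [1,-2,-2]], [Swap
     (Peel (Leaf [([], 0)] [2]) (Swap (Leaf [([], 0), ([], 1)] [-2]))), Peel (Leaf [([], 2)]
     [-1,-1,2]) (Leaf [([], 1), ([], 2)] [-1,-1,-2]), Leaf [([], 2), ([], 3)] [-1,-1,2,2,2], Leaf
     [([], 3), ([], 0)] [2,2,2]], [Leaf [([], 0), ([], 1)] [1,2], Leaf [([], 1), ([], 2)] [-1,2],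
     Leaf [([], 2), ([], 3)] [-1,-2], Leaf [([], 3), ([], 0)] [1,-2]]]"

lemma growth_pgg_44: "growth_fraction pgg_44 [1,2,1] [1,-2,1]"
proof (rule certified_growth)
  show "coded_presentation pgg_44 [gP, gO]
     [([1,2,1,2], []), ([-1,2,-1,2], [])] 2"
    unfolding pgg_44_def by (rule coded_presentation.intro) (simp_all add: letter_of_def wpow_def eval_nat_numeral)
  \<comment> \<open>P and O are glide reflections with perpendicular axes; A = P^2 and B =
    O^-2.\<close>
  show "group_ok 2
     [([1,2,1,2], []), ([-1,2,-1,2], [])]
     4 pgg_44_table [] [1,1] [-2,-2]
     [[], [1], [2], [1,2]]
     [([1,1,-2], -1), ([1,1,-2,1,2], 2), ([1,1], -2), ([], 1)]
     [((2, 1), [([2,1], -1), ([2,1,1], -2), ([2], 1)]), ((3, 1), [([], 1)]), ((3, 2), [([1,2,2],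
     2), ([], 1)])]"
    by code_simp
  show "trees_ok 2 pgg_44_table 4
     [(2, -2, [0,1,1,0]), (-2, -2, [0,-1,1,-2]), (2, 2, [0,1,-1,2]), (-2, 2, [0,-1,-1,0])]
     pgg_44_loops pgg_44_trees"
    by code_simp
  show "series_ok
     [1,0,-2,0,1]
     [([2], [1,0,-1]), ([2,2], [1])]
     (concat (map (leaves pgg_44_loops) (concat pgg_44_trees)))
     [1,2,1] [1,-2,1]"
    by code_simp
qed

section \<open>The hexagonal tiling 6^3\<close>

definition p2_63_table :: table where
  "p2_63_table =
     [(1, [((0, 0), 1), ((0, 0), 0)]), (-1, [((0, 0), 1), ((0, 0), 0)]), (2, [((-1, 0), 1), ((1,
     0), 0)]), (-2, [((-1, 0), 1), ((1, 0), 0)]), (3, [((-1, -1), 1), ((1, 1), 0)]), (-3, [((-1,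
     -1), 1), ((1, 1), 0)])]"

definition p2_63_loops :: "code list" where
  "p2_63_loops =
     [[1,2], [1,3], [2,3], [2,1], [3,1], [3,2]]"

definition p2_63_trees :: "tree list list" where
  "p2_63_trees =
     [[Star (Leaf [([], 0), ([], 1)] []) (Leaf [([], 1), ([], 2)] [2,3]), Leaf [([], 2), ([], 3)]
     [2,1], Star (Leaf [([], 3), ([], 4)] [3,1]) (Leaf [([], 4), ([], 5)] [3,1,3,2]), Leaf [([],
     5), ([], 0)] [3,2]], [Star (Leaf [([], 0), ([], 1)] [1]) (Leaf [([], 1), ([], 2)] [1,3,2]),
     Leaf [([], 2), ([], 3)] [2], Star (Leaf [([], 3), ([], 4)] [3]) (Leaf [([], 4), ([], 5)]
     [3,2,3]), Leaf [([], 5), ([], 0)] [1,2,3]]]"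

lemma growth_p2_63: "growth_fraction p2_63 [1,1,1] [1,-2,1]"
proof (rule certified_growth)
  show "coded_presentation p2_63 [gT1, gT2, gT3]
     [([1,1], []), ([2,2], []), ([3,3], []), ([1,2,3,1,2,3], [])] 3"
    unfolding p2_63_def by (rule coded_presentation.intro) (simp_all add: letter_of_def wpow_def eval_nat_numeral)
  \<comment> \<open>Products of half-turns again: A = T1 T2 and B = T2 T3.\<close>
  show "group_ok 3
     [([1,1], []), ([2,2], []), ([3,3], []), ([1,2,3,1,2,3], [])]
     2 p2_63_table [1,2,3] [1,2] [2,3]
     [[], [1]]
     [([1], -4)]
     [((0, 3), [([3], 4)])]"
    by code_simp
  show "trees_ok 3 p2_63_table 2
     [(2, 0, [0,1]), (0, 2, [0,1]), (0, -2, [0,-1]), (-2, 0, [0,-1]), (2, -2, [0,1]), (-2, 2,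
     [0,-1])]
     p2_63_loops p2_63_trees"
    by code_simp
  show "series_ok
     [1,0,-2,0,1]
     [([2,2], [1])]
     (concat (map (leaves p2_63_loops) (concat p2_63_trees)))
     [1,1,1] [1,-2,1]"
    by code_simp
qed

definition cm_63_table :: table where
  "cm_63_table =
     [(1, [((0, 0), 1), ((0, 1), 0)]), (-1, [((0, -1), 1), ((0, 0), 0)]), (2, [((-1, -1), 1),
     ((1, 1), 0)]), (-2, [((-1, -1), 1), ((1, 1), 0)])]"

definition cm_63_loops :: "code list" where
  "cm_63_loops =
     [[-1,2], [1,2], [1,1], [2,1], [2,-1], [-1,-1]]"

definition cm_63_trees :: "tree list list" where
  "cm_63_trees =
     [[Star (Leaf [([], 0), ([], 1)] []) (Leaf [([], 1), ([], 2)] [1,1]), Leaf [([], 2), ([], 3)]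
     [2,1], Star (Leaf [([], 3), ([], 4)] [2,-1]) (Leaf [([], 4), ([], 5)] [-1,-1,2,-1]), Leaf
     [([], 5), ([], 0)] [-1,-1]], [Star (Leaf [([], 0), ([], 1)] [1]) (Leaf [([], 1), ([], 2)]
     [1,1,1]), Leaf [([], 2), ([], 3)] [1,1,2], Star (Leaf [([], 3), ([], 4)] [2]) (Leaf [([],
     4), ([], 5)] [-1,-1,2]), Leaf [([], 5), ([], 0)] [-1]]]"

lemma growth_cm_63: "growth_fraction cm_63 [1,1,1] [1,-2,1]"
proof (rule certified_growth)
  show "coded_presentation cm_63 [gP, gR]
     [([2,2], []), ([2,1,1], [1,1,2])] 2"
    unfolding cm_63_def by (rule coded_presentation.intro) (simp_all add: letter_of_def wpow_def eval_nat_numeral)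
  \<comment> \<open>R commutes with P^2, so its mirror is parallel to the axis of the glide
    reflection P; hence A = P^-1 R is a translation, oblique to B = P^2.\<close>
  show "group_ok 2
     [([2,2], []), ([2,1,1], [1,1,2])]
     2 cm_63_table [2] [-1,2] [1,1]
     [[], [1]]
     [([-1], 2)]
     [((1, 2), [([1,2,-1,-1], 2)])]"
    by code_simp
  show "trees_ok 2 cm_63_table 2
     [(2, 0, [0,1]), (0, 2, [0,1]), (0, -2, [0,-1]), (-2, 0, [0,-1]), (2, -2, [0,-1]), (-2, 2,
     [0,1])]
     cm_63_loops cm_63_trees"
    by code_simp
  show "series_ok
     [1,0,-2,0,1]
     [([2,2], [1])]
     (concat (map (leaves cm_63_loops) (concat cm_63_trees)))
     [1,1,1] [1,-2,1]"
    by code_simp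
qed

definition pmg_63_table :: table where
  "pmg_63_table =
     [(1, [((0, 0), 1), ((0, 0), 0), ((0, -1), 3), ((0, 1), 2)]), (-1, [((0, 0), 1), ((0, 0), 0),
     ((0, -1), 3), ((0, 1), 2)]), (2, [((0, 0), 2), ((0, 0), 3), ((0, 0), 0), ((0, 0), 1)]), (-2,
     [((0, 0), 2), ((0, 0), 3), ((0, 0), 0), ((0, 0), 1)]), (3, [((-1, 0), 2), ((-1, 0), 3), ((1,
     0), 0), ((1, 0), 1)]), (-3, [((-1, 0), 2), ((-1, 0), 3), ((1, 0), 0), ((1, 0), 1)])]"

definition pmg_63_loops :: "code list" where
  "pmg_63_loops =
     [[2,3], [1,2,1,3], [1,2,1,2], [3,2], [1,3,1,2], [3,1,2,1], [2,1,2,1], [2,1,3,1]]"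

definition pmg_63_trees :: "tree list list" where
  "pmg_63_trees =
     [[Star (Leaf [([], 0), ([], 1)] []) (Leaf [([], 1), ([], 2)] [1,2,1,2]), Peel (Leaf [([],
     3)] [3,2]) (Star (Leaf [([], 2), ([], 4)] [1,3,1,2]) (Leaf [([], 4), ([], 3)]
     [1,3,1,2,3,2])), Star (Leaf [([], 3), ([], 5)] [3,1,2,1]) (Leaf [([], 5), ([], 6)]
     [2,1,2,1,3,1,2,1]), Star (Leaf [([], 6), ([], 7)] [2,1,2,1]) (Leaf [([], 7), ([], 0)]
     [2,1,3,1])], [Star (Leaf [([], 0), ([], 1)] [1]) (Leaf [([], 1), ([], 2)] [1,2,1,2,1]), Peel
     (Leaf [([], 3)] [1,3,2]) (Star (Leaf [([], 2), ([], 4)] [1,3,1,2,1]) (Leaf [([], 4), ([],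
     3)] [1,3,1,2,1,3,2])), Star (Leaf [([], 3), ([], 5)] [3,1,2]) (Leaf [([], 5), ([], 6)]
     [2,1,2,1,3,1,2]), Star (Leaf [([], 6), ([], 7)] [2,1,2]) (Leaf [([], 7), ([], 0)] [2,1,3])],
     [Star (Leaf [([], 0), ([], 1)] [2]) (Leaf [([], 1), ([], 2)] [1,2,1]), Peel (Leaf [([], 3)]
     [3]) (Star (Leaf [([], 2), ([], 4)] [1,3,1]) (Leaf [([], 4), ([], 3)] [1,3,1,2,3])), Peel
     (Leaf [([], 6)] [2,1,2,1,3]) (Star (Leaf [([], 3), ([], 5)] [3,1,2,1,3]) (Leaf [([], 5),
     ([], 6)] [2,1,2,1,3,1,2,1,3])), Star (Leaf [([], 6), ([], 7)] [2,1,2,1,2]) (Leaf [([], 7),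
     ([], 0)] [2,1,3,1,2])], [Star (Leaf [([], 0), ([], 1)] [1,2]) (Leaf [([], 1), ([], 2)]
     [1,2,1,2,1,2]), Star (Leaf [([], 2), ([], 4)] [1,3]) (Leaf [([], 4), ([], 3)] [1,3,2,3]),
     Star (Leaf [([], 3), ([], 5)] [3,1]) (Leaf [([], 5), ([], 6)] [2,1,2,1,3,1]), Star (Leaf
     [([], 6), ([], 7)] [2,1]) (Leaf [([], 7), ([], 0)] [2,1,3,2])]]"

lemma growth_pmg_63: "growth_fraction pmg_63 [1,1,1] [1,-2,1]"
proof (rule certified_growth)
  show "coded_presentation pmg_63 [gR, gT1, gT2]
     [([1,1], []), ([2,2], []), ([3,3], []), ([2,1,2], [3,1,3])] 3"
    unfolding pmg_63_def by (rule coded_presentation.intro) (simp_all add: letter_of_def wpow_def eval_nat_numeral)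
  \<comment> \<open>A = T1 T2 commutes with R and translates along its mirror. R T1 is a glide
    reflection with axis across that mirror, and B is its square.\<close>
  show "group_ok 3
     [([1,1], []), ([2,2], []), ([3,3], []), ([2,1,2], [3,1,3])]
     4 pmg_63_table [1,2,3] [2,3] [1,2,1,2]
     [[], [1], [2], [1,2]]
     [([2,3,1], 4), ([2,3,1,3], 4)]
     [((1, 3), [([1,3], 4)]), ((3, 3), [([1,2,3,1,3], 4)])]"
    by code_simp
  show "trees_ok 3 pmg_63_table 4
     [(-2, 2, [0,1,-1,0]), (2, 2, [0,1,1,2]), (2, -2, [0,-1,1,0]), (0, 4, [0,1,-1,2]), (0, -4,
     [0,-1,1,-2]), (-2, -2, [0,-1,-1,-2])]
     pmg_63_loops pmg_63_trees"
    by code_simp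
  show "series_ok
     [1,0,0,0,-2,0,0,0,1]
     [([2], [1,0,1,0,-1,0,-1]), ([2,4], [1,0,1]), ([4], [1,0,0,0,-1]), ([4,2], [1,0,1]), ([4,4],
     [1])]
     (concat (map (leaves pmg_63_loops) (concat pmg_63_trees)))
     [1,1,1] [1,-2,1]"
    by code_simp
qed

definition p3m1_63_table :: table where
  "p3m1_63_table =
     [(1, [((0, 0), 1), ((0, 0), 0), ((0, -1), 5), ((-1, 1), 4), ((1, -1), 3), ((0, 1), 2)]),
     (-1, [((0, 0), 1), ((0, 0), 0), ((0, -1), 5), ((-1, 1), 4), ((1, -1), 3), ((0, 1), 2)]), (2,
     [((0, 0), 2), ((0, 0), 4), ((0, 0), 0), ((-1, 0), 5), ((0, 0), 1), ((1, 0), 3)]), (-2, [((0,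
     0), 2), ((0, 0), 4), ((0, 0), 0), ((-1, 0), 5), ((0, 0), 1), ((1, 0), 3)]), (3, [((0, 0),
     3), ((0, 0), 5), ((-1, 0), 4), ((0, 0), 0), ((1, 0), 2), ((0, 0), 1)]), (-3, [((0, 0), 3),
     ((0, 0), 5), ((-1, 0), 4), ((0, 0), 0), ((1, 0), 2), ((0, 0), 1)])]"

definition p3m1_63_loops :: "code list" where
  "p3m1_63_loops =
     [[1,2,3,2], [1,3,2,1,3,2], [1,3,1,2], [2,3,2,1], [3,1,2,1], [3,1,2,3,1,2], [3,2,1,3,2,1],
     [2,3,1,2,3,1], [2,1,3,1], [2,1,3,2,1,3], [1,2,1,3], [1,2,3,1,2,3]]"

definition p3m1_63_trees :: "tree list list" where
  "p3m1_63_trees =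
     [[Star (Leaf [([], 0), ([], 1)] []) (Leaf [([], 1), ([], 2)] [1,3,1,2]), Peel (Leaf [([],
     3)] [2,3,2,1]) (Star (Peel (Leaf [([], 4)] [3,1,2,1]) (Star (Leaf [([], 2), ([], 5)]
     [3,1,2,3,1,2]) (Leaf [([], 5), ([], 4)] [3,1,2,1,3,1,2,3,1,2]))) (Star (Leaf [([], 4), ([],
     6)] [3,2,1,3,2,1]) (Leaf [([], 6), ([], 3)] [2,3,2,1,3,2,1,3,2,1]))), Star (Leaf [([], 3),
     ([], 7)] [2,3,1,2,3,1]) (Leaf [([], 7), ([], 8)] [2,1,3,1,2,3,1,2,3,1]), Star (Star (Leaf
     [([], 8), ([], 9)] [2,1,3,1]) (Leaf [([], 9), ([], 10)] [2,1,3,2,1,3])) (Star (Leaf [([],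
     10), ([], 11)] [1,2,1,3]) (Leaf [([], 11), ([], 0)] [1,2,3,1,2,3]))], [Star (Leaf [([], 0),
     ([], 1)] [1]) (Leaf [([], 1), ([], 2)] [1,3,1,2,1]), Peel (Leaf [([], 3)] [2,3,2]) (Star
     (Star (Leaf [([], 2), ([], 5)] [3,1,2]) (Leaf [([], 5), ([], 4)] [3,1,2,1,3,1,2])) (Star
     (Leaf [([], 4), ([], 6)] [3,2,1,3,2]) (Leaf [([], 6), ([], 3)] [2,3,2,1,3,2,1,3,2]))), Star
     (Leaf [([], 3), ([], 7)] [2,3,1,2,3]) (Leaf [([], 7), ([], 8)] [2,1,3,1,2,3,1,2,3]), Star
     (Star (Leaf [([], 8), ([], 9)] [2,1,3]) (Leaf [([], 9), ([], 10)] [1,2,1,3,2,1,3])) (Star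
     (Leaf [([], 10), ([], 11)] [1,2,1,3,1]) (Leaf [([], 11), ([], 0)] [1,2,3,1,2,3,1]))], [Star
     (Peel (Peel (Leaf [] [2]) (Leaf [([], 1)] [1,3,2,1,3])) (Leaf [([], 0), ([], 1)] [1,2,3]))
     (Leaf [([], 1), ([], 2)] [1,3,1]), Peel (Leaf [([], 3)] [2,3,1,2,1]) (Peel (Leaf [([], 3)]
     [3,2,1]) (Star (Star (Leaf [([], 2), ([], 5)] [3,1,2,3,1]) (Leaf [([], 5), ([], 4)]
     [3,1,2,1,3,1,2,3,1])) (Star (Leaf [([], 4), ([], 6)] [3,1,2,1,3,2,1]) (Leaf [([], 6), ([],
     3)] [3,2,1,3,2,1,3,2,1])))), Star (Leaf [([], 3), ([], 7)] [2,3,1,2,3,1,2]) (Leaf [([], 7),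
     ([], 8)] [2,1,3,1,2,3,1,2,3,1,2]), Star (Star (Leaf [([], 8), ([], 9)] [2,1,3,1,2]) (Leaf
     [([], 9), ([], 10)] [2,1,3,2,1,3,2])) (Swap (Peel (Leaf [([], 10)] [1,2,1,3,2]) (Swap (Star
     (Leaf [([], 10), ([], 11)] [1,2,1,3,1,2,3]) (Leaf [([], 11), ([], 0)]
     [1,2,3,1,2,3,1,2,3])))))], [Peel (Leaf [([], 2)] [3]) (Star (Leaf [([], 0), ([], 1)]
     [1,3,2]) (Leaf [([], 1), ([], 2)] [1,3,1,2,1,3,2])), Peel (Leaf [([], 3)] [2,3,2,1,3]) (Star
     (Peel (Leaf [([], 4)] [3,1,2,1,3]) (Star (Leaf [([], 2), ([], 5)] [3,1,2,3,1,2,3]) (Leaf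
     [([], 5), ([], 4)] [3,1,2,1,3,1,2,3,1,2,3]))) (Star (Leaf [([], 4), ([], 6)]
     [3,2,1,3,2,1,3]) (Leaf [([], 6), ([], 3)] [2,3,2,1,3,2,1,3,2,1,3]))), Star (Leaf [([], 3),
     ([], 7)] [2,3,1,2,1,3,1]) (Leaf [([], 7), ([], 8)] [2,3,1,2,3,1,2,3,1]), Star (Star (Leaf
     [([], 8), ([], 9)] [2,3,1]) (Leaf [([], 9), ([], 10)] [2,1,3,2,1])) (Star (Leaf [([], 10),
     ([], 11)] [1,2,1]) (Leaf [([], 11), ([], 0)] [1,2,3,1,2]))], [Star (Leaf [([], 0), ([], 1)]
     [1,2]) (Leaf [([], 1), ([], 2)] [1,3,2,1]), Peel (Leaf [([], 3)] [2,3]) (Star (Star (Leaf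
     [([], 2), ([], 5)] [3,1]) (Leaf [([], 5), ([], 4)] [3,1,2,1,3,1])) (Star (Leaf [([], 4),
     ([], 6)] [3,2,1,3]) (Leaf [([], 6), ([], 3)] [2,3,2,1,3,2,1,3]))), Peel (Leaf [([], 8)]
     [2,1,3,1,2,3]) (Star (Leaf [([], 3), ([], 7)] [2,3,1,2,3,1,2,3]) (Leaf [([], 7), ([], 8)]
     [2,1,3,1,2,3,1,2,3,1,2,3])), Star (Star (Leaf [([], 8), ([], 9)] [2,1,3,2]) (Leaf [([], 9),
     ([], 10)] [1,2,1,3,2,1,3,2])) (Star (Leaf [([], 10), ([], 11)] [1,2,1,3,1,2]) (Leaf [([],
     11), ([], 0)] [1,2,3,1,2,3,1,2]))], [Star (Leaf [([], 0), ([], 1)] [1,3]) (Leaf [([], 1),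
     ([], 2)] [1,3,1,2,1,3]), Peel (Leaf [([], 3)] [3,2]) (Star (Star (Leaf [([], 2), ([], 5)]
     [3,1,2,3]) (Leaf [([], 5), ([], 4)] [3,1,2,1,3,1,2,3])) (Star (Leaf [([], 4), ([], 6)]
     [3,1,2,1,3,2]) (Leaf [([], 6), ([], 3)] [3,2,1,3,2,1,3,2]))), Star (Leaf [([], 3), ([], 7)]
     [2,3,1,2]) (Leaf [([], 7), ([], 8)] [2,1,3,1,2,3,1,2]), Star (Star (Leaf [([], 8), ([], 9)]
     [2,1]) (Leaf [([], 9), ([], 10)] [1,2,1,3,2,1])) (Star (Leaf [([], 10), ([], 11)] [1,2,3,1])
     (Leaf [([], 11), ([], 0)] [1,2,3,1,2,1,3,1]))]]"

lemma growth_p3m1_63: "growth_fraction p3m1_63 [1,1,1] [1,-2,1]"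
proof (rule certified_growth)
  show "coded_presentation p3m1_63 [gR1, gR2, gR3]
     [([1,1], []), ([2,2], []), ([3,3], []), ([1,2,1,2,1,2], []), ([2,3,2,3,2,3], []),
     ([3,1,3,1,3,1], [])] 3"
    unfolding p3m1_63_def by (rule coded_presentation.intro) (simp_all add: letter_of_def wpow_def eval_nat_numeral)
  \<comment> \<open>The mirror of R2 R3 R2 is parallel to that of R1, and the mirror of R1 R3 R1 to
    that of R2; A and B are the corresponding products of reflections.\<close>
  show "group_ok 3
     [([1,1], []), ([2,2], []), ([3,3], []), ([1,2,1,2,1,2], []), ([2,3,2,3,2,3], []),
     ([3,1,3,1,3,1], [])]
     6 p3m1_63_table [1,2,3] [1,2,3,2] [1,3,1,2]
     [[], [1], [2], [3], [1,2], [1,3]]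
     [([1,2,3,2,1,3,1,3,2], 4), ([1,2,3,2,1], 6), ([1], 5)]
     [((3, 1), [([3], 4), ([3], 5)]), ((3, 2), [([3], 5)]), ((4, 1), [([1,2,1], 6)]), ((5, 2),
     [([1,3], 5)])]"
    by code_simp
  show "trees_ok 3 p3m1_63_table 6
     [(2, -2, [0,1,1,-1,2,0]), (4, 2, [0,1,-1,-1,2,2]), (-2, 2, [0,-1,-1,1,-2,0]), (2, 4,
     [0,1,-1,1,0,2]), (-2, -4, [0,-1,1,-1,0,-2]), (-4, -2, [0,-1,1,1,-2,-2])]
     p3m1_63_loops p3m1_63_trees"
    by code_simp
  \<comment> \<open>Q = (1 - z^4) (1 - z^6). The type \<open>[]\<close> belongs to single vertices
    peeled off at an apex; their cofactor is Q itself.\<close>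
  show "series_ok
     [1,0,0,0,-1,0,-1,0,0,0,1]
     [([], [1,0,0,0,-1,0,-1,0,0,0,1]), ([4], [1,0,0,0,0,0,-1]), ([4,6], [1]), ([6],
     [1,0,0,0,-1]), ([6,4], [1])]
     (concat (map (leaves p3m1_63_loops) (concat p3m1_63_trees)))
     [1,1,1] [1,-2,1]"
    by code_simp
qed

section \<open>The trihexagonal tiling (3.6)^2\<close>

definition p3_3636_table :: table where
  "p3_3636_table =
     [(1, [((0, 0), 1), ((0, 0), 2), ((0, 0), 0)]), (-1, [((0, 0), 2), ((0, 0), 0), ((0, 0),
     1)]), (2, [((-1, 0), 1), ((0, -1), 2), ((1, 1), 0)]), (-2, [((-1, -1), 2), ((1, 0), 0), ((0,
     1), 1)])]"

definition p3_3636_loops :: "code list" where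
  "p3_3636_loops =
     [[1,-2], [-1,2], [-2,1], [2,-1]]"

definition p3_3636_trees :: "tree list list" where
  "p3_3636_trees =
     [[Star (Leaf [([], 0), ([], 1)] []) (Peel (Leaf [([-1], 2)] [-2,-1]) (Leaf [([], 1), ([-1],
     2)] [-2,1,2])), Swap (Leaf [([], 3), ([2], 0)] [-1]), Star (Leaf [([], 3), ([], 2)] [-2,1])
     (Leaf [([], 2), ([-2], 1)] [-1,2,1]), Swap (Peel (Leaf [([1], 3)] [2,1]) (Leaf [([], 0),
     ([1], 3)] [2,-1,-2]))], [Star (Leaf [([], 0), ([], 1)] [1]) (Leaf [([], 1), ([-1], 2)]
     [-2]), Swap (Leaf [([], 3), ([2], 0)] []), Peel (Leaf [([-2], 1)] [-1]) (Star (Leaf [([],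
     3), ([], 2)] [-2,1,2]) (Leaf [([], 2), ([-2], 1)] [1,-2,-1])), Swap (Leaf [([], 0), ([1],
     3)] [2,-1])], [Star (Leaf [([], 0), ([], 1)] [-1]) (Leaf [([], 1), ([-1], 2)] [-2,1]), Swap
     (Leaf [([], 3), ([2], 0)] [1]), Star (Leaf [([], 3), ([], 2)] [-2]) (Leaf [([], 2), ([-2],
     1)] [-1,2]), Swap (Leaf [([], 0), ([1], 3)] [2])]]"

lemma growth_p3_3636: "growth_fraction p3_3636 [1,4,6,6,3,-2] [1,0,-2,0,1]"
proof (rule certified_growth)
  show "coded_presentation p3_3636 [gS1, gS2]
     [([1,1,1], []), ([2,2,2], []), ([1,2,1,2,1,2], [])] 2"
    unfolding p3_3636_def by (rule coded_presentation.intro) (simp_all add: letter_of_def wpow_def eval_nat_numeral)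
  \<comment> \<open>S1 and S2 rotate by the same angle. In A = S1 S2^-1 opposite rotations
    compensate; in B = S1^-1 S2^-1 S1^-1 three equal ones add up to a full turn.\<close>
  show "group_ok 2
     [([1,1,1], []), ([2,2,2], []), ([1,2,1,2,1,2], [])]
     3 p3_3636_table [] [1,-2] [-1,-2,-1]
     [[], [1], [-1]]
     [([1], -3), ([1,1], 2), ([], 1)]
     [((1, 1), [([], 1)]), ((2, 2), [([-1,2], 3), ([], -1)])]"
    by code_simp
  show "trees_ok 2 p3_3636_table 3
     [(0, 2, [0,0,1]), (0, -2, [0,0,-1]), (2, -2, [0,1,0]), (-2, 2, [0,-1,0]), (2, 0, [0,1,1]),
     (-2, 0, [0,-1,-1])]
     p3_3636_loops p3_3636_trees"
    by code_simp
  show "series_ok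
     [1,0,-2,0,1]
     [([2], [1,0,-1]), ([2,2], [1])]
     (concat (map (leaves p3_3636_loops) (concat p3_3636_trees)))
     [1,4,6,6,3,-2] [1,0,-2,0,1]"
    by code_simp
qed

section \<open>The truncated square tiling 4.8^2\<close>

definition cmm_488_table :: table where
  "cmm_488_table =
     [(1, [((0, 0), 1), ((0, 0), 0), ((0, 1), 3), ((0, -1), 2)]), (-1, [((0, 0), 1), ((0, 0), 0),
     ((0, 1), 3), ((0, -1), 2)]), (2, [((0, 0), 2), ((0, 1), 3), ((0, 0), 0), ((0, -1), 1)]),
     (-2, [((0, 0), 2), ((0, 1), 3), ((0, 0), 0), ((0, -1), 1)]), (3, [((0, 0), 3), ((1, 0), 2),
     ((-1, 0), 1), ((0, 0), 0)]), (-3, [((0, 0), 3), ((1, 0), 2), ((-1, 0), 1), ((0, 0), 0)])]"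

definition cmm_488_loops :: "code list" where
  "cmm_488_loops =
     [[1,3,2], [1,3,1,3], [1,2,3], [2,3,1], [2,3,2,3], [3,1,3,1], [3,1,2], [3,2,3,2]]"

definition cmm_488_trees :: "tree list list" where
  "cmm_488_trees =
     [[Star (Leaf [([], 0), ([], 1)] []) (Leaf [([], 1), ([], 2)] [1,2,3]), Peel (Leaf [([], 3)]
     [2,3,1]) (Star (Leaf [([], 2), ([], 4)] [2,3,2,3]) (Leaf [([], 4), ([], 3)]
     [2,3,1,2,3,2,3])), Star (Leaf [([], 3), ([], 5)] [3,1,3,1]) (Leaf [([], 5), ([], 6)]
     [3,1,2,3,1,3,1]), Star (Leaf [([], 6), ([], 7)] [3,1,2]) (Leaf [([], 7), ([], 0)]
     [3,2,3,2])], [Star (Leaf [([], 0), ([], 1)] [1]) (Leaf [([], 1), ([], 2)] [1,2,3,1]), Star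
     (Leaf [([], 2), ([], 4)] [2,3]) (Leaf [([], 4), ([], 3)] [2,3,1,2,3]), Star (Leaf [([], 3),
     ([], 5)] [3,1,3]) (Leaf [([], 5), ([], 6)] [3,1,2,3,1,3]), Star (Leaf [([], 6), ([], 7)]
     [3,2]) (Leaf [([], 7), ([], 0)] [1,3,2,3,2])], [Peel (Leaf [([], 2)] [2]) (Star (Leaf [([],
     0), ([], 1)] [1,3]) (Leaf [([], 1), ([], 2)] [1,2,3,1,3])), Peel (Leaf [([], 3)] [2,3,1,2])
     (Star (Leaf [([], 2), ([], 4)] [2,3,2,3,2]) (Leaf [([], 4), ([], 3)] [2,3,1,2,3,2,3,2])),
     Star (Leaf [([], 3), ([], 5)] [2,3,1,3,1]) (Leaf [([], 5), ([], 6)] [3,1,3,1,3,1]), Star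
     (Leaf [([], 6), ([], 7)] [3,1]) (Leaf [([], 7), ([], 0)] [3,2,3])], [Star (Swap (Peel (Leaf
     [([], 0)] [3]) (Swap (Leaf [([], 0), ([], 1)] [1,3,1])))) (Leaf [([], 1), ([], 2)] [1,2]),
     Peel (Leaf [([], 3)] [2,3,1,3]) (Star (Leaf [([], 2), ([], 4)] [2,3,2]) (Leaf [([], 4), ([],
     3)] [2,3,1,2,3,2])), Star (Leaf [([], 3), ([], 5)] [3,1,3,1,3]) (Leaf [([], 5), ([], 6)]
     [3,1,2,3,1,3,1,3]), Star (Leaf [([], 6), ([], 7)] [3,1,2,3]) (Leaf [([], 7), ([], 0)]
     [3,2,3,2,3])]]"

lemma growth_cmm_488: "growth_fraction cmm_488 [1,2,2,2,1] [1,-1,0,-1,1]"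
proof (rule certified_growth)
  show "coded_presentation cmm_488 [gR1, gR2, gT]
     [([1,1], []), ([2,2], []), ([3,3], []), ([1,2,1,2], []), ([1,3,2,3,1,3,2,3], [])] 3"
    unfolding cmm_488_def by (rule coded_presentation.intro) (simp_all add: letter_of_def wpow_def eval_nat_numeral)
  \<comment> \<open>R1 and R2 have perpendicular mirrors and T is a half-turn, so A = R1 T R2 and B
    = R1 R2 T have trivial linear part.\<close>
  show "group_ok 3
     [([1,1], []), ([2,2], []), ([3,3], []), ([1,2,1,2], []), ([1,3,2,3,1,3,2,3], [])]
     4 cmm_488_table [1,2,3] [1,3,2] [1,2,3]
     [[], [1], [2], [3]]
     [([1,3,2,1,2,3,2,3], 5), ([1,3,2], 4)]
     [((2, 1), [([2], 4)]), ((3, 1), [([3], 4)])]"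
    by code_simp
  show "trees_ok 3 cmm_488_table 4
     [(1, 3, [0,1,1,-1]), (-3, 1, [0,-1,1,-1]), (3, 1, [0,1,-1,-1]), (3, -1, [0,1,-1,1]), (1, -3,
     [0,-1,-1,1]), (-1, 3, [0,1,1,-1]), (-1, -3, [0,-1,-1,1]), (-3, -1, [0,-1,1,1])]
     cmm_488_loops cmm_488_trees"
    by code_simp
  show "series_ok
     [1,0,0,-1,-1,0,0,1]
     [([3], [1,0,0,0,-1]), ([3,4], [1]), ([4,3], [1])]
     (concat (map (leaves cmm_488_loops) (concat cmm_488_trees)))
     [1,2,2,2,1] [1,-1,0,-1,1]"
    by code_simp
qed

definition p4_488_table :: table where
  "p4_488_table =
     [(1, [((0, 0), 1), ((0, 1), 3), ((0, 0), 0), ((0, -1), 2)]), (-1, [((0, 0), 2), ((0, 0), 0),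
     ((0, 1), 3), ((0, -1), 1)]), (2, [((0, 0), 3), ((1, 0), 2), ((-1, 0), 1), ((0, 0), 0)]),
     (-2, [((0, 0), 3), ((1, 0), 2), ((-1, 0), 1), ((0, 0), 0)])]"

definition p4_488_loops :: "code list" where
  "p4_488_loops =
     [[1,2,1], [1,2,-1,2], [1,1,2], [-1,2,-1], [-1,2,1,2], [2,1,2,-1], [2,1,1], [2,-1,2,1]]"

definition p4_488_trees :: "tree list list" where
  "p4_488_trees =
     [[Star (Leaf [([], 0), ([], 1)] []) (Leaf [([], 1), ([], 2)] [1,1,2]), Peel (Leaf [([], 3)]
     [-1,2,-1]) (Star (Leaf [([], 2), ([], 4)] [-1,2,1,2]) (Leaf [([], 4), ([], 3)]
     [-1,2,1,1,2,1,2])), Star (Leaf [([], 3), ([], 5)] [2,1,2,-1]) (Leaf [([], 5), ([], 6)]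
     [2,1,1,2,1,2,-1]), Star (Leaf [([], 6), ([], 7)] [2,1,1]) (Leaf [([], 7), ([], 0)]
     [2,-1,2,1])], [Star (Leaf [([], 0), ([], 1)] [1]) (Leaf [([], 1), ([], 2)] [1,1,2,1]), Star
     (Leaf [([], 2), ([], 4)] [-1,2]) (Leaf [([], 4), ([], 3)] [-1,2,1,1,2]), Star (Leaf [([],
     3), ([], 5)] [2,1,2]) (Leaf [([], 5), ([], 6)] [2,1,1,2,1,2]), Star (Leaf [([], 6), ([], 7)]
     [2,-1]) (Leaf [([], 7), ([], 0)] [1,2,1,2,-1])], [Peel (Leaf [([], 2)] [-1]) (Star (Leaf
     [([], 0), ([], 1)] [1,2]) (Leaf [([], 1), ([], 2)] [1,1,2,1,2])), Peel (Leaf [([], 3)]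
     [-1,2,1,1]) (Star (Leaf [([], 2), ([], 4)] [-1,2,1,2,-1]) (Leaf [([], 4), ([], 3)]
     [-1,2,1,1,2,1,2,-1])), Star (Leaf [([], 3), ([], 5)] [-1,2,-1,2,1]) (Leaf [([], 5), ([], 6)]
     [2,1,2,-1,2,1]), Star (Leaf [([], 6), ([], 7)] [2,1]) (Leaf [([], 7), ([], 0)] [2,-1,2])],
     [Star (Swap (Peel (Leaf [([], 0)] [2]) (Swap (Leaf [([], 0), ([], 1)] [1,2,-1])))) (Leaf
     [([], 1), ([], 2)] [1,1]), Peel (Leaf [([], 3)] [-1,2,-1,2]) (Star (Leaf [([], 2), ([], 4)]
     [-1,2,1]) (Leaf [([], 4), ([], 3)] [-1,2,1,1,2,1])), Star (Leaf [([], 3), ([], 5)]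
     [2,1,2,-1,2]) (Leaf [([], 5), ([], 6)] [2,1,1,2,1,2,-1,2]), Star (Leaf [([], 6), ([], 7)]
     [2,1,1,2]) (Leaf [([], 7), ([], 0)] [2,-1,2,1,2])]]"

lemma growth_p4_488: "growth_fraction p4_488 [1,2,2,2,1] [1,-1,0,-1,1]"
proof (rule certified_growth)
  show "coded_presentation p4_488 [gS, gT]
     [([1,1,1,1], []), ([2,2], []), ([1,2,1,2,1,2,1,2], [])] 2"
    unfolding p4_488_def by (rule coded_presentation.intro) (simp_all add: letter_of_def wpow_def eval_nat_numeral)
  \<comment> \<open>With a quarter-turn S and a half-turn T, the angles in A = S T S and B = S^2 T
    add up to a full turn.\<close>
  show "group_ok 2
     [([1,1,1,1], []), ([2,2], []), ([1,2,1,2,1,2,1,2], [])]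
     4 p4_488_table [2] [1,2,1] [1,1,2]
     [[], [1], [-1], [2]]
     [([1,2,1,1,1], -3), ([1,2], 1)]
     [((3, 1), [([2], 1)])]"
    by code_simp
  show "trees_ok 2 p4_488_table 4
     [(1, 3, [0,1,1,-1]), (-3, 1, [0,-1,1,-1]), (3, 1, [0,1,-1,-1]), (3, -1, [0,1,-1,1]), (1, -3,
     [0,-1,-1,1]), (-1, 3, [0,1,1,-1]), (-1, -3, [0,-1,-1,1]), (-3, -1, [0,-1,1,1])]
     p4_488_loops p4_488_trees"
    by code_simp
  show "series_ok
     [1,0,0,-1,-1,0,0,1]
     [([3], [1,0,0,0,-1]), ([3,4], [1]), ([4,3], [1])]
     (concat (map (leaves p4_488_loops) (concat p4_488_trees)))
     [1,2,2,2,1] [1,-1,0,-1,1]"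
    by code_simp
qed

definition p4m_488_table :: table where
  "p4m_488_table =
     [(1, [((0, 0), 1), ((0, 0), 0), ((-1, 0), 5), ((0, -1), 4), ((0, 1), 3), ((1, 0), 2), ((-1,
     -1), 7), ((1, 1), 6)]), (-1, [((0, 0), 1), ((0, 0), 0), ((-1, 0), 5), ((0, -1), 4), ((0, 1),
     3), ((1, 0), 2), ((-1, -1), 7), ((1, 1), 6)]), (2, [((0, 0), 2), ((0, 0), 4), ((0, 0), 0),
     ((0, 0), 6), ((0, 0), 1), ((0, 0), 7), ((0, 0), 3), ((0, 0), 5)]), (-2, [((0, 0), 2), ((0,
     0), 4), ((0, 0), 0), ((0, 0), 6), ((0, 0), 1), ((0, 0), 7), ((0, 0), 3), ((0, 0), 5)]), (3,
     [((0, 0), 3), ((0, 0), 5), ((0, 0), 6), ((0, 0), 0), ((0, 0), 7), ((0, 0), 1), ((0, 0), 2),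
     ((0, 0), 4)]), (-3, [((0, 0), 3), ((0, 0), 5), ((0, 0), 6), ((0, 0), 0), ((0, 0), 7), ((0,
     0), 1), ((0, 0), 2), ((0, 0), 4)])]"

definition p4m_488_loops :: "code list" where
  "p4m_488_loops =
     [[1,3,1,2], [1,2,3,1,2,3], [1,2,1,3], [2,1,3,1], [2,1,2,3,1,3], [2,3,1,2,3,1], [3,1,2,1],
     [3,1,2,3,1,2]]"

definition p4m_488_trees :: "tree list list" where
  "p4m_488_trees =
     [[Star (Leaf [([], 0), ([], 1)] []) (Leaf [([], 1), ([], 2)] [1,2,1,3]), Peel (Leaf [([],
     3)] [2,1,3,1]) (Star (Leaf [([], 2), ([], 4)] [2,1,2,3,1,3]) (Leaf [([], 4), ([], 3)]
     [2,1,2,3,1,2,1,3,1,3])), Star (Leaf [([], 3), ([], 5)] [2,3,1,2,3,1]) (Leaf [([], 5), ([],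
     6)] [2,3,1,2,1,3,1,2,3,1]), Star (Leaf [([], 6), ([], 7)] [3,1,2,1]) (Leaf [([], 7), ([],
     0)] [3,1,2,3,1,2])], [Star (Leaf [([], 0), ([], 1)] [1]) (Leaf [([], 1), ([], 2)]
     [1,2,1,3,1]), Star (Leaf [([], 2), ([], 4)] [2,1,3]) (Leaf [([], 4), ([], 3)]
     [2,1,3,1,2,1,3]), Star (Leaf [([], 3), ([], 5)] [2,3,1,2,3]) (Leaf [([], 5), ([], 6)]
     [2,3,1,2,1,3,1,2,3]), Star (Leaf [([], 6), ([], 7)] [3,1,2]) (Leaf [([], 7), ([], 0)]
     [1,3,1,2,3,1,2])], [Peel (Leaf [([], 2)] [2]) (Star (Leaf [([], 0), ([], 1)] [1,3,1]) (Leaf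
     [([], 1), ([], 2)] [1,2,3,1,3])), Peel (Leaf [([], 3)] [2,1,3,1,2]) (Star (Leaf [([], 2),
     ([], 4)] [2,1,2,3,1,2,3]) (Leaf [([], 4), ([], 3)] [2,1,2,3,1,2,1,3,1,2,3])), Star (Leaf
     [([], 3), ([], 5)] [2,3,1,2,3,1,2]) (Leaf [([], 5), ([], 6)] [2,3,1,2,1,3,1,2,3,1,2]), Swap
     (Peel (Leaf [([], 6)] [2,3,1,2,1]) (Swap (Star (Leaf [([], 6), ([], 7)] [3,1,2,3,1]) (Leaf
     [([], 7), ([], 0)] [1,3,1,2,3,1,2,3,1]))))], [Star (Swap (Peel (Leaf [([], 0)] [3]) (Swap
     (Leaf [([], 0), ([], 1)] [1,2,3,1,2])))) (Leaf [([], 1), ([], 2)] [1,2,1]), Peel (Leaf [([],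
     3)] [2,1,3,1,3]) (Star (Leaf [([], 2), ([], 4)] [2,1,2,3,1]) (Leaf [([], 4), ([], 3)]
     [2,1,2,3,1,2,1,3,1])), Star (Leaf [([], 3), ([], 5)] [2,3,1,2,3,1,3]) (Leaf [([], 5), ([],
     6)] [2,3,1,2,1,3,1,2,3,1,3]), Star (Leaf [([], 6), ([], 7)] [3,1,2,1,3]) (Leaf [([], 7),
     ([], 0)] [3,1,2,3,1,2,3])], [Star (Leaf [([], 0), ([], 1)] [1,2]) (Leaf [([], 1), ([], 2)]
     [1,2,1,3,1,2]), Star (Leaf [([], 2), ([], 4)] [2,1,2,3]) (Leaf [([], 4), ([], 3)]
     [2,1,2,3,1,2,1,3]), Star (Leaf [([], 3), ([], 5)] [2,3,1,3]) (Leaf [([], 5), ([], 6)]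
     [2,3,1,2,1,3,1,3]), Star (Leaf [([], 6), ([], 7)] [3,1]) (Leaf [([], 7), ([], 0)]
     [1,3,1,2,3,1])], [Star (Leaf [([], 0), ([], 1)] [1,3]) (Leaf [([], 1), ([], 2)]
     [1,2,1,3,1,3]), Star (Leaf [([], 2), ([], 4)] [2,1]) (Leaf [([], 4), ([], 3)]
     [2,1,3,1,2,1]), Star (Leaf [([], 3), ([], 5)] [2,3,1,2]) (Leaf [([], 5), ([], 6)]
     [2,3,1,2,1,3,1,2]), Star (Leaf [([], 6), ([], 7)] [3,1,2,3]) (Leaf [([], 7), ([], 0)]
     [1,3,1,2,3,1,2,3])], [Star (Swap (Peel (Peel (Leaf [] [2,3]) (Leaf [([], 0)] [1,3,1,3]))
     (Swap (Leaf [([], 0), ([], 1)] [1,2,3,1])))) (Peel (Leaf [([], 2)] [1,2,1,2]) (Leaf [([],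
     1), ([], 2)] [1,2,1,3,1,2,3,1])), Peel (Leaf [([], 3)] [2,1,3,1,2,3]) (Star (Leaf [([], 2),
     ([], 4)] [2,1,2,3,1,2]) (Leaf [([], 4), ([], 3)] [2,1,2,3,1,2,1,3,1,2])), Star (Leaf [([],
     3), ([], 5)] [2,3,1,2,3,1,2,3]) (Leaf [([], 5), ([], 6)] [2,3,1,2,1,3,1,2,3,1,2,3]), Swap
     (Peel (Leaf [([], 6)] [2,3,1,2,1,3]) (Swap (Star (Leaf [([], 6), ([], 7)] [3,1,2,3,1,3])
     (Leaf [([], 7), ([], 0)] [1,3,1,2,3,1,2,3,1,3]))))], [Star (Leaf [([], 0), ([], 1)] [1,2,3])
     (Leaf [([], 1), ([], 2)] [1,2,1,3,1,2,3]), Star (Leaf [([], 2), ([], 4)] [2,1,2]) (Leaf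
     [([], 4), ([], 3)] [2,1,2,3,1,2,1]), Star (Leaf [([], 3), ([], 5)] [2,3,1]) (Leaf [([], 5),
     ([], 6)] [2,3,1,2,1,3,1]), Star (Leaf [([], 6), ([], 7)] [3,1,3]) (Leaf [([], 7), ([], 0)]
     [1,3,1,2,3,1,3])]]"

lemma growth_p4m_488: "growth_fraction p4m_488 [1,2,2,2,1] [1,-1,0,-1,1]"
proof (rule certified_growth)
  show "coded_presentation p4m_488 [gR, gR1, gR2]
     [([1,1], []), ([2,2], []), ([3,3], []), ([1,2,1,2,1,2,1,2], []), ([2,3,2,3], []),
     ([3,1,3,1,3,1,3,1], [])] 3"
    unfolding p4m_488_def by (rule coded_presentation.intro) (simp_all add: letter_of_def wpow_def eval_nat_numeral)
  \<comment> \<open>R exchanges the two perpendicular mirror directions of R1 and R2, so A = (R R2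
    R) R1 and B = (R R1 R) R2 are products of reflections in parallel mirrors.\<close>
  show "group_ok 3
     [([1,1], []), ([2,2], []), ([3,3], []), ([1,2,1,2,1,2,1,2], []), ([2,3,2,3], []),
     ([3,1,3,1,3,1,3,1], [])]
     8 p4m_488_table [1,2,3] [1,3,1,2] [1,2,1,3]
     [[], [1], [2], [3], [1,2], [1,3], [2,3], [1,2,3]]
     [([1,3], 4), ([1,3,2,1], 5), ([1,3,2,1], 6), ([1,3], 5)]
     [((3, 2), [([3], 5)]), ((5, 2), [([1,3], 5)]), ((6, 1), [([2], 6)]), ((6, 2), [([], 5)]),
     ((7, 1), [([1,2,3,1,3,2,3], 4), ([1,2,3,1,3], 5), ([1], 5)]), ((7, 2), [([1], 5)])]"
    by code_simp
  show "trees_ok 3 p4m_488_table 8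
     [(-4, -2, [0,-1,1,1,-2,-2,2,-3]), (4, -2, [0,1,-1,1,0,2,0,1]), (-2, 4, [0,1,1,-1,2,0,0,1]),
     (-2, -4, [0,-1,1,1,-2,-2,2,-3]), (4, 2, [0,1,-1,-1,2,2,-2,3]), (2, 4, [0,1,-1,-1,2,2,-2,3]),
     (2, -4, [0,-1,-1,1,-2,0,0,-1]), (-4, 2, [0,-1,1,-1,0,-2,0,-1])]
     p4m_488_loops p4m_488_trees"
    by code_simp
  \<comment> \<open>With eight cosets instead of the four of \<open>cmm_488\<close> and
    \<open>p4_488\<close>, the spanning translations have lengths 4 and 6 instead of 3 and 4; after
    cancellation the same fraction remains.\<close>
  show "series_ok
     [1,0,0,0,-1,0,-1,0,0,0,1]
     [([], [1,0,0,0,-1,0,-1,0,0,0,1]), ([4], [1,0,0,0,0,0,-1]), ([4,6], [1]), ([6,4], [1])]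
     (concat (map (leaves p4m_488_loops) (concat p4m_488_trees)))
     [1,2,2,2,1] [1,-1,0,-1,1]"
    by code_simp
qed

definition p4g_488_table :: table where
  "p4g_488_table =
     [(1, [((0, 0), 1), ((0, 0), 0), ((-1, 0), 5), ((0, -1), 4), ((0, 1), 3), ((1, 0), 2), ((-1,
     -1), 7), ((1, 1), 6)]), (-1, [((0, 0), 1), ((0, 0), 0), ((-1, 0), 5), ((0, -1), 4), ((0, 1),
     3), ((1, 0), 2), ((-1, -1), 7), ((1, 1), 6)]), (2, [((0, 0), 2), ((0, 0), 4), ((0, 0), 6),
     ((0, 0), 0), ((0, 0), 7), ((0, 0), 1), ((0, 0), 3), ((0, 0), 5)]), (-2, [((0, 0), 3), ((0,
     0), 5), ((0, 0), 0), ((0, 0), 6), ((0, 0), 1), ((0, 0), 7), ((0, 0), 2), ((0, 0), 4)])]"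

definition p4g_488_loops :: "code list" where
  "p4g_488_loops =
     [[1,-2,1,-2], [1,2,2,1,2,2], [1,2,1,2], [2,1,2,1], [2,1,2,2,1,2], [2,2,1,2,2,1],
     [-2,1,-2,1], [-2,1,2,2,1,-2]]"

definition p4g_488_trees :: "tree list list" where
  "p4g_488_trees =
     [[Star (Leaf [([], 0), ([], 1)] []) (Leaf [([], 1), ([], 2)] [1,2,1,2]), Peel (Leaf [([],
     3)] [2,1,2,1]) (Star (Leaf [([], 2), ([], 4)] [2,1,2,2,1,2]) (Leaf [([], 4), ([], 3)]
     [2,1,2,1,2,1,2,2,1,2])), Star (Leaf [([], 3), ([], 5)] [2,2,1,2,2,1]) (Leaf [([], 5), ([],
     6)] [2,2,1,2,1,2,1,2,2,1]), Star (Leaf [([], 6), ([], 7)] [-2,1,-2,1]) (Leaf [([], 7), ([],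
     0)] [-2,1,2,2,1,-2])], [Star (Leaf [([], 0), ([], 1)] [1]) (Leaf [([], 1), ([], 2)]
     [1,2,1,2,1]), Star (Leaf [([], 2), ([], 4)] [2,1,2]) (Leaf [([], 4), ([], 3)]
     [2,1,2,1,2,1,2]), Star (Leaf [([], 3), ([], 5)] [2,2,1,2,2]) (Leaf [([], 5), ([], 6)]
     [2,2,1,2,1,2,1,2,2]), Star (Leaf [([], 6), ([], 7)] [-2,1,-2]) (Leaf [([], 7), ([], 0)]
     [1,-2,1,2,2,1,-2])], [Peel (Leaf [([], 2)] [2]) (Star (Leaf [([], 0), ([], 1)] [1,-2,1])
     (Leaf [([], 1), ([], 2)] [1,2,2,1,-2])), Peel (Leaf [([], 3)] [2,1,2,1,2]) (Star (Leaf [([],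
     2), ([], 4)] [2,1,2,2,1,2,2]) (Leaf [([], 4), ([], 3)] [2,1,2,1,2,1,2,2,1,2,2])), Star (Leaf
     [([], 3), ([], 5)] [2,2,1,2,2,1,2]) (Leaf [([], 5), ([], 6)] [2,2,1,2,1,2,1,2,2,1,2]), Swap
     (Peel (Leaf [([], 6)] [2,2,1,2,1]) (Swap (Star (Leaf [([], 6), ([], 7)] [-2,1,2,2,1]) (Leaf
     [([], 7), ([], 0)] [1,-2,1,2,2,1,2,2,1]))))], [Star (Swap (Peel (Leaf [([], 0)] [-2]) (Swap
     (Leaf [([], 0), ([], 1)] [1,2,2,1,2])))) (Leaf [([], 1), ([], 2)] [1,2,1]), Peel (Leaf [([],
     3)] [2,1,2,1,-2]) (Star (Leaf [([], 2), ([], 4)] [2,1,2,2,1]) (Leaf [([], 4), ([], 3)]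
     [2,1,2,1,2,1,2,2,1])), Star (Leaf [([], 3), ([], 5)] [2,2,1,2,2,1,-2]) (Leaf [([], 5), ([],
     6)] [2,2,1,2,1,2,1,2,2,1,-2]), Star (Leaf [([], 6), ([], 7)] [-2,1,-2,1,-2]) (Leaf [([], 7),
     ([], 0)] [-2,1,2,2,1,2,2])], [Star (Leaf [([], 0), ([], 1)] [1,2]) (Leaf [([], 1), ([], 2)]
     [1,2,1,2,1,2]), Star (Leaf [([], 2), ([], 4)] [2,1,2,2]) (Leaf [([], 4), ([], 3)]
     [2,1,2,1,2,1,2,2]), Star (Leaf [([], 3), ([], 5)] [2,2,1,-2]) (Leaf [([], 5), ([], 6)]
     [2,2,1,2,1,2,1,-2]), Star (Leaf [([], 6), ([], 7)] [-2,1]) (Leaf [([], 7), ([], 0)]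
     [1,-2,1,2,2,1])], [Star (Leaf [([], 0), ([], 1)] [1,-2]) (Leaf [([], 1), ([], 2)]
     [1,2,1,2,1,-2]), Star (Leaf [([], 2), ([], 4)] [2,1]) (Leaf [([], 4), ([], 3)]
     [2,1,2,1,2,1]), Star (Leaf [([], 3), ([], 5)] [2,2,1,2]) (Leaf [([], 5), ([], 6)]
     [2,2,1,2,1,2,1,2]), Star (Leaf [([], 6), ([], 7)] [-2,1,2,2]) (Leaf [([], 7), ([], 0)]
     [1,-2,1,2,2,1,2,2])], [Star (Swap (Peel (Peel (Leaf [] [2,2]) (Leaf [([], 0)] [1,-2,1,2]))
     (Swap (Leaf [([], 0), ([], 1)] [1,2,2,1])))) (Peel (Leaf [([], 2)] [1,2,1,-2]) (Leaf [([],
     1), ([], 2)] [1,2,1,2,1,2,2,1])), Peel (Leaf [([], 3)] [2,1,2,1,2,2]) (Star (Leaf [([], 2),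
     ([], 4)] [2,1,2,2,1,-2]) (Leaf [([], 4), ([], 3)] [2,1,2,1,2,1,2,2,1,-2])), Star (Leaf [([],
     3), ([], 5)] [2,2,1,2,2,1,2,2]) (Leaf [([], 5), ([], 6)] [2,2,1,2,1,2,1,2,2,1,2,2]), Swap
     (Peel (Leaf [([], 6)] [2,2,1,2,1,2]) (Swap (Star (Leaf [([], 6), ([], 7)] [-2,1,2,2,1,2])
     (Leaf [([], 7), ([], 0)] [1,-2,1,2,2,1,2,2,1,2]))))], [Star (Leaf [([], 0), ([], 1)]
     [1,2,2]) (Leaf [([], 1), ([], 2)] [1,2,1,2,1,2,2]), Star (Leaf [([], 2), ([], 4)] [2,1,-2])
     (Leaf [([], 4), ([], 3)] [2,1,2,1,2,1,-2]), Star (Leaf [([], 3), ([], 5)] [2,2,1]) (Leaf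
     [([], 5), ([], 6)] [2,2,1,2,1,2,1]), Star (Leaf [([], 6), ([], 7)] [-2,1,2]) (Leaf [([], 7),
     ([], 0)] [1,-2,1,2,2,1,2])]]"

lemma growth_p4g_488: "growth_fraction p4g_488 [1,2,2,2,1] [1,-1,0,-1,1]"
proof (rule certified_growth)
  show "coded_presentation p4g_488 [gR, gS]
     [([1,1], []), ([2,2,2,2], []), ([1,-2,1,2,1,-2,1,2], [])] 2"
    unfolding p4g_488_def by (rule coded_presentation.intro) (simp_all add: letter_of_def wpow_def eval_nat_numeral)
  \<comment> \<open>R S^-1 and R S are glide reflections; A and B are their squares.\<close>
  show "group_ok 2
     [([1,1], []), ([2,2,2,2], []), ([1,-2,1,2,1,-2,1,2], [])]
     8 p4g_488_table [1] [1,-2,1,-2] [1,2,1,2]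
     [[], [1], [2], [-2], [1,2], [1,-2], [2,2], [1,2,2]]
     [([1,-2], 3), ([1,-2,-2,1], 2), ([1,-2,-2], 3), ([1], -2)]
     [((6, 1), [([2,2], 3)]), ((6, 2), [([], 2)]), ((7, 1), [([1,2,2,1], -2), ([1,2,2,1,2], 3),
     ([1], 2)]), ((7, 2), [([1], 2)])]"
    by code_simp
  show "trees_ok 2 p4g_488_table 8
     [(-4, -2, [0,-1,1,1,-2,-2,2,-3]), (4, -2, [0,1,-1,1,0,2,0,1]), (-2, 4, [0,1,1,-1,2,0,0,1]),
     (-2, -4, [0,-1,1,1,-2,-2,2,-3]), (4, 2, [0,1,-1,-1,2,2,-2,3]), (2, 4, [0,1,-1,-1,2,2,-2,3]),
     (2, -4, [0,-1,-1,1,-2,0,0,-1]), (-4, 2, [0,-1,1,-1,0,-2,0,-1])]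
     p4g_488_loops p4g_488_trees"
    by code_simp
  show "series_ok
     [1,0,0,0,-1,0,-1,0,0,0,1]
     [([], [1,0,0,0,-1,0,-1,0,0,0,1]), ([4], [1,0,0,0,0,0,-1]), ([4,6], [1]), ([6,4], [1])]
     (concat (map (leaves p4g_488_loops) (concat p4g_488_trees)))
     [1,2,2,2,1] [1,-1,0,-1,1]"
    by code_simp
qed

section \<open>The truncated hexagonal tiling 3.12^2\<close>

definition p31m_31212_table :: table where
  "p31m_31212_table =
     [(1, [((0, 0), 1), ((0, 0), 0), ((-1, 0), 5), ((-1, -1), 4), ((1, 1), 3), ((1, 0), 2)]),
     (-1, [((0, 0), 1), ((0, 0), 0), ((-1, 0), 5), ((-1, -1), 4), ((1, 1), 3), ((1, 0), 2)]), (2,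
     [((0, 0), 2), ((0, 0), 4), ((0, 0), 3), ((0, 0), 0), ((0, 0), 5), ((0, 0), 1)]), (-2, [((0,
     0), 3), ((0, 0), 5), ((0, 0), 0), ((0, 0), 2), ((0, 0), 1), ((0, 0), 4)])]"

definition p31m_31212_loops :: "code list" where
  "p31m_31212_loops =
     [[1,-2,1,-2], [1,2,1,2], [2,1,2,1], [-2,1,-2,1]]"

definition p31m_31212_trees :: "tree list list" where
  "p31m_31212_trees =
     [[Star (Leaf [([], 0), ([], 1)] []) (Peel (Leaf [([2], 0)] [1,-2,1,2]) (Leaf [([], 1),
     ([1,2], 0)] [1,-2,1,-2,1,2])), Swap (Leaf [([], 2), ([2], 0)] [1,2,1]), Star (Leaf [([], 2),
     ([], 3)] [-2,1,-2,1]) (Leaf [([], 3), ([-2], 1)] [1,2,1,2,1,-2,1]), Swap (Peel (Leaf [([-2],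
     1)] [1,2,1,-2]) (Leaf [([], 0), ([1,-2], 1)] [1,2,1,2,1,-2]))], [Star (Leaf [([], 0), ([],
     1)] [1]) (Peel (Leaf [([1,2], 0)] [1,-2,1,2]) (Leaf [([], 1), ([1,2], 0)]
     [1,-2,1,-2,1,2,1])), Swap (Leaf [([], 2), ([2], 0)] [1,2]), Star (Leaf [([], 2), ([], 3)]
     [-2,1,-2]) (Leaf [([], 3), ([-2], 1)] [1,2,1,2,1,-2]), Swap (Peel (Leaf [([1,-2], 1)]
     [1,2,1,-2]) (Leaf [([], 0), ([1,-2], 1)] [1,2,1,2,1,-2,1]))], [Peel (Leaf [([2], 0)] [])
     (Star (Leaf [([], 0), ([], 1)] [1,-2,1]) (Leaf [([], 1), ([1,2], 0)] [1,-2])), Swap (Leaf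
     [([], 2), ([2], 0)] [1,2,1,2]), Star (Leaf [([], 2), ([], 3)] [-2,1,-2,1,2]) (Leaf [([], 3),
     ([-2], 1)] [1,-2,1,-2,1,2,1]), Swap (Peel (Leaf [([-2], 1)] [1,2,1]) (Leaf [([], 0),
     ([1,-2], 1)] [1,2,1,2,1]))], [Star (Swap (Peel (Peel (Leaf [] [-2]) (Leaf [([], 0)]
     [1,-2,1,2])) (Swap (Leaf [([], 0), ([], 1)] [1,2,1])))) (Peel (Leaf [([2], 0)] [1,-2,1])
     (Leaf [([], 1), ([1,2], 0)] [1,-2,1,-2,1])), Peel (Leaf [([], 2)] [2,1,2,1,-2]) (Swap (Leaf
     [([], 2), ([2], 0)] [1,2,1,2,1,-2,1])), Star (Leaf [([], 2), ([], 3)] [-2,1,-2,1,-2]) (Leaf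
     [([], 3), ([-2], 1)] [1,2,1,2,1,-2,1,-2]), Swap (Peel (Leaf [([-2], 1)] [1,2,1,2]) (Leaf
     [([], 0), ([1,-2], 1)] [1,2,1,2,1,2]))], [Star (Leaf [([], 0), ([], 1)] [1,2]) (Leaf [([],
     1), ([1,2], 0)] [1,-2,1,-2]), Swap (Leaf [([], 2), ([2], 0)] [1,-2]), Star (Leaf [([], 2),
     ([], 3)] [-2,1]) (Leaf [([], 3), ([-2], 1)] [1,2,1,2,1]), Swap (Leaf [([], 0), ([1,-2], 1)]
     [1,2,1])], [Star (Leaf [([], 0), ([], 1)] [1,-2]) (Leaf [([], 1), ([1,2], 0)] [1,-2,1]),
     Swap (Leaf [([], 2), ([2], 0)] [1]), Peel (Leaf [([-2], 1)] [1,2]) (Star (Leaf [([], 2),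
     ([], 3)] [-2,1,-2,1,2,1]) (Leaf [([], 3), ([-2], 1)] [1,-2,1,-2,1,2])), Swap (Leaf [([], 0),
     ([1,-2], 1)] [1,2,1,2])]]"

lemma growth_p31m_31212: "growth_fraction p31m_31212 [1,1,1,3,-1,5,-3,4,-2] [1,-2,3,-4,3,-2,1]"
proof (rule certified_growth)
  show "coded_presentation p31m_31212 [gR, gS]
     [([1,1], []), ([2,2,2], []), ([1,-2,1,2,1,-2,1,2,1,-2,1,2], [])] 2"
    unfolding p31m_31212_def by (rule coded_presentation.intro) (simp_all add: letter_of_def wpow_def eval_nat_numeral)
  \<comment> \<open>A is the square of the glide reflection R S^-1. Conjugation by R reverses
    rotations, so B = S (R S^-1 R) S is a product of three rotations by the same angle, a
    translation.\<close>
  show "group_ok 2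
     [([1,1], []), ([2,2,2], []), ([1,-2,1,2,1,-2,1,2,1,-2,1,2], [])]
     6 p31m_31212_table [1] [1,-2,1,-2] [2,1,-2,1,2]
     [[], [1], [2], [-2], [1,2], [1,-2]]
     [([1,-2,-2,1,2,2,1,2], 3), ([1,-2,-2,1], 2), ([1], -2)]
     [((2, 2), [([], 2)]), ((3, 1), [([-2], 3), ([], -2)]), ((4, 1), [([1], 2)]), ((4, 2), [([1],
     2)])]"
    by code_simp
  \<comment> \<open>At B^-1 C_1 no form exceeds 5, but the length is 6; the neighbour B^-1 falls
    short as well, with 4 against 5. Here the neighbour argument is needed twice in
    succession.\<close>
  show "trees_ok 2 p31m_31212_table 6
     [(3, -4, [0,1,0,1,1,2]), (0, 4, [0,1,0,-1,2,1]), (-4, 0, [0,-1,1,1,-2,-2]), (4, -4,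
     [0,1,-1,0,1,2]), (-4, 4, [0,-1,1,0,-1,-2]), (4, 0, [0,1,-1,-1,2,2]), (0, -4,
     [0,-1,0,1,-2,-1])]
     p31m_31212_loops p31m_31212_trees"
    by code_simp
  show "series_ok
     [1,0,0,0,-2,0,0,0,1]
     [([], [1,0,0,0,-2,0,0,0,1]), ([4], [1,0,0,0,-1]), ([4,4], [1])]
     (concat (map (leaves p31m_31212_loops) (concat p31m_31212_trees)))
     [1,1,1,3,-1,5,-3,4,-2] [1,-2,3,-4,3,-2,1]"
    by code_simp
qed

definition p6_31212_table :: table where
  "p6_31212_table =
     [(1, [((0, 0), 1), ((0, 0), 2), ((0, 0), 0), ((-1, 0), 4), ((0, -1), 5), ((1, 1), 3)]), (-1,
     [((0, 0), 2), ((0, 0), 0), ((0, 0), 1), ((-1, -1), 5), ((1, 0), 3), ((0, 1), 4)]), (2, [((0,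
     0), 3), ((0, 0), 4), ((0, 0), 5), ((0, 0), 0), ((0, 0), 1), ((0, 0), 2)]), (-2, [((0, 0),
     3), ((0, 0), 4), ((0, 0), 5), ((0, 0), 0), ((0, 0), 1), ((0, 0), 2)])]"

definition p6_31212_loops :: "code list" where
  "p6_31212_loops =
     [[1,2,-1,2], [-1,2,1,2], [2,-1,2,1], [2,1,2,-1]]"

definition p6_31212_trees :: "tree list list" where
  "p6_31212_trees =
     [[Star (Leaf [([], 0), ([], 1)] []) (Peel (Leaf [([-1], 2)] [2,-1,2,-1]) (Leaf [([], 1),
     ([-1], 2)] [2,-1,2,1,2,1,2])), Swap (Leaf [([], 3), ([2,1], 3)] [2,-1]), Star (Leaf [([],
     3), ([], 2)] [2,-1,2,1]) (Leaf [([], 2), ([2,-1], 2)] [2,-1,2,1,2,1]), Swap (Peel (Leaf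
     [([1], 3)] [2,1,2,1]) (Leaf [([], 0), ([1], 3)] [2,1,2,-1,2,-1,2]))], [Star (Leaf [([], 0),
     ([], 1)] [1]) (Leaf [([], 1), ([-1], 2)] [2,-1,2]), Swap (Leaf [([], 3), ([2,1], 3)] [2]),
     Peel (Leaf [([2,-1], 2)] [2,-1]) (Star (Leaf [([], 3), ([], 2)] [2,-1,2,1,2,1,2]) (Leaf
     [([], 2), ([2,-1], 2)] [2,1,2,-1,2,-1])), Swap (Leaf [([], 0), ([1], 3)] [2,1,2,-1])], [Star
     (Leaf [([], 0), ([], 1)] [-1]) (Leaf [([], 1), ([-1], 2)] [2,-1,2,1]), Swap (Leaf [([], 3),
     ([2,1], 3)] [2,1]), Star (Leaf [([], 3), ([], 2)] [2,-1,2]) (Leaf [([], 2), ([2,-1], 2)]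
     [2,-1,2,1,2]), Swap (Leaf [([], 0), ([1], 3)] [2,1,2])], [Peel (Peel (Leaf [] [2]) (Leaf
     [([-1], 2)] [2,-1,2,-1,2])) (Star (Leaf [([], 0), ([], 1)] [1,2,-1]) (Leaf [([], 1), ([-1],
     2)] [2,1])), Swap (Leaf [([], 3), ([2,1], 3)] [2,-1,2]), Star (Leaf [([], 3), ([], 2)]
     [2,-1,2,1,2]) (Leaf [([], 2), ([2,-1], 2)] [2,-1,2,1,2,1,2]), Swap (Peel (Leaf [([1], 3)]
     [2,1,2,1,2]) (Leaf [([], 0), ([1], 3)] [2,1,2,-1,2,-1]))], [Star (Leaf [([], 0), ([], 1)]
     [1,2]) (Leaf [([], 1), ([-1], 2)] [2,-1]), Swap (Leaf [([], 3), ([2,1], 3)] []), Peel (Leaf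
     [([2,-1], 2)] [2,-1,2]) (Star (Leaf [([], 3), ([], 2)] [2,-1,2,1,2,1]) (Leaf [([], 2),
     ([2,-1], 2)] [2,1,2,-1,2,-1,2])), Swap (Leaf [([], 0), ([1], 3)] [2,1,2,-1,2])], [Star (Leaf
     [([], 0), ([], 1)] [-1,2]) (Leaf [([], 1), ([-1], 2)] [2,-1,2,1,2]), Swap (Leaf [([], 3),
     ([2,1], 3)] [2,1,2]), Star (Leaf [([], 3), ([], 2)] [2,-1]) (Leaf [([], 2), ([2,-1], 2)]
     [2,-1,2,1]), Swap (Leaf [([], 0), ([1], 3)] [2,1])]]"

lemma growth_p6_31212: "growth_fraction p6_31212 [1,1,1,3,-1,5,-3,4,-2] [1,-2,3,-4,3,-2,1]"
proof (rule certified_growth)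
  show "coded_presentation p6_31212 [gS, gT]
     [([1,1,1], []), ([2,2], []), ([1,2,1,2,1,2,1,2,1,2,1,2], [])] 2"
    unfolding p6_31212_def by (rule coded_presentation.intro) (simp_all add: letter_of_def wpow_def eval_nat_numeral)
  \<comment> \<open>T S^-1 T rotates like S^-1. Opposite angles cancel in A = S (T S^-1 T), and B =
    S^-1 (T S^-1 T) S^-1 makes a full turn.\<close>
  show "group_ok 2
     [([1,1,1], []), ([2,2], []), ([1,2,1,2,1,2,1,2,1,2,1,2], [])]
     6 p6_31212_table [2] [1,2,-1,2] [-1,2,-1,2,-1]
     [[], [1], [-1], [2], [1,2], [-1,2]]
     [([1], -3), ([1,1,2], 1), ([], 1)]
     [((1, 1), [([], 1)]), ((5, 1), [([-1,2], 3), ([], -1)])]"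
    by code_simp
  show "trees_ok 2 p6_31212_table 6
     [(0, -4, [0,0,-1,1,1,-2]), (-3, 4, [0,0,1,1,-1,2]), (4, -4, [0,1,0,-1,2,-1]), (4, 0,
     [0,1,1,-1,2,2]), (0, 4, [0,0,1,-1,-1,2]), (-4, 0, [0,-1,-1,1,-2,-2]), (-4, 4,
     [0,-1,0,1,-2,1])]
     p6_31212_loops p6_31212_trees"
    by code_simp
  show "series_ok
     [1,0,0,0,-2,0,0,0,1]
     [([], [1,0,0,0,-2,0,0,0,1]), ([4], [1,0,0,0,-1]), ([4,4], [1])]
     (concat (map (leaves p6_31212_loops) (concat p6_31212_trees)))
     [1,1,1,3,-1,5,-3,4,-2] [1,-2,3,-4,3,-2,1]"
    by code_simp
qed

section \<open>The truncated trihexagonal tiling 4.6.12\<close>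

definition p6m_4612_table :: table where
  "p6m_4612_table =
     [(1, [((0, 0), 1), ((0, 0), 0), ((0, 0), 6), ((0, 0), 5), ((0, 0), 9), ((0, 0), 3), ((0, 0),
     2), ((-1, 0), 11), ((0, 1), 10), ((0, 0), 4), ((0, -1), 8), ((1, 0), 7)]), (-1, [((0, 0),
     1), ((0, 0), 0), ((0, 0), 6), ((0, 0), 5), ((0, 0), 9), ((0, 0), 3), ((0, 0), 2), ((-1, 0),
     11), ((0, 1), 10), ((0, 0), 4), ((0, -1), 8), ((1, 0), 7)]), (2, [((0, 0), 2), ((0, 0), 4),
     ((0, 0), 0), ((0, 0), 8), ((0, 0), 1), ((0, 0), 11), ((-1, 0), 10), ((0, 1), 9), ((0, 0),
     3), ((0, -1), 7), ((1, 0), 6), ((0, 0), 5)]), (-2, [((0, 0), 2), ((0, 0), 4), ((0, 0), 0),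
     ((0, 0), 8), ((0, 0), 1), ((0, 0), 11), ((-1, 0), 10), ((0, 1), 9), ((0, 0), 3), ((0, -1),
     7), ((1, 0), 6), ((0, 0), 5)]), (3, [((0, 0), 3), ((0, 0), 5), ((0, 0), 7), ((0, 0), 0),
     ((0, 0), 10), ((0, 0), 1), ((-1, 0), 11), ((0, 0), 2), ((0, 1), 9), ((0, -1), 8), ((0, 0),
     4), ((1, 0), 6)]), (-3, [((0, 0), 3), ((0, 0), 5), ((0, 0), 7), ((0, 0), 0), ((0, 0), 10),
     ((0, 0), 1), ((-1, 0), 11), ((0, 0), 2), ((0, 1), 9), ((0, -1), 8), ((0, 0), 4), ((1, 0),
     6)])]"

definition p6m_4612_loops :: "code list" where
  "p6m_4612_loops =
     [[1,2,3,2,1,2], [1,3,2,1,2,1,3,2,1,2], [3,2,1,2,1,2], [2,3,2,1,2,1], [3,2,1,2,1,3,2,1,2,1],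
     [2,1,2,3,2,1], [2,1,3,2,1,2,1,3,2,1], [2,1,2,1,2,3], [2,1,2,1,3,2,1,2,1,3],
     [1,2,1,2,1,3,2,1,2,3], [1,2,1,2,3,2], [1,2,1,3,2,1,2,1,3,2]]"

definition p6m_4612_trees :: "tree list list" where
  "p6m_4612_trees =
     [[Star (Star (Leaf [([], 0), ([], 1)] []) (Leaf [([], 1), ([], 2)] [3,2,1,2,1,2])) (Peel
     (Leaf [([], 3)] [2,3,2,1,2,1]) (Star (Leaf [([], 2), ([], 4)] [3,2,1,2,1,3,2,1,2,1]) (Leaf
     [([], 4), ([], 3)] [2,3,2,1,2,1,3,2,1,2,1,3,2,1,2,1]))), Peel (Leaf [([], 5)] [2,1,2,3,2,1])
     (Star (Leaf [([], 3), ([], 6)] [2,1,3,2,1,2,1,3,2,1]) (Leaf [([], 6), ([], 5)]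
     [2,1,2,3,2,1,2,1,3,2,1,2,1,3,2,1])), Star (Peel (Leaf [([], 7)] [2,1,2,1,2,3]) (Star (Leaf
     [([], 5), ([], 8)] [2,1,2,1,3,2,1,2,1,3]) (Leaf [([], 8), ([], 7)]
     [2,1,2,1,2,3,2,1,2,1,3,2,1,2,1,3]))) (Star (Leaf [([], 7), ([], 9)] [1,2,1,2,1,3,2,1,2,3])
     (Leaf [([], 9), ([], 10)] [1,2,1,2,1,3,2,1,2,1,2,3,2,1,2,3])), Star (Leaf [([], 10), ([],
     11)] [1,2,1,2,3,2]) (Leaf [([], 11), ([], 0)] [1,2,1,3,2,1,2,1,3,2])], [Star (Star (Leaf
     [([], 0), ([], 1)] [1]) (Leaf [([], 1), ([], 2)] [1,3,2,1,2,1,2])) (Peel (Leaf [([], 3)]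
     [2,3,2,1,2]) (Star (Leaf [([], 2), ([], 4)] [3,2,1,2,1,3,2,1,2]) (Leaf [([], 4), ([], 3)]
     [2,3,2,1,2,1,3,2,1,2,1,3,2,1,2]))), Peel (Leaf [([], 5)] [2,1,2,3,2]) (Star (Leaf [([], 3),
     ([], 6)] [2,1,3,2,1,2,1,3,2]) (Leaf [([], 6), ([], 5)] [2,1,2,3,2,1,2,1,3,2,1,2,1,3,2])),
     Star (Peel (Leaf [([], 7)] [1,2,1,2,1,2,3]) (Star (Leaf [([], 5), ([], 8)]
     [2,1,2,1,3,2,1,2,3]) (Leaf [([], 8), ([], 7)] [2,1,2,1,2,3,2,1,2,1,3,2,1,2,3]))) (Star (Leaf
     [([], 7), ([], 9)] [1,2,1,2,1,3,2,1,2,1,3]) (Leaf [([], 9), ([], 10)]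
     [1,2,1,2,1,3,2,1,2,1,2,3,2,1,2,1,3])), Star (Leaf [([], 10), ([], 11)] [1,2,1,2,3,2,1])
     (Leaf [([], 11), ([], 0)] [1,2,1,3,2,1,2,1,3,2,1])], [Peel (Leaf [([], 3)] [2]) (Star (Star
     (Leaf [([], 0), ([], 1)] [1,2,3,2,1]) (Leaf [([], 1), ([], 2)] [1,3,2,1,2,1,3,2,1])) (Star
     (Leaf [([], 2), ([], 4)] [3,2,1,2,1]) (Leaf [([], 4), ([], 3)] [2,3,2,1,2,1,3,2,1,2,1]))),
     Peel (Leaf [([], 5)] [2,1,2,3,2,1,2]) (Star (Leaf [([], 3), ([], 6)]
     [2,1,3,2,1,2,1,3,2,1,2]) (Leaf [([], 6), ([], 5)] [2,1,2,3,2,1,2,1,3,2,1,2,1,3,2,1,2])),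
     Star (Peel (Leaf [([], 7)] [2,1,2,1,2,3,2]) (Star (Leaf [([], 5), ([], 8)]
     [2,1,2,1,3,2,1,2,1,3,2]) (Leaf [([], 8), ([], 7)] [2,1,2,1,2,3,2,1,2,1,3,2,1,2,1,3,2])))
     (Star (Leaf [([], 7), ([], 9)] [1,2,1,2,1,2,3,2,1,2,3]) (Leaf [([], 9), ([], 10)]
     [1,2,1,2,1,3,2,1,2,1,3,2,1,2,3])), Star (Leaf [([], 10), ([], 11)] [1,2,1,2,3]) (Leaf [([],
     11), ([], 0)] [1,2,1,3,2,1,2,1,3])], [Star (Star (Leaf [([], 0), ([], 1)] [3]) (Leaf [([],
     1), ([], 2)] [3,2,1,2,1,2,3])) (Peel (Leaf [([], 3)] [2,3,2,1,2,1,3]) (Star (Leaf [([], 2),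
     ([], 4)] [3,2,1,2,1,3,2,1,2,1,3]) (Leaf [([], 4), ([], 3)]
     [2,3,2,1,2,1,3,2,1,2,1,3,2,1,2,1,3]))), Star (Leaf [([], 3), ([], 6)] [2,1,3,2,1]) (Leaf
     [([], 6), ([], 5)] [2,1,2,3,2,1,2,1,3,2,1]), Star (Peel (Leaf [([], 7)] [2,1,2,1,2]) (Star
     (Leaf [([], 5), ([], 8)] [2,1,2,1,3,2,1,2,1]) (Leaf [([], 8), ([], 7)]
     [2,1,2,1,2,3,2,1,2,1,3,2,1,2,1]))) (Star (Leaf [([], 7), ([], 9)] [1,2,1,2,1,3,2,1,2]) (Leaf
     [([], 9), ([], 10)] [1,2,1,2,1,3,2,1,2,1,2,3,2,1,2])), Star (Leaf [([], 10), ([], 11)]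
     [1,2,1,3,2]) (Leaf [([], 11), ([], 0)] [1,2,1,3,2,1,2,1,2,3,2])], [Star (Star (Leaf [([],
     0), ([], 1)] [1,2]) (Leaf [([], 1), ([], 2)] [1,3,2,1,2,1])) (Peel (Leaf [([], 3)]
     [2,3,2,1]) (Star (Leaf [([], 2), ([], 4)] [3,2,1,2,1,3,2,1]) (Leaf [([], 4), ([], 3)]
     [2,3,2,1,2,1,3,2,1,2,1,3,2,1]))), Peel (Leaf [([], 5)] [2,1,2,3]) (Star (Leaf [([], 3), ([],
     6)] [2,1,3,2,1,2,1,3]) (Leaf [([], 6), ([], 5)] [2,1,2,3,2,1,2,1,3,2,1,2,1,3])), Star (Peel
     (Leaf [([], 7)] [1,2,1,2,1,2,3,2]) (Peel (Leaf [([], 7)] [2,1,2,1,2,3,2,1,2,3]) (Star (Leaf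
     [([], 5), ([], 8)] [2,1,2,1,3,2,1,2,1,3,2,1,2,3]) (Leaf [([], 8), ([], 7)]
     [2,1,2,1,2,3,2,1,2,1,3,2,1,2,1,3,2,1,2,3])))) (Star (Leaf [([], 7), ([], 9)]
     [1,2,1,2,1,3,2,1,2,1,3,2]) (Leaf [([], 9), ([], 10)]
     [1,2,1,2,1,3,2,1,2,1,2,3,2,1,2,1,3,2])), Star (Leaf [([], 10), ([], 11)] [1,2,1,2,3,2,1,2])
     (Leaf [([], 11), ([], 0)] [1,2,1,3,2,1,2,1,3,2,1,2])], [Star (Star (Leaf [([], 0), ([], 1)]
     [1,3]) (Leaf [([], 1), ([], 2)] [1,3,2,1,2,1,2,3])) (Peel (Leaf [([], 3)] [2,3,2,1,2,3])
     (Star (Leaf [([], 2), ([], 4)] [3,2,1,2,1,3,2,1,2,3]) (Leaf [([], 4), ([], 3)]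
     [2,3,2,1,2,1,3,2,1,2,1,3,2,1,2,3]))), Star (Leaf [([], 3), ([], 6)] [2,1,3,2]) (Leaf [([],
     6), ([], 5)] [2,1,2,3,2,1,2,1,3,2]), Star (Peel (Leaf [([], 7)] [1,2,1,2,1,2]) (Star (Leaf
     [([], 5), ([], 8)] [2,1,2,1,3,2,1,2]) (Leaf [([], 8), ([], 7)]
     [2,1,2,1,2,3,2,1,2,1,3,2,1,2]))) (Star (Leaf [([], 7), ([], 9)] [1,2,1,2,1,3,2,1,2,1]) (Leaf
     [([], 9), ([], 10)] [1,2,1,2,1,3,2,1,2,1,2,3,2,1,2,1])), Star (Leaf [([], 10), ([], 11)]
     [1,2,1,3,2,1]) (Leaf [([], 11), ([], 0)] [1,2,1,3,2,1,2,1,2,3,2,1])], [Peel (Leaf [([], 3)]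
     [2,1]) (Star (Star (Leaf [([], 0), ([], 1)] [1,2,3,2]) (Leaf [([], 1), ([], 2)]
     [1,3,2,1,2,1,3,2])) (Star (Leaf [([], 2), ([], 4)] [3,2,1,2]) (Leaf [([], 4), ([], 3)]
     [2,3,2,1,2,1,3,2,1,2]))), Peel (Leaf [([], 5)] [2,1,2,3,2,1,2,1]) (Star (Leaf [([], 3), ([],
     6)] [2,1,3,2,1,2,1,3,2,1,2,1]) (Leaf [([], 6), ([], 5)]
     [2,1,2,3,2,1,2,1,3,2,1,2,1,3,2,1,2,1])), Star (Peel (Leaf [([], 7)] [2,1,2,1,2,3,2,1]) (Star
     (Leaf [([], 5), ([], 8)] [2,1,2,1,3,2,1,2,1,3,2,1]) (Leaf [([], 8), ([], 7)]
     [2,1,2,1,2,3,2,1,2,1,3,2,1,2,1,3,2,1]))) (Star (Leaf [([], 7), ([], 9)]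
     [1,2,1,2,1,2,3,2,1,2,1,3]) (Leaf [([], 9), ([], 10)] [1,2,1,2,1,3,2,1,2,1,3,2,1,2,1,3])),
     Swap (Peel (Leaf [([], 10)] [1,2,1,2,1,3]) (Swap (Star (Leaf [([], 10), ([], 11)]
     [1,2,1,3,2,1,2,3]) (Leaf [([], 11), ([], 0)] [1,2,1,3,2,1,2,1,2,3,2,1,2,3]))))], [Peel (Leaf
     [([], 3)] [2,3]) (Star (Star (Leaf [([], 0), ([], 1)] [1,3,2,1]) (Leaf [([], 1), ([], 2)]
     [1,3,2,1,2,1,2,3,2,1])) (Star (Leaf [([], 2), ([], 4)] [3,2,1,2,1,3]) (Leaf [([], 4), ([],
     3)] [2,3,2,1,2,1,3,2,1,2,1,3]))), Peel (Leaf [([], 5)] [2,1,2,3,2,1,2,3]) (Star (Leaf [([],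
     3), ([], 6)] [2,1,3,2,1,2,1,3,2,1,2,3]) (Leaf [([], 6), ([], 5)]
     [2,1,2,3,2,1,2,1,3,2,1,2,1,3,2,1,2,3])), Star (Star (Leaf [([], 5), ([], 8)] [2,1,2,1,3,2])
     (Leaf [([], 8), ([], 7)] [2,1,2,1,2,3,2,1,2,1,3,2])) (Star (Leaf [([], 7), ([], 9)]
     [1,2,1,2,1,2,3,2,1,2]) (Leaf [([], 9), ([], 10)] [1,2,1,2,1,3,2,1,2,1,3,2,1,2])), Star (Leaf
     [([], 10), ([], 11)] [1,2,1,2]) (Leaf [([], 11), ([], 0)] [1,2,1,3,2,1,2,1])], [Peel (Leaf
     [([], 3)] [3,2]) (Star (Star (Leaf [([], 0), ([], 1)] [1,3,2,1,2,3]) (Leaf [([], 1), ([],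
     2)] [1,3,2,1,2,1,2,3,2,1,2,3])) (Star (Leaf [([], 2), ([], 4)] [3,2,1,2,1,2,3,2]) (Leaf
     [([], 4), ([], 3)] [3,2,1,2,1,3,2,1,2,1,3,2]))), Star (Leaf [([], 3), ([], 6)]
     [2,1,3,2,1,2]) (Leaf [([], 6), ([], 5)] [2,1,2,3,2,1,2,1,3,2,1,2]), Star (Star (Leaf [([],
     5), ([], 8)] [2,1,2,1]) (Leaf [([], 8), ([], 7)] [2,1,2,1,2,3,2,1,2,1])) (Star (Leaf [([],
     7), ([], 9)] [1,2,1,2,1,3,2,1]) (Leaf [([], 9), ([], 10)] [1,2,1,2,1,3,2,1,2,1,2,3,2,1])),
     Star (Leaf [([], 10), ([], 11)] [1,2,1,3]) (Leaf [([], 11), ([], 0)]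
     [1,2,1,3,2,1,2,1,2,3])], [Star (Swap (Peel (Leaf [([], 0)] [1,2,1]) (Swap (Star (Leaf [([],
     0), ([], 1)] [1,3,2,1,2]) (Leaf [([], 1), ([], 2)] [1,3,2,1,2,1,2,3,2,1,2]))))) (Peel (Leaf
     [([], 3)] [2,3,2]) (Star (Leaf [([], 2), ([], 4)] [3,2,1,2,1,3,2]) (Leaf [([], 4), ([], 3)]
     [2,3,2,1,2,1,3,2,1,2,1,3,2]))), Peel (Leaf [([], 5)] [2,1,2,1,3]) (Star (Leaf [([], 3), ([],
     6)] [2,1,3,2,1,2,3]) (Leaf [([], 6), ([], 5)] [2,1,2,3,2,1,2,1,3,2,1,2,3])), Star (Peel
     (Leaf [([], 7)] [1,2,1,2,1,2,3,2,1]) (Peel (Leaf [([], 7)] [2,1,2,1,2,3,2,1,2,1,3]) (Star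
     (Leaf [([], 5), ([], 8)] [2,1,2,1,3,2,1,2,1,3,2,1,2,1,3]) (Leaf [([], 8), ([], 7)]
     [2,1,2,1,2,3,2,1,2,1,3,2,1,2,1,3,2,1,2,1,3])))) (Star (Leaf [([], 7), ([], 9)]
     [1,2,1,2,1,3,2,1,2,1,3,2,1]) (Leaf [([], 9), ([], 10)]
     [1,2,1,2,1,3,2,1,2,1,2,3,2,1,2,1,3,2,1])), Star (Leaf [([], 10), ([], 11)]
     [1,2,1,2,3,2,1,2,1]) (Leaf [([], 11), ([], 0)] [1,2,1,3,2,1,2,1,3,2,1,2,1])], [Star (Star
     (Leaf [([], 0), ([], 1)] [1,2,3]) (Leaf [([], 1), ([], 2)] [1,3,2,1,2,1,3])) (Star (Leaf
     [([], 2), ([], 4)] [3,2,1]) (Leaf [([], 4), ([], 3)] [2,3,2,1,2,1,3,2,1])), Peel (Leaf [([],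
     5)] [2,1,2]) (Star (Leaf [([], 3), ([], 6)] [2,1,3,2,1,2,1]) (Leaf [([], 6), ([], 5)]
     [2,1,2,3,2,1,2,1,3,2,1,2,1])), Peel (Leaf [([], 10)] [1,2,1,2,1,3,2]) (Star (Peel (Leaf
     [([], 7)] [2,1,2,1,2,3,2,1,2]) (Star (Leaf [([], 5), ([], 8)] [2,1,2,1,3,2,1,2,1,3,2,1,2])
     (Leaf [([], 8), ([], 7)] [2,1,2,1,2,3,2,1,2,1,3,2,1,2,1,3,2,1,2]))) (Star (Leaf [([], 7),
     ([], 9)] [1,2,1,2,1,2,3,2,1,2,1,3,2]) (Leaf [([], 9), ([], 10)]
     [1,2,1,2,1,3,2,1,2,1,3,2,1,2,1,3,2]))), Star (Leaf [([], 10), ([], 11)] [1,2,1,2,3,2,1,2,3])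
     (Leaf [([], 11), ([], 0)] [1,2,1,3,2,1,2,1,3,2,1,2,3])], [Star (Star (Leaf [([], 0), ([],
     1)] [1,3,2]) (Leaf [([], 1), ([], 2)] [1,3,2,1,2,1,2,3,2])) (Star (Leaf [([], 2), ([], 4)]
     [3,2,1,2,3]) (Leaf [([], 4), ([], 3)] [2,3,2,1,2,1,3,2,1,2,3])), Star (Leaf [([], 3), ([],
     6)] [2,1,3]) (Leaf [([], 6), ([], 5)] [2,1,2,3,2,1,2,1,3]), Peel (Leaf [([], 10)]
     [1,2,1,2,1]) (Star (Star (Leaf [([], 5), ([], 8)] [2,1,2,1,3,2,1]) (Leaf [([], 8), ([], 7)]
     [2,1,2,1,2,3,2,1,2,1,3,2,1])) (Star (Leaf [([], 7), ([], 9)] [1,2,1,2,1,2,3,2,1,2,1]) (Leaf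
     [([], 9), ([], 10)] [1,2,1,2,1,3,2,1,2,1,3,2,1,2,1]))), Star (Leaf [([], 10), ([], 11)]
     [1,2,1,3,2,1,2]) (Leaf [([], 11), ([], 0)] [1,2,1,3,2,1,2,1,2,3,2,1,2])]]"

lemma growth_p6m_4612: "growth_fraction p6m_4612 [1,2,2,2,2,2,1] [1,-1,0,0,0,-1,1]"
proof (rule certified_growth)
  show "coded_presentation p6m_4612 [gR, gR1, gR2]
     [([1,1], []), ([2,2], []), ([3,3], []), ([2,3,2,3,2,3], []), ([3,1,3,1], []),
     ([1,2,1,2,1,2,1,2,1,2,1,2], [])] 3"
    unfolding p6m_4612_def by (rule coded_presentation.intro) (simp_all add: letter_of_def wpow_def eval_nat_numeral)
  \<comment> \<open>A is the product of the reflections R R1 R2 R1 R and R1, whose mirrors are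
    parallel, and B = R A R.\<close>
  show "group_ok 3
     [([1,1], []), ([2,2], []), ([3,3], []), ([2,3,2,3,2,3], []), ([3,1,3,1], []),
     ([1,2,1,2,1,2,1,2,1,2,1,2], [])]
     12 p6m_4612_table [1,2,3] [1,2,3,2,1,2] [2,3,2,1,2,1]
     [[], [1], [2], [3], [1,2], [1,3], [2,1], [2,3], [3,2], [1,2,1], [1,2,3], [1,3,2]]
     [([1,2,3,2,1,3,2], 6), ([1,2,3,2,1], 5), ([1], 4), ([1], 5), ([3,2,1], 5), ([3], 4)]
     [((3, 1), [([], 5)]), ((5, 1), [([1], 5)]), ((6, 3), [([2,1,3], 4)]), ((7, 1), [([2,3,1],
     4), ([2], 5)]), ((8, 1), [([3,2,1], 5), ([3], 4)]), ((8, 3), [([3], 4)]), ((9, 3),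
     [([1,2,1,3], 4)]), ((10, 1), [([1,2,3,1], 4), ([1,2], 5)]), ((11, 1), [([1,3,2,1], 5),
     ([1,3], 4)]), ((11, 3), [([1,3], 4)])]"
    by code_simp
  \<comment> \<open>Twelve plane sectors per coset, each spanned by a translation of length 6 and
    one of length 10, correspond to the twelve forms.\<close>
  show "trees_ok 3 p6m_4612_table 12
     [(-2, -4, [0,1,1,-1,2,0,2,0,-2,3,1,-1]), (-2, 6, [0,-1,1,1,-2,0,0,2,2,-3,-3,-1]), (-6, 2,
     [0,-1,1,-1,-2,-2,2,2,0,-1,-3,-3]), (4, 2, [0,1,-1,1,0,2,-2,0,2,-1,1,3]), (2, 4,
     [0,-1,-1,1,-2,0,-2,0,2,-3,-1,1]), (-4, -2, [0,-1,1,-1,0,-2,2,0,-2,1,-1,-3]), (6, -2,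
     [0,1,-1,1,2,2,-2,-2,0,1,3,3]), (2, -6, [0,1,-1,-1,2,0,0,-2,-2,3,3,1]), (6, -4,
     [0,1,-1,1,2,2,-2,-2,0,3,3,3]), (4, -6, [0,1,-1,-1,2,0,-2,-2,-2,3,3,1]), (-4, 6,
     [0,-1,1,1,-2,0,2,2,2,-3,-3,-1]), (-6, 4, [0,-1,1,-1,-2,-2,2,2,0,-3,-3,-3])]
     p6m_4612_loops p6m_4612_trees"
    by code_simp
  show "series_ok
     [1,0,0,0,0,0,-1,0,0,0,-1,0,0,0,0,0,1]
     [([6], [1,0,0,0,0,0,0,0,0,0,-1]), ([6,10], [1]), ([10,6], [1])]
     (concat (map (leaves p6m_4612_loops) (concat p6m_4612_trees)))
     [1,2,2,2,2,2,1] [1,-1,0,0,0,-1,1]"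
    by code_simp
qed

section \<open>The growth of the wallpaper groups\<close>

lemma growth_fraction_series:
  "growth_fraction p q (1 # d) \<Longrightarrow> series p = poly_fps q / poly_fps (1 # d)"
  by (rule series_quotient[OF growth_fractionD(1)])

text \<open>With \<open>of_int\<close> in place of \<open>fps_const\<close>, unfolding a concrete
  list gives an expression over numerals, on which \<open>algebra\<close> can settle the identities
  below.\<close>

lemma poly_fps_Cons: "poly_fps (a # p) = of_int a + fps_X * poly_fps p"
  by (simp add: fps_of_int)

lemma denominators:
  "poly_fps [1, -2, 1] = (1 - fps_X)\<^sup>2"
  "poly_fps [1, 0, -2, 0, 1] = (1 - fps_X\<^sup>2)\<^sup>2"
  "poly_fps [1, -1, 0, -1, 1] = (1 - fps_X)\<^sup>2 * (1 + fps_X + fps_X\<^sup>2)"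
  "poly_fps [1, -2, 3, -4, 3, -2, 1] = (1 - fps_X)\<^sup>2 * (1 + fps_X\<^sup>2)\<^sup>2"
  "poly_fps [1, -1, 0, 0, 0, -1, 1] = (1 - fps_X ^ 5) * (1 - fps_X)"
  unfolding poly_fps_Cons poly_fps.simps(1) of_int_1 of_int_0 of_int_numeral of_int_minus by algebra+

lemma numerators:
  "poly_fps [1, 4, 1] = fps_X\<^sup>2 + 4 * fps_X + 1"
  "poly_fps [1, 2, 1] = (1 + fps_X)\<^sup>2"
  "poly_fps [1, 1, 1] = fps_X\<^sup>2 + fps_X + 1"
  "poly_fps [1, 4, 6, 6, 3, -2] = - 2 * fps_X ^ 5 + 3 * fps_X ^ 4 + 6 * fps_X ^ 3 + 6 * fps_X\<^sup>2 + 4 * fps_X + 1"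
  "poly_fps [1, 2, 2, 2, 1] = (fps_X\<^sup>2 + 1) * (fps_X + 1)\<^sup>2"
  "poly_fps [1, 1, 1, 3, -1, 5, -3, 4, -2] = - 2 * fps_X ^ 8 + 4 * fps_X ^ 7 - 3 * fps_X ^ 6 + 5 * fps_X ^ 5
     - fps_X ^ 4 + 3 * fps_X ^ 3 + fps_X\<^sup>2 + fps_X + 1"
  "poly_fps [1, 2, 2, 2, 2, 2, 1] = (fps_X\<^sup>2 + fps_X + 1) * (fps_X\<^sup>2 - fps_X + 1) * (fps_X + 1)\<^sup>2"
  unfolding poly_fps_Cons poly_fps.simps(1) of_int_1 of_int_0 of_int_numeral of_int_minus by algebra+

theorem mainTheorem1:
  fixes z :: "real fps"
  assumes "z = fps_X"
  shows
    "(\<forall>p \<in> {p1_36, p3_36}.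
        series p = (z^2 + 4*z + 1) / (1 - z)^2 \<and>
        sph p 0 = 1 \<and> (\<forall>n>0. sph p n = 6 * real n) \<and>
        (\<forall>n. cum p n = 1 + 3 * real n * (real n + 1))) \<and>
     (\<forall>p \<in> {p1_44, p2_44, pm_44, pg_44, pmm_44, pgg_44}.
        series p = (1 + z)^2 / (1 - z)^2 \<and>
        sph p 0 = 1 \<and> (\<forall>n>0. sph p n = 4 * real n) \<and>
        (\<forall>n. cum p n = 1 + 2 * real n * (real n + 1))) \<and>
     (\<forall>p \<in> {p2_63, cm_63, pmg_63, p3m1_63}.
        series p = (z^2 + z + 1) / (1 - z)^2 \<and>
        sph p 0 = 1 \<and> (\<forall>n>0. sph p n = 3 * real n) \<and>
        (\<forall>n. cum p n = 1 + 3/2 * real n * (real n + 1))) \<and>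
     (\<forall>p \<in> {p3_3636}.
        series p = (-2*z^5 + 3*z^4 + 6*z^3 + 6*z^2 + 4*z + 1) / (1 - z^2)^2 \<and>
        sph p 0 = 1 \<and> sph p 1 = 4 \<and>
        (\<forall>n>1. (even n \<longrightarrow> sph p n = 5 * real n - 2) \<and>
               (odd n \<longrightarrow> sph p n = 4 * real n + 2)) \<and>
        cum p 0 = 1 \<and>
        (\<forall>n>1. (even n \<longrightarrow> cum p n = (9 * real n^2 + 10 * real n - 4) / 4) \<and>
               (odd n \<longrightarrow> cum p n = (9 * real n^2 + 8 * real n + 3) / 4))) \<and>
     (\<forall>p \<in> {cmm_488, p4_488, p4m_488, p4g_488}.
        series p = ((z^2 + 1) * (z + 1)^2) / ((1 - z)^2 * (1 + z + z^2)) \<and>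
        sph p 0 = 1 \<and>
        (\<forall>n>0. (n mod 3 = 0 \<longrightarrow> sph p n = 8 * real n / 3) \<and>
               (n mod 3 = 1 \<longrightarrow> sph p n = (8 * real n + 1) / 3) \<and>
               (n mod 3 = 2 \<longrightarrow> sph p n = (8 * real n - 1) / 3)) \<and>
        (\<forall>n>0. (n mod 3 = 0 \<longrightarrow> cum p n = (3 + 4 * real n * (real n + 1)) / 3) \<and>
               (n mod 3 = 1 \<longrightarrow> cum p n = (4 + 4 * real n * (real n + 1)) / 3) \<and>
               (n mod 3 = 2 \<longrightarrow> cum p n = (3 + 4 * real n * (real n + 1)) / 3))) \<and>
     (\<forall>p \<in> {p31m_31212, p6_31212}.
        series p = (-2*z^8 + 4*z^7 - 3*z^6 + 5*z^5 - z^4 + 3*z^3 + z^2 + z + 1)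
                     / ((1 - z)^2 * (1 + z^2)^2) \<and>
        sph p 0 = 1 \<and> sph p 1 = 3 \<and> sph p 2 = 4 \<and>
        (\<forall>n>2. (n mod 4 = 0 \<longrightarrow> sph p n = (5 * real n - 4) / 2) \<and>
               (n mod 4 = 1 \<longrightarrow> sph p n = (9 * real n + 3) / 4) \<and>
               (n mod 4 = 2 \<longrightarrow> sph p n = 2 * real n + 2) \<and>
               (n mod 4 = 3 \<longrightarrow> sph p n = (9 * real n - 3) / 4)) \<and>
        cum p 0 = 1 \<and> cum p 1 = 4 \<and>
        (\<forall>n>2. (n mod 4 = 0 \<longrightarrow> cum p n = (9 * real n^2 + 10 * real n - 8) / 8) \<and>
               (n mod 4 = 1 \<longrightarrow> cum p n = (9 * real n^2 + 10 * real n - 3) / 8) \<and>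
               (n mod 4 = 2 \<longrightarrow> cum p n = (9 * real n^2 + 8 * real n + 12) / 8) \<and>
               (n mod 4 = 3 \<longrightarrow> cum p n = (9 * real n^2 + 8 * real n + 7) / 8))) \<and>
     (\<forall>p \<in> {p6m_4612}.
        series p = ((z^2 + z + 1) * (z^2 - z + 1) * (z + 1)^2) / ((1 - z^5) * (1 - z)) \<and>
        sph p 0 = 1 \<and>
        (\<forall>n>0. (n mod 5 = 0 \<longrightarrow> sph p n = 12 * real n / 5) \<and>
               (n mod 5 = 1 \<longrightarrow> sph p n = (12 * real n + 3) / 5) \<and>
               (n mod 5 = 2 \<longrightarrow> sph p n = (12 * real n + 1) / 5) \<and>
               (n mod 5 = 3 \<longrightarrow> sph p n = (12 * real n - 1) / 5) \<and>
               (n mod 5 = 4 \<longrightarrow> sph p n = (12 * real n - 3) / 5)) \<and>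
        (\<forall>n>0. (n mod 5 = 0 \<longrightarrow> cum p n = (5 + 6 * real n * (real n + 1)) / 5) \<and>
               (n mod 5 = 1 \<longrightarrow> cum p n = (8 + 6 * real n * (real n + 1)) / 5) \<and>
               (n mod 5 = 2 \<longrightarrow> cum p n = (9 + 6 * real n * (real n + 1)) / 5) \<and>
               (n mod 5 = 3 \<longrightarrow> cum p n = (8 + 6 * real n * (real n + 1)) / 5) \<and>
               (n mod 5 = 4 \<longrightarrow> cum p n = (5 + 6 * real n * (real n + 1)) / 5)))"
proof -
  \<comment> \<open>The pattern names the seven family statements, so that each is proved for an
    arbitrary \<open>p\<close> with the right growth fraction.\<close>
  let "(\<forall>p\<in>_. ?P1 p) \<and> (\<forall>p\<in>_. ?P2 p) \<and> (\<forall>p\<in>_. ?P3 p) \<and> (\<forall>p\<in>_. ?P4 p) \<and>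
    (\<forall>p\<in>_. ?P5 p) \<and> (\<forall>p\<in>_. ?P6 p) \<and> (\<forall>p\<in>_. ?P7 p)" = ?thesis
  have 1: "\<forall>p\<in>{p1_36, p3_36}. ?P1 p"
  proof
    fix p assume "p \<in> {p1_36, p3_36}"
    then have G: "growth_fraction p [1, 4, 1] [1, -2, 1]"
      using growth_p1_36 growth_p3_36 by blast
    show "?P1 p"
      using growth_fraction_series[OF G] growth_linear[OF G] unfolding denominators numerators assms by simp
  qed
  have 2: "\<forall>p\<in>{p1_44, p2_44, pm_44, pg_44, pmm_44, pgg_44}. ?P2 p"
  proof
    fix p assume "p \<in> {p1_44, p2_44, pm_44, pg_44, pmm_44, pgg_44}"
    then have G: "growth_fraction p [1, 2, 1] [1, -2, 1]"
      using growth_p1_44 growth_p2_44 growth_pm_44 growth_pg_44 growth_pmm_44 growth_pgg_44 by blast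
    show "?P2 p"
      using growth_fraction_series[OF G] growth_linear[OF G] unfolding denominators numerators assms by simp
  qed
  have 3: "\<forall>p\<in>{p2_63, cm_63, pmg_63, p3m1_63}. ?P3 p"
  proof
    fix p assume "p \<in> {p2_63, cm_63, pmg_63, p3m1_63}"
    then have G: "growth_fraction p [1, 1, 1] [1, -2, 1]"
      using growth_p2_63 growth_cm_63 growth_pmg_63 growth_p3m1_63 by blast
    show "?P3 p"
      using growth_fraction_series[OF G] growth_linear[OF G] unfolding denominators numerators assms by simp
  qed
  have 4: "\<forall>p\<in>{p3_3636}. ?P4 p"
  proof
    fix p assume "p \<in> {p3_3636}"
    then have G: "growth_fraction p [1, 4, 6, 6, 3, -2] [1, 0, -2, 0, 1]"
      using growth_p3_3636 by blast
    show "?P4 p"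
      using growth_fraction_series[OF G] growth_3636[OF G] unfolding denominators numerators assms by blast
  qed
  have 5: "\<forall>p\<in>{cmm_488, p4_488, p4m_488, p4g_488}. ?P5 p"
  proof
    fix p assume "p \<in> {cmm_488, p4_488, p4m_488, p4g_488}"
    then have G: "growth_fraction p [1, 2, 2, 2, 1] [1, -1, 0, -1, 1]"
      using growth_cmm_488 growth_p4_488 growth_p4m_488 growth_p4g_488 by blast
    show "?P5 p"
      using growth_fraction_series[OF G] growth_488[OF G] unfolding denominators numerators assms by blast
  qed
  have 6: "\<forall>p\<in>{p31m_31212, p6_31212}. ?P6 p"
  proof
    fix p assume "p \<in> {p31m_31212, p6_31212}"
    then have G: "growth_fraction p [1, 1, 1, 3, -1, 5, -3, 4, -2] [1, -2, 3, -4, 3, -2, 1]"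
      using growth_p31m_31212 growth_p6_31212 by blast
    show "?P6 p"
      using growth_fraction_series[OF G] growth_31212[OF G] unfolding denominators numerators assms by blast
  qed
  have 7: "\<forall>p\<in>{p6m_4612}. ?P7 p"
  proof
    fix p assume "p \<in> {p6m_4612}"
    then have G: "growth_fraction p [1, 2, 2, 2, 2, 2, 1] [1, -1, 0, 0, 0, -1, 1]"
      using growth_p6m_4612 by blast
    show "?P7 p"
      using growth_fraction_series[OF G] growth_4612[OF G] unfolding denominators numerators assms by blast
  qed
  show ?thesis by (intro conjI 1 2 3 4 5 6 7)
qed

end
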